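(* Let $T$ be a tree with at least $4$ vertices, and let $G$ be a graph obtained from $T$ by adding a new vertex $v$ and edges from $v$ to vertices of $V(T)$ such that there is no proper 2-coloring of the vertices of $T$ in which the vertices in $N_G(v)$ are all the same color, but there is some vertex $u\in N_G(v)$ such that there is a proper 2-coloring of the vertices of $T$ in which the vertices of $N_G(v)\setminus\{u\}$ are all the same color. Then for every integer $t\geq 5$ and every real $d$ with $0<d\leq 1/2$, $$p(n;K_t,G,d)=n^{-2/(t-1)}.$$
   Context: $K_t$ is the complete graph on $t$ vertices and $N_G(v)$ is the neighborhood of $v$ in $G$. The density of an $n$-vertex graph is its number of edges divided by $\binom n2$. $G(n,p)$ is the binomial random graph on $[n]$, each edge present independently with probability $p$. "With high probability" means with probability tending to $1$ as $n\to\infty$. Ramsey property: a graph $\Gamma$ is $(H_1,H_2)$-Ramsey if every coloring of its edges with red and blue contains a red copy of $H_1$ or a blue copy of $H_2$ (copies need not be induced). Perturbed Ramsey threshold: for $0<d<1$ and graphs $H_1,H_2$, writing $p(n;H_1,H_2,d)=f(n)$ means that $f$ satisfies: (1) if $p=p(n)=\omega(f(n))$, then for any sequence $(G_n)_{n\in\mathbb{N}}$ of $n$-vertex graphs with density at least $d$, the graph $G_n\cup G(n,p)$ is $(H_1,H_2)$-Ramsey with high probability; and (2) if $p=p(n)=o(f(n))$, then for some sequence $(G_n)_{n\in\mathbb{N}}$ of $n$-vertex graphs with density at least $d$, the graph $G_n\cup G(n,p)$ is with high probability not $(H_1,H_2)$-Ramsey. (Here $G_n$ and $G(n,p)$ are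 on the same vertex set.) *)

theory Defs
  imports
    "HOL-Probability.Product_PMF"
    "HOL-Library.Landau_Symbols"
    "HOL-Library.Ramsey"
begin

section \<open>Finite simple graphs\<close>

text \<open>Edges are two-element vertex sets; \<open>nsets V 2\<close> is the set of all of them.\<close>

record 'a graph =
  vertices :: "'a set"
  edges :: "'a set set"

definition simple_graph :: "'a graph \<Rightarrow> bool" where
  "simple_graph \<Gamma> \<longleftrightarrow> finite (vertices \<Gamma>) \<and> edges \<Gamma> \<subseteq> nsets (vertices \<Gamma>) 2"

definition neighborhood :: "'a graph \<Rightarrow> 'a \<Rightarrow> 'a set" where
  "neighborhood \<Gamma> v = {u. {v, u} \<in> edges \<Gamma>}"

definition complete_graph :: "nat \<Rightarrow> nat graph" where
  "complete_graph t = \<lparr>vertices = {1..t}, edges = nsets {1..t} 2\<rparr>"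

definition graph_union :: "'a graph \<Rightarrow> 'a graph \<Rightarrow> 'a graph" where
  "graph_union \<Gamma> \<Delta> =
     \<lparr>vertices = vertices \<Gamma> \<union> vertices \<Delta>, edges = edges \<Gamma> \<union> edges \<Delta>\<rparr>"

definition add_vertex :: "'a graph \<Rightarrow> 'a \<Rightarrow> 'a set \<Rightarrow> 'a graph" where
  "add_vertex \<Gamma> v S =
     \<lparr>vertices = insert v (vertices \<Gamma>), edges = edges \<Gamma> \<union> {{v, u} | u. u \<in> S}\<rparr>"

definition density :: "'a graph \<Rightarrow> real" where
  "density \<Gamma> = real (card (edges \<Gamma>)) / real (card (vertices \<Gamma>) choose 2)"

definition connected_graph :: "'a graph \<Rightarrow> bool" where
  "connected_graph \<Gamma> \<longleftrightarrow> vertices \<Gamma> \<noteq> {} \<and>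
     (\<forall>u\<in>vertices \<Gamma>. \<forall>w\<in>vertices \<Gamma>. (\<lambda>x y. {x, y} \<in> edges \<Gamma>)\<^sup>*\<^sup>* u w)"

definition cycle_in :: "'a graph \<Rightarrow> 'a list \<Rightarrow> bool" where
  "cycle_in \<Gamma> xs \<longleftrightarrow> length xs \<ge> 3 \<and> distinct xs \<and>
     (\<forall>i<length xs. {xs ! i, xs ! (Suc i mod length xs)} \<in> edges \<Gamma>)"

definition tree :: "'a graph \<Rightarrow> bool" where
  "tree \<Gamma> \<longleftrightarrow> simple_graph \<Gamma> \<and> connected_graph \<Gamma> \<and> (\<nexists>xs. cycle_in \<Gamma> xs)"

text \<open>A proper 2-coloring is a proper coloring with colors in \<^typ>\<open>bool\<close>.\<close>

definition proper_coloring :: "'a graph \<Rightarrow> ('a \<Rightarrow> 'c) \<Rightarrow> bool" where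
  "proper_coloring \<Gamma> c \<longleftrightarrow> (\<forall>u w. {u, w} \<in> edges \<Gamma> \<longrightarrow> c u \<noteq> c w)"

definition monochromatic_on :: "('a \<Rightarrow> 'c) \<Rightarrow> 'a set \<Rightarrow> bool" where
  "monochromatic_on c S \<longleftrightarrow> (\<forall>x\<in>S. \<forall>y\<in>S. c x = c y)"


section \<open>The Ramsey property\<close>

definition contains_copy :: "'a graph \<Rightarrow> 'b graph \<Rightarrow> bool" where
  "contains_copy \<Gamma> H \<longleftrightarrow> (\<exists>f. inj_on f (vertices H) \<and> f ` vertices H \<subseteq> vertices \<Gamma> \<and>
     (\<forall>e\<in>edges H. f ` e \<in> edges \<Gamma>))"

datatype color = Red | Blue

definition color_class :: "'a graph \<Rightarrow> ('a set \<Rightarrow> color) \<Rightarrow> color \<Rightarrow> 'a graph" where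
  "color_class \<Gamma> c k = \<lparr>vertices = vertices \<Gamma>, edges = {e \<in> edges \<Gamma>. c e = k}\<rparr>"

definition ramsey_graph :: "'b graph \<Rightarrow> 'c graph \<Rightarrow> 'a graph \<Rightarrow> bool" where
  "ramsey_graph H\<^sub>1 H\<^sub>2 \<Gamma> \<longleftrightarrow> (\<forall>c. contains_copy (color_class \<Gamma> c Red) H\<^sub>1 \<or>
     contains_copy (color_class \<Gamma> c Blue) H\<^sub>2)"


section \<open>Perturbed Ramsey thresholds\<close>

definition binomial_random_graph :: "nat \<Rightarrow> real \<Rightarrow> nat graph pmf" where
  "binomial_random_graph n p =
     map_pmf (\<lambda>X. \<lparr>vertices = {1..n}, edges = {e \<in> nsets {1..n} 2. X e}\<rparr>)
       (Pi_pmf (nsets {1..n} 2) False (\<lambda>_. bernoulli_pmf p))"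

definition with_high_probability :: "(nat \<Rightarrow> 'a pmf) \<Rightarrow> (nat \<Rightarrow> 'a \<Rightarrow> bool) \<Rightarrow> bool" where
  "with_high_probability M P \<longleftrightarrow>
     (\<lambda>n. measure_pmf.prob (M n) {x. P n x}) \<longlonglongrightarrow> 1"

text \<open>
  For \<open>n < 2\<close> the density is 0/0, which HOL evaluates to 0. Requiring it to be at least
  \<open>d > 0\<close> there would leave no sequence at all, so the bound is imposed only for \<open>n \<ge> 2\<close>.
\<close>

definition dense_graph_sequence :: "real \<Rightarrow> (nat \<Rightarrow> nat graph) \<Rightarrow> bool" where
  "dense_graph_sequence d \<Gamma> \<longleftrightarrow> (\<forall>n. simple_graph (\<Gamma> n) \<and> vertices (\<Gamma> n) = {1..n} \<and>
     (n \<ge> 2 \<longrightarrow> density (\<Gamma> n) \<ge> d))"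

text \<open>The relation written \<open>p(n; H\<^sub>1, H\<^sub>2, d) = f(n)\<close>.\<close>

definition perturbed_ramsey_threshold ::
    "'a graph \<Rightarrow> 'b graph \<Rightarrow> real \<Rightarrow> (nat \<Rightarrow> real) \<Rightarrow> bool" where
  "perturbed_ramsey_threshold H\<^sub>1 H\<^sub>2 d f \<longleftrightarrow>
     (\<forall>p. (\<forall>n. 0 \<le> p n \<and> p n \<le> 1) \<and> p \<in> \<omega>(f) \<longrightarrow>
        (\<forall>\<Gamma>. dense_graph_sequence d \<Gamma> \<longrightarrow>
           with_high_probability (\<lambda>n. binomial_random_graph n (p n))
             (\<lambda>n R. ramsey_graph H\<^sub>1 H\<^sub>2 (graph_union (\<Gamma> n) R)))) \<and>
     (\<forall>p. (\<forall>n. 0 \<le> p n \<and> p n \<le> 1) \<and> p \<in> o(f) \<longrightarrow>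
        (\<exists>\<Gamma>. dense_graph_sequence d \<Gamma> \<and>
           with_high_probability (\<lambda>n. binomial_random_graph n (p n))
             (\<lambda>n R. \<not> ramsey_graph H\<^sub>1 H\<^sub>2 (graph_union (\<Gamma> n) R))))"

end

theory Submission
  imports Defs "HOL-Library.Transitive_Closure_Table"
begin

text \<open>
  Lower bound: if \<open>p\<close> is below the threshold, the random graph has no \<open>K\<^sub>t\<close>; colour the edges of
  a balanced complete bipartite graph blue and all others red, and recall that \<open>G\<close> is not bipartite.

  Upper bound: the tree \<open>T\<close> has a bipartition \<open>X\<close>, \<open>Y\<close> with \<open>u \<in> Y\<close> such that \<open>G\<close> without
  the edge \<open>uv\<close> is bipartite between \<open>X\<close> and \<open>Y \<union> {v}\<close>. By Janson's inequality the random graph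
  contains one copy of \<open>K\<^sub>t\<close> and many copies of \<open>G\<close> whose vertices have linearly many common
  neighbours in the dense graph. Pass to the linearly many common neighbours \<open>W\<close> with the most
  popular colour pattern towards these copies. If many of the pattern vertices are joined to \<open>W\<close>
  in blue, then a blue edge on either side gives a blue \<open>G\<close>, and otherwise there is a red \<open>K\<^sub>t\<close>.
  If not, some copy of \<open>G\<close> is joined to \<open>W\<close> in red. It contains a red edge, which forms a
  red \<open>K\<^sub>t\<close> with a red \<open>K\<^bsub>t-2\<^esub>\<close> inside \<open>W\<close>.

  So it suffices that whp every colouring of the random graph inside every linear vertex set has a
  red \<open>K\<^bsub>t-2\<^esub>\<close> or a blue \<open>G\<close>. This is a two-round argument. If the first round has no red
  \<open>K\<^bsub>t-2\<^esub>\<close>, its blue graph is dense relative to \<open>p\<close> in every linear set. Counting blue walks of length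
  two and embedding \<open>T\<close> greedily into cores of the neighbourhoods shows that a positive proportion of
  pairs close a blue \<open>G\<close>, and these pairs contain a positive proportion of all \<open>K\<^bsub>t-2\<^esub>\<close>. The second
  round contains one of them with probability so close to 1 that a union bound over all blue subgraphs
  of the first round succeeds. All the edges of that \<open>K\<^bsub>t-2\<^esub>\<close> must be red.
\<close>

section \<open>Random subsets of a finite set\<close>

text \<open>Three clique sizes occur because three union bounds have to be paid for. Write X = n^2
  p^(t-1). The Janson exponents are at least constant multiples of sqrt X for K_t, of n sqrt X for
  K_(t-1) and of n^2 p for K_(t-2). The first merely tends to infinity, so K_t is found only once,
  as part of the pattern; the second beats the 2^n vertex sets; only the third has the order of the
  number of random edges and can compete with the choice of a blue subgraph.

  In that last competition the constants matter. The first round has probability q = \<eta> p, and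
  density of its blue graph is measured relative to q, so that the constant in the exponent of the
  second round is fixed before \<eta> is chosen small.

  The bound t >= 5 enters twice. It makes n p^2 tend to infinity, so that the blue walks of length
  two outnumber error terms of order n^2. And it makes G no denser than K_t in the sense of
  \<open>sparse\<close>, so that copies of G come with K_t at no extra cost.\<close>

definition expect :: "'e set \<Rightarrow> real \<Rightarrow> ('e set \<Rightarrow> real) \<Rightarrow> real" where
  "expect P p F = (\<Sum>E\<in>Pow P. p ^ card E * (1 - p) ^ card (P - E) * F E)"

abbreviation pr :: "'e set \<Rightarrow> real \<Rightarrow> ('e set \<Rightarrow> bool) \<Rightarrow> real" where
  "pr P p Q \<equiv> expect P p (\<lambda>E. of_bool (Q E))"

lemma expect_empty [simp]: "expect {} p F = F {}"
  by (simp add: expect_def)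

text \<open>Conditioning on whether \<open>x\<close> is chosen. As \<open>expect\<close> is an
  explicit finite sum, this recursion and induction on \<open>P\<close> take the place of
  independence arguments; \<open>prob_binomial_random_graph\<close> makes the link to the random
  graph model.\<close>

lemma expect_insert:
  assumes "finite P" "x \<notin> P"
  shows "expect (insert x P) p F = p * expect P p (\<lambda>E. F (insert x E)) + (1 - p) * expect P p F"
proof -
  have disj: "Pow P \<inter> insert x ` Pow P = {}"
    using assms by auto
  have inj: "inj_on (insert x) (Pow P)"
    using assms by (auto simp: inj_on_def)
  have 1: "p ^ card E * (1 - p) ^ card (insert x P - E) = (1 - p) * (p ^ card E * (1 - p) ^ card (P - E))"
    if "E \<subseteq> P" for E
  proof -
    have "insert x P - E = insert x (P - E)" using that assms by auto
    then show ?thesis using assms by simp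
  qed
  have 2: "p ^ card (insert x E) * (1 - p) ^ card (insert x P - insert x E) = p * (p ^ card E * (1 - p) ^ card (P - E))"
    if "E \<subseteq> P" for E
  proof -
    have "insert x P - insert x E = P - E" using that assms by auto
    moreover have "finite E" "x \<notin> E" using that assms finite_subset by auto
    ultimately show ?thesis by simp
  qed
  have "expect (insert x P) p F = (\<Sum>E\<in>Pow P. (1 - p) * (p ^ card E * (1 - p) ^ card (P - E)) * F E) +
      (\<Sum>E\<in>Pow P. p * (p ^ card E * (1 - p) ^ card (P - E)) * F (insert x E))"
    unfolding expect_def Pow_insert
  proof (subst sum.union_disjoint)
    have "(\<Sum>E\<in>insert x ` Pow P. p ^ card E * (1 - p) ^ card (insert x P - E) * F E) =
        (\<Sum>E\<in>Pow P. p * (p ^ card E * (1 - p) ^ card (P - E)) * F (insert x E))"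
      unfolding sum.reindex[OF inj] o_def by (rule sum.cong) (use 2 in auto)
    moreover have "(\<Sum>E\<in>Pow P. p ^ card E * (1 - p) ^ card (insert x P - E) * F E) =
        (\<Sum>E\<in>Pow P. (1 - p) * (p ^ card E * (1 - p) ^ card (P - E)) * F E)"
      by (rule sum.cong) (use 1 in auto)
    ultimately show "(\<Sum>E\<in>Pow P. p ^ card E * (1 - p) ^ card (insert x P - E) * F E) +
       (\<Sum>E\<in>insert x ` Pow P. p ^ card E * (1 - p) ^ card (insert x P - E) * F E) =
      (\<Sum>E\<in>Pow P. (1 - p) * (p ^ card E * (1 - p) ^ card (P - E)) * F E) +
      (\<Sum>E\<in>Pow P. p * (p ^ card E * (1 - p) ^ card (P - E)) * F (insert x E))"
      by (rule arg_cong2[where f = "(+)", rotated])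
  qed (use assms(1) disj in auto)
  then show ?thesis
    by (simp add: expect_def sum_distrib_left mult.assoc)
qed

section \<open>Linearity, monotonicity and union bounds\<close>

lemma expect_cong:
  assumes "\<And>E. E \<subseteq> P \<Longrightarrow> F E = F' E"
  shows "expect P p F = expect P p F'"
  unfolding expect_def using assms by (auto intro!: sum.cong)

lemma expect_add: "expect P p (\<lambda>E. F E + F' E) = expect P p F + expect P p F'"
  by (simp add: expect_def algebra_simps sum.distrib)

lemma expect_diff: "expect P p (\<lambda>E. F E - F' E) = expect P p F - expect P p F'"
  by (simp add: expect_def algebra_simps sum_subtractf)

lemma expect_cmult: "expect P p (\<lambda>E. a * F E) = a * expect P p F"
  by (simp add: expect_def sum_distrib_left mult_ac)

lemma expect_sum: "expect P p (\<lambda>E. \<Sum>i\<in>I. F i E) = (\<Sum>i\<in>I. expect P p (F i))"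
  unfolding expect_def by (subst sum.swap) (simp add: sum_distrib_left)

lemma expect_mono:
  assumes "0 \<le> p" "p \<le> 1" "\<And>E. E \<subseteq> P \<Longrightarrow> F E \<le> F' E"
  shows "expect P p F \<le> expect P p F'"
  unfolding expect_def using assms by (intro sum_mono mult_left_mono) auto

lemma expect_const [simp]:
  assumes "finite P"
  shows "expect P p (\<lambda>_. a) = a"
  using assms
proof induction
  case (insert x P)
  then show ?case by (simp add: expect_insert algebra_simps)
qed simp

lemma expect_nonneg:
  assumes "0 \<le> p" "p \<le> 1" "\<And>E. E \<subseteq> P \<Longrightarrow> 0 \<le> F E"
  shows "0 \<le> expect P p F"
  unfolding expect_def using assms by (intro sum_nonneg mult_nonneg_nonneg) auto

lemma pr_union_bound:
  assumes "0 \<le> p" "p \<le> 1" "finite I"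
    and "\<And>E. E \<subseteq> P \<Longrightarrow> Q E \<Longrightarrow> \<exists>i\<in>I. R i E"
  shows "pr P p Q \<le> (\<Sum>i\<in>I. pr P p (R i))"
proof -
  have "pr P p Q \<le> expect P p (\<lambda>E. \<Sum>i\<in>I. of_bool (R i E))"
  proof (rule expect_mono)
    fix E assume E: "E \<subseteq> P"
    show "of_bool (Q E) \<le> (\<Sum>i\<in>I. of_bool (R i E) :: real)"
    proof (cases "Q E")
      case True
      then obtain i where "i \<in> I" "R i E" using assms E by blast
      then have "(1 :: real) \<le> (\<Sum>i\<in>I. of_bool (R i E))"
        using member_le_sum[of i I "\<lambda>i. of_bool (R i E) :: real"] assms(3) by simp
      then show ?thesis using True by simp
    qed (simp add: sum_nonneg)
  qed (use assms in auto)
  then show ?thesis by (simp add: expect_sum)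
qed

lemma pr_mono:
  assumes "0 \<le> p" "p \<le> 1" "\<And>E. E \<subseteq> P \<Longrightarrow> Q E \<Longrightarrow> R E"
  shows "pr P p Q \<le> pr P p R"
  using assms by (intro expect_mono) auto

lemma pr_disj_le:
  assumes "0 \<le> p" "p \<le> 1" "\<And>E. E \<subseteq> P \<Longrightarrow> Q E \<Longrightarrow> R E \<or> R' E"
  shows "pr P p Q \<le> pr P p R + pr P p R'"
  unfolding expect_add[symmetric] using assms
  by (intro expect_mono) (auto simp: of_bool_def)

text \<open>A fixed element lies in the union of both rounds with probability 1 - (1 - q)(1 - r),
  independently of the others. This is what allows the random graph to be exposed in two
  rounds.\<close>

lemma expect_two_rounds:
  assumes "finite P"
  shows "expect P q (\<lambda>E1. expect P r (\<lambda>E2. F (E1 \<union> E2))) = expect P (q + r - q * r) F"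
  using assms
proof (induction arbitrary: F)
  case (insert x P)
  have *: "expect P q (\<lambda>E1. expect P r (\<lambda>E2. F (insert x (E1 \<union> E2)))) = expect P (q + r - q * r) (\<lambda>E. F (insert x E))"
    using insert.IH[of "\<lambda>E. F (insert x E)"] .
  show ?case
    using insert.hyps insert.IH[of F] *
    by (simp add: expect_insert expect_add expect_cmult) (simp add: algebra_simps)
qed simp

text \<open>Given \<open>Z \<subseteq> E\<close>, the other elements are still chosen independently;
  the elements of \<open>Z\<close> are exposed one at a time.\<close>

lemma expect_superset:
  assumes "finite P" "Z \<subseteq> P"
  shows "expect P p (\<lambda>E. of_bool (Z \<subseteq> E) * F E) = p ^ card Z * expect (P - Z) p (\<lambda>E. F (E \<union> Z))"
proof -
  have "finite Z" using assms finite_subset by auto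
  then show ?thesis using assms
  proof (induction Z arbitrary: P F)
    case (insert z Z)
    let ?P = "P - {z}"
    have P: "P = insert z ?P" "finite ?P" using insert by auto
    have Z: "Z \<subseteq> ?P" using insert by auto
    have "expect P p (\<lambda>E. of_bool (insert z Z \<subseteq> E) * F E) =
        p * expect ?P p (\<lambda>E. of_bool (insert z Z \<subseteq> insert z E) * F (insert z E)) +
        (1 - p) * expect ?P p (\<lambda>E. of_bool (insert z Z \<subseteq> E) * F E)"
      using P by (subst P(1), subst expect_insert) auto
    also have "expect ?P p (\<lambda>E. of_bool (insert z Z \<subseteq> E) * F E) = expect ?P p (\<lambda>E. 0)"
      by (rule expect_cong) auto
    also have "expect ?P p (\<lambda>E. of_bool (insert z Z \<subseteq> insert z E) * F (insert z E)) =
        expect ?P p (\<lambda>E. of_bool (Z \<subseteq> E) * F (insert z E))"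
      using insert by (intro expect_cong) (auto simp: of_bool_def)
    also have "\<dots> = p ^ card Z * expect (?P - Z) p (\<lambda>E. F (insert z (E \<union> Z)))"
      using insert.IH[OF P(2) Z] by simp
    also have "?P - Z = P - insert z Z" by auto
    finally show ?case using insert.hyps P by (simp add: mult.assoc)
  qed simp
qed

lemma expect_ignore:
  assumes "finite P" "Z \<subseteq> P" "\<And>E. F (E - Z) = F E"
  shows "expect (P - Z) p F = expect P p F"
proof -
  have "finite Z" using assms finite_subset by auto
  then show ?thesis using assms
  proof (induction Z arbitrary: P)
    case (insert z Z)
    let ?P = "P - {z}"
    have P: "P = insert z ?P" "finite ?P" using insert by auto
    have Z: "Z \<subseteq> ?P" using insert by auto
    have F: "F (insert z E) = F E" for E
      using insert.prems(3)[of "insert z E"] insert.prems(3)[of E] by simp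
    have F': "F (E - Z) = F E" for E
    proof -
      have "insert z E - insert z Z = E - insert z Z" by auto
      then show ?thesis
        using insert.prems(3)[of "E - Z"] insert.prems(3)[of E] by (metis Diff_idemp Diff_insert)
    qed
    have "expect P p F = p * expect ?P p (\<lambda>E. F (insert z E)) + (1 - p) * expect ?P p F"
      using P by (subst P(1), subst expect_insert) auto
    also have "\<dots> = expect ?P p F" by (simp add: F algebra_simps)
    also have "\<dots> = expect (?P - Z) p F" using insert.IH[OF P(2) Z F'] by simp
    also have "?P - Z = P - insert z Z" by auto
    finally show ?case by simp
  qed simp
qed

text \<open>The case of the Harris inequality needed for Janson's inequality: forcing one more
  element into the random set can only lower a decreasing function.\<close>

lemma expect_antitone_le:
  assumes "finite P" "Z \<subseteq> P" "0 \<le> p" "p \<le> 1" "\<And>E E'. E \<subseteq> E' \<Longrightarrow> F E' \<le> F E"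
  shows "expect (P - Z) p (\<lambda>E. F (E \<union> Z)) \<le> expect P p F"
proof -
  have "finite Z" using assms(1,2) finite_subset by auto
  then show ?thesis using assms
  proof (induction Z arbitrary: P F)
    case (insert z Z)
    let ?P = "P - {z}"
    have P: "P = insert z ?P" "finite ?P" using insert by auto
    have Z: "Z \<subseteq> ?P" using insert by auto
    have *: "expect ?P p (\<lambda>E. F (insert z E)) \<le> expect ?P p F"
      using insert.prems(3,4) by (rule expect_mono) (rule insert.prems(5), auto)
    have "expect (P - insert z Z) p (\<lambda>E. F (E \<union> insert z Z)) = expect (?P - Z) p (\<lambda>E. F (insert z (E \<union> Z)))"
    proof -
      have "P - insert z Z = ?P - Z" by auto
      then show ?thesis by simp
    qed
    also have "\<dots> \<le> expect ?P p (\<lambda>E. F (insert z E))"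
      by (rule insert.IH[OF P(2) Z insert.prems(3,4)]) (rule insert.prems(5), rule insert_mono)
    also have "\<dots> = p * expect ?P p (\<lambda>E. F (insert z E)) + (1 - p) * expect ?P p (\<lambda>E. F (insert z E))"
      by (simp add: algebra_simps)
    also have "\<dots> \<le> p * expect ?P p (\<lambda>E. F (insert z E)) + (1 - p) * expect ?P p F"
      using * insert.prems by (intro add_left_mono mult_left_mono) auto
    also have "\<dots> = expect P p F"
      using P by (subst (3) P(1), subst expect_insert) auto
    finally show ?case .
  qed simp
qed

lemma pr_superset_and:
  assumes "finite P" "Z \<subseteq> P"
  shows "pr P p (\<lambda>E. Z \<subseteq> E \<and> Q E) = p ^ card Z * pr (P - Z) p (\<lambda>E. Q (E \<union> Z))"
  using expect_superset[OF assms, of p "\<lambda>E. of_bool (Q E)"] by (simp add: of_bool_conj)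

lemma pr_superset:
  assumes "finite P" "Z \<subseteq> P"
  shows "pr P p (\<lambda>E. Z \<subseteq> E) = p ^ card Z"
  using pr_superset_and[OF assms, of p "\<lambda>_. True"] assms by simp

text \<open>The probability generating function of a binomial variable. It serves as an exponential
  moment (\<open>y = exp 1\<close>) and, with \<open>p = 1 / 2\<close>, evaluates weighted sums over
  all subsets.\<close>

lemma expect_power_card:
  assumes "finite P" "Z \<subseteq> P"
  shows "expect P p (\<lambda>E. y ^ card (E \<inter> Z)) = (1 - p + p * y) ^ card Z"
proof -
  have "expect P p (\<lambda>E. y ^ card (E \<inter> Z)) = expect (P - (P - Z)) p (\<lambda>E. y ^ card (E \<inter> Z))"
    by (rule expect_ignore[symmetric])
       (use assms in \<open>auto intro!: arg_cong[where f = "\<lambda>A. y ^ card A"]\<close>)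
  also have "P - (P - Z) = Z" using assms by auto
  also have "expect Z p (\<lambda>E. y ^ card (E \<inter> Z)) = expect Z p (\<lambda>E. y ^ card E)"
    by (rule expect_cong) (simp add: Int_absorb2)
  also have "\<dots> = (1 - p + p * y) ^ card Z"
  proof -
    have "finite Z" using assms finite_subset by auto
    then show ?thesis
    proof induction
      case (insert x Z)
      have "expect Z p (\<lambda>E. y ^ card (insert x E)) = expect Z p (\<lambda>E. y * y ^ card E)"
        using insert.hyps by (intro expect_cong) (metis card_insert_disjoint finite_subset power_Suc subsetD)
      then show ?case using insert
        by (simp add: expect_insert expect_cmult algebra_simps)
    qed simp
  qed
  finally show ?thesis .
qed


section \<open>Janson's inequality\<close>

text \<open>One factor of the chain rule in the proof of Janson's inequality, in product form so
  that no conditional probability has to be divided out. The sets with index in \<open>I - D\<close>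
  are disjoint from \<open>S i\<close>, hence avoiding them is independent of
  \<open>S i \<subseteq> E\<close>; and avoiding them is a decreasing event, hence negatively
  correlated with \<open>S i \<union> S j \<subseteq> E\<close> for
  \<open>j \<in> D\<close>.\<close>

lemma prob_none_step:
  assumes P: "finite P" "0 \<le> p" "p \<le> 1"
    and I: "finite I" "i \<notin> I" "\<And>j. j \<in> insert i I \<Longrightarrow> S j \<subseteq> P"
  defines "D \<equiv> {j \<in> I. S j \<inter> S i \<noteq> {}}"
  shows "pr P p (\<lambda>E. \<forall>j\<in>insert i I. \<not> S j \<subseteq> E) \<le>
    pr P p (\<lambda>E. \<forall>j\<in>I. \<not> S j \<subseteq> E) * (1 - p ^ card (S i) + (\<Sum>j\<in>D. p ^ card (S i \<union> S j)))"
proof -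
  let ?N = "\<lambda>E. \<forall>j\<in>I. \<not> S j \<subseteq> E"
  let ?C = "\<lambda>E. \<forall>j\<in>I - D. \<not> S j \<subseteq> E"
  let ?s = "p ^ card (S i) - (\<Sum>j\<in>D. p ^ card (S i \<union> S j))"
  have Si: "S i \<subseteq> P" using I by auto
  have fD: "finite D" using I by (simp add: D_def)
  have ind: "pr P p (\<lambda>E. S i \<subseteq> E \<and> ?C E) = p ^ card (S i) * pr P p ?C"
  proof -
    have disj: "S j \<inter> S i = {}" if "j \<in> I - D" for j using that by (auto simp: D_def)
    have 1: "?C (E \<union> S i) = ?C E" for E
    proof (intro ball_cong refl)
      fix j assume "j \<in> I - D"
      then show "(\<not> S j \<subseteq> E \<union> S i) = (\<not> S j \<subseteq> E)" using disj[of j] by blast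
    qed
    have 2: "?C (E - S i) = ?C E" for E
    proof (intro ball_cong refl)
      fix j assume "j \<in> I - D"
      then show "(\<not> S j \<subseteq> E - S i) = (\<not> S j \<subseteq> E)" using disj[of j] by blast
    qed
    have "pr P p (\<lambda>E. S i \<subseteq> E \<and> ?C E) = p ^ card (S i) * pr (P - S i) p (\<lambda>E. ?C (E \<union> S i))"
      by (rule pr_superset_and[OF P(1) Si])
    also have "pr (P - S i) p (\<lambda>E. ?C (E \<union> S i)) = pr (P - S i) p ?C"
      using 1 by simp
    also have "\<dots> = pr P p ?C"
      by (rule expect_ignore[OF P(1) Si]) (use 2 in simp)
    finally show ?thesis .
  qed
  have corr: "pr P p (\<lambda>E. (S i \<union> S j \<subseteq> E) \<and> ?C E) \<le> p ^ card (S i \<union> S j) * pr P p ?C" if "j \<in> D" for j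
  proof -
    have sub: "S i \<union> S j \<subseteq> P" using that I by (auto simp: D_def)
    have "pr (P - (S i \<union> S j)) p (\<lambda>E. ?C (E \<union> (S i \<union> S j))) \<le> pr P p ?C"
      by (rule expect_antitone_le[OF P(1) sub P(2,3)]) (auto simp: of_bool_def)
    then show ?thesis
      using P by (subst pr_superset_and[OF P(1) sub]) (intro mult_left_mono, auto)
  qed
  have "pr P p (\<lambda>E. S i \<subseteq> E \<and> ?C E) - (\<Sum>j\<in>D. pr P p (\<lambda>E. (S i \<union> S j \<subseteq> E) \<and> ?C E))
      \<le> pr P p (\<lambda>E. S i \<subseteq> E \<and> ?N E)"
  proof -
    have "pr P p (\<lambda>E. S i \<subseteq> E \<and> ?C E) \<le> pr P p (\<lambda>E. S i \<subseteq> E \<and> ?N E) +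
       pr P p (\<lambda>E. \<exists>j\<in>D. S i \<union> S j \<subseteq> E \<and> ?C E)"
      by (rule pr_disj_le) (use P in auto)
    also have "pr P p (\<lambda>E. \<exists>j\<in>D. S i \<union> S j \<subseteq> E \<and> ?C E) \<le> (\<Sum>j\<in>D. pr P p (\<lambda>E. (S i \<union> S j \<subseteq> E) \<and> ?C E))"
      by (rule pr_union_bound) (use P fD in auto)
    finally show ?thesis by simp
  qed
  moreover have "(\<Sum>j\<in>D. pr P p (\<lambda>E. (S i \<union> S j \<subseteq> E) \<and> ?C E)) \<le> (\<Sum>j\<in>D. p ^ card (S i \<union> S j)) * pr P p ?C"
    unfolding sum_distrib_right by (intro sum_mono corr)
  ultimately have low: "?s * pr P p ?C \<le> pr P p (\<lambda>E. S i \<subseteq> E \<and> ?N E)"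
    unfolding ind by (simp add: algebra_simps)
  have NC: "pr P p ?N \<le> pr P p ?C"
    by (rule pr_mono) (use P in auto)
  have N0: "0 \<le> pr P p ?N" by (rule expect_nonneg) (use P in auto)
  \<comment> \<open>Replacing \<open>?C\<close> by the smaller event \<open>?N\<close> needs
    \<open>?s\<close> to be nonnegative; otherwise the left side is at most 0 anyway.\<close>
  have "?s * pr P p ?N \<le> pr P p (\<lambda>E. S i \<subseteq> E \<and> ?N E)"
  proof (cases "?s \<ge> 0")
    case True
    then have "?s * pr P p ?N \<le> ?s * pr P p ?C" using NC by (intro mult_left_mono)
    then show ?thesis using low by linarith
  next
    case False
    then have "?s * pr P p ?N \<le> 0" using N0 by (intro mult_nonpos_nonneg) auto
    also have "0 \<le> pr P p (\<lambda>E. S i \<subseteq> E \<and> ?N E)" by (rule expect_nonneg) (use P in auto)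
    finally show ?thesis .
  qed
  moreover have "pr P p ?N = pr P p (\<lambda>E. S i \<subseteq> E \<and> ?N E) + pr P p (\<lambda>E. \<forall>j\<in>insert i I. \<not> S j \<subseteq> E)"
    unfolding expect_add[symmetric] by (intro expect_cong) (auto simp: of_bool_def)
  ultimately show ?thesis by (simp add: algebra_simps)
qed

text \<open>A term of the correlation sum in Janson's inequality. Ordered pairs are used, so every
  unordered pair counts twice, whence the division by 2 in \<open>janson\<close>.\<close>

definition dep_weight :: "real \<Rightarrow> ('i \<Rightarrow> 'e set) \<Rightarrow> 'i \<Rightarrow> 'i \<Rightarrow> real" where
  "dep_weight p S a b = of_bool (a \<noteq> b \<and> S b \<inter> S a \<noteq> {}) * p ^ card (S a \<union> S b)"

text \<open>The indices are inserted one by one, and each factor 1 + x from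
  \<open>prob_none_step\<close> is at most exp x.\<close>

lemma janson:
  assumes P: "finite P" "0 \<le> p" "p \<le> 1"
    and I: "finite I" "\<And>j. j \<in> I \<Longrightarrow> S j \<subseteq> P"
  shows "pr P p (\<lambda>E. \<forall>j\<in>I. \<not> S j \<subseteq> E) \<le>
    exp (- (\<Sum>i\<in>I. p ^ card (S i)) + (\<Sum>a\<in>I. \<Sum>b\<in>I. dep_weight p S a b) / 2)"
  using I
proof (induction I)
  case empty
  then show ?case using P by simp
next
  case (insert i I)
  let ?w = "dep_weight p S"
  have w_sym: "?w a b = ?w b a" for a b by (auto simp: dep_weight_def Un_commute Int_commute)
  have w0: "?w a a = 0" for a by (simp add: dep_weight_def)
  have D: "(\<Sum>j\<in>{j \<in> I. S j \<inter> S i \<noteq> {}}. p ^ card (S i \<union> S j)) = (\<Sum>b\<in>I. ?w i b)"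
    unfolding dep_weight_def using insert.hyps by (intro sum.mono_neutral_cong_left) auto
  have split: "(\<Sum>a\<in>insert i I. \<Sum>b\<in>insert i I. ?w a b) = (\<Sum>a\<in>I. \<Sum>b\<in>I. ?w a b) + 2 * (\<Sum>b\<in>I. ?w i b)"
    using insert.hyps by (simp add: sum.distrib w0 w_sym[of _ i])
  define x where "x = (\<Sum>b\<in>I. ?w i b) - p ^ card (S i)"
  have IH: "pr P p (\<lambda>E. \<forall>j\<in>I. \<not> S j \<subseteq> E) \<le> exp (- (\<Sum>i\<in>I. p ^ card (S i)) + (\<Sum>a\<in>I. \<Sum>b\<in>I. ?w a b) / 2)"
    using insert.IH insert.prems by auto
  have "pr P p (\<lambda>E. \<forall>j\<in>insert i I. \<not> S j \<subseteq> E) \<le> pr P p (\<lambda>E. \<forall>j\<in>I. \<not> S j \<subseteq> E) * (1 + x)"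
    using prob_none_step[OF P insert.hyps(1,2), of S] insert.prems unfolding D x_def by (simp add: algebra_simps)
  also have "\<dots> \<le> pr P p (\<lambda>E. \<forall>j\<in>I. \<not> S j \<subseteq> E) * exp x"
    using exp_ge_add_one_self[of x] P by (intro mult_left_mono expect_nonneg) auto
  also have "\<dots> \<le> exp (- (\<Sum>i\<in>I. p ^ card (S i)) + (\<Sum>a\<in>I. \<Sum>b\<in>I. ?w a b) / 2) * exp x"
    using IH by (intro mult_right_mono) auto
  also have "\<dots> = exp (- (\<Sum>i\<in>insert i I. p ^ card (S i)) + (\<Sum>a\<in>insert i I. \<Sum>b\<in>insert i I. ?w a b) / 2)"
    unfolding exp_add[symmetric] split x_def using insert.hyps by (simp add: algebra_simps)
  finally show ?case .
qed

text \<open>Useful when the correlation sum exceeds the mean. Unlike \<open>dep_weight\<close>, the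
  sum bounded by \<Delta> includes the diagonal, which forces \<mu> \<le> \<Delta>, so that the
  sampling density \<mu> / \<Delta> is a probability without a case distinction.\<close>

lemma janson_extended:
  assumes P: "finite P" "0 < p" "p \<le> 1"
    and I: "finite I" "I \<noteq> {}" "\<And>j. j \<in> I \<Longrightarrow> S j \<subseteq> P" "\<And>j. j \<in> I \<Longrightarrow> S j \<noteq> {}"
    and \<mu>: "\<mu> = (\<Sum>i\<in>I. p ^ card (S i))"
    and \<Delta>: "(\<Sum>i\<in>I. \<Sum>j\<in>{j \<in> I. S j \<inter> S i \<noteq> {}}. p ^ card (S i \<union> S j)) \<le> \<Delta>"
  shows "pr P p (\<lambda>E. \<forall>j\<in>I. \<not> S j \<subseteq> E) \<le> exp (- \<mu>\<^sup>2 / (2 * \<Delta>))"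
proof -
  let ?w = "dep_weight p S"
  have \<mu>_pos: "0 < \<mu>" unfolding \<mu> using I P by (intro sum_pos) auto
  have \<mu>_le: "\<mu> \<le> \<Delta>"
  proof -
    have "\<mu> \<le> (\<Sum>i\<in>I. \<Sum>j\<in>{j \<in> I. S j \<inter> S i \<noteq> {}}. p ^ card (S i \<union> S j))"
      unfolding \<mu>
    proof (rule sum_mono)
      fix i assume i: "i \<in> I"
      then show "p ^ card (S i) \<le> (\<Sum>j\<in>{j \<in> I. S j \<inter> S i \<noteq> {}}. p ^ card (S i \<union> S j))"
        using member_le_sum[of i "{j \<in> I. S j \<inter> S i \<noteq> {}}" "\<lambda>j. p ^ card (S i \<union> S j)"] I P by simp
    qed
    then show ?thesis using \<Delta> by simp
  qed
  have W_le: "(\<Sum>a\<in>I. \<Sum>b\<in>I. ?w a b) \<le> \<Delta>"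
  proof -
    have "(\<Sum>b\<in>I. ?w a b) \<le> (\<Sum>b\<in>{b \<in> I. S b \<inter> S a \<noteq> {}}. p ^ card (S a \<union> S b))" for a
    proof -
      have "(\<Sum>b\<in>I. ?w a b) = (\<Sum>b\<in>{b \<in> I. S b \<inter> S a \<noteq> {}}. ?w a b)"
        using I(1) by (intro sum.mono_neutral_right) (auto simp: dep_weight_def)
      also have "\<dots> \<le> (\<Sum>b\<in>{b \<in> I. S b \<inter> S a \<noteq> {}}. p ^ card (S a \<union> S b))"
        using P(2) by (intro sum_mono) (simp add: dep_weight_def)
      finally show ?thesis .
    qed
    then have "(\<Sum>a\<in>I. \<Sum>b\<in>I. ?w a b) \<le> (\<Sum>i\<in>I. \<Sum>j\<in>{j \<in> I. S j \<inter> S i \<noteq> {}}. p ^ card (S i \<union> S j))"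
      by (rule sum_mono)
    then show ?thesis using \<Delta> by simp
  qed
  \<comment> \<open>The maximiser of \<open>q * \<mu> - q\<^sup>2 / 2 * \<Delta>\<close>, with
    maximum \<open>\<mu>\<^sup>2 / (2 * \<Delta>)\<close>.\<close>
  define q where "q = \<mu> / \<Delta>"
  have q: "0 \<le> q" "q \<le> 1" using \<mu>_pos \<mu>_le by (auto simp: q_def)
  define f where "f = (\<lambda>J. (\<Sum>i\<in>J. p ^ card (S i)) - (\<Sum>a\<in>J. \<Sum>b\<in>J. ?w a b) / 2)"
  have f_eq: "f J = (\<Sum>i\<in>I. p ^ card (S i) * of_bool ({i} \<subseteq> J)) - (\<Sum>a\<in>I. \<Sum>b\<in>I. (?w a b / 2) * of_bool ({a, b} \<subseteq> J))"
    if "J \<subseteq> I" for J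
  proof -
    have "finite J" using that I(1) finite_subset by auto
    have "(\<Sum>i\<in>J. p ^ card (S i)) = (\<Sum>i\<in>I. p ^ card (S i) * of_bool ({i} \<subseteq> J))"
      using that I(1) by (intro sum.mono_neutral_cong_left) auto
    moreover have "(\<Sum>a\<in>J. \<Sum>b\<in>J. ?w a b / 2) = (\<Sum>a\<in>I. \<Sum>b\<in>J. ?w a b / 2 * of_bool (a \<in> J))"
      using that I(1) by (intro sum.mono_neutral_cong_left) (use \<open>finite J\<close> in auto)
    moreover have "\<dots> = (\<Sum>a\<in>I. \<Sum>b\<in>I. (?w a b / 2) * of_bool ({a, b} \<subseteq> J))"
    proof (rule sum.cong[OF refl])
      fix a assume "a \<in> I"
      show "(\<Sum>b\<in>J. ?w a b / 2 * of_bool (a \<in> J)) = (\<Sum>b\<in>I. (?w a b / 2) * of_bool ({a, b} \<subseteq> J))"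
        using that I(1) by (intro sum.mono_neutral_cong_left) auto
    qed
    ultimately show ?thesis by (simp add: f_def sum_divide_distrib)
  qed
  \<comment> \<open>A random subfamily of density \<open>q\<close> trades the linear term against the quadratic one.\<close>
  have "expect I q f = expect I q (\<lambda>J. (\<Sum>i\<in>I. p ^ card (S i) * of_bool ({i} \<subseteq> J)) - (\<Sum>a\<in>I. \<Sum>b\<in>I. (?w a b / 2) * of_bool ({a, b} \<subseteq> J)))"
    by (rule expect_cong) (rule f_eq)
  also have "\<dots> = (\<Sum>i\<in>I. p ^ card (S i) * q) - (\<Sum>a\<in>I. \<Sum>b\<in>I. (?w a b / 2) * q ^ card {a, b})"
    unfolding expect_diff expect_sum expect_cmult
    by (intro arg_cong2[where f = "(-)"] arg_cong2[where f = "(*)"] sum.cong refl; subst pr_superset; use I(1) in simp)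
  \<comment> \<open>The weight vanishes for \<open>a = b\<close>, so \<open>card {a, b}\<close> may
    be taken to be 2 throughout.\<close>
  also have "(\<Sum>a\<in>I. \<Sum>b\<in>I. (?w a b / 2) * q ^ card {a, b}) = (\<Sum>a\<in>I. \<Sum>b\<in>I. ?w a b * (q\<^sup>2 / 2))"
    by (intro sum.cong refl) (auto simp: dep_weight_def power2_eq_square)
  also have "(\<Sum>i\<in>I. p ^ card (S i) * q) - (\<Sum>a\<in>I. \<Sum>b\<in>I. ?w a b * (q\<^sup>2 / 2)) = q * \<mu> - (q\<^sup>2 / 2) * (\<Sum>a\<in>I. \<Sum>b\<in>I. ?w a b)"
    by (simp add: \<mu> sum_distrib_left sum_distrib_right mult_ac)
  finally have Ef: "expect I q f \<ge> q * \<mu> - q\<^sup>2 / 2 * \<Delta>"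
    using mult_left_mono[OF W_le, of "q\<^sup>2 / 2"] by simp
  have "\<exists>J\<subseteq>I. expect I q f \<le> f J"
  proof (rule ccontr)
    assume *: "\<not> (\<exists>J\<subseteq>I. expect I q f \<le> f J)"
    have less: "f J < expect I q f" if "J \<subseteq> I" for J
      using * that by (meson not_le)
    let ?M = "Max (f ` Pow I)"
    have M: "?M \<in> f ` Pow I" using I by (intro Max_in) auto
    have "expect I q f \<le> expect I q (\<lambda>_. ?M)"
      using q I by (intro expect_mono) auto
    also have "\<dots> = ?M" using I by simp
    also have "\<dots> < expect I q f" using M less by auto
    finally show False by simp
  qed
  then obtain J where J: "J \<subseteq> I" "expect I q f \<le> f J" by blast
  have "q * \<mu> - q\<^sup>2 / 2 * \<Delta> = \<mu>\<^sup>2 / (2 * \<Delta>)"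
    using \<mu>_pos \<mu>_le by (simp add: q_def field_simps power2_eq_square)
  then have fJ: "\<mu>\<^sup>2 / (2 * \<Delta>) \<le> f J" using J Ef by linarith
  have fin: "finite J" using finite_subset[OF J(1) I(1)] .
  have "pr P p (\<lambda>E. \<forall>j\<in>I. \<not> S j \<subseteq> E) \<le> pr P p (\<lambda>E. \<forall>j\<in>J. \<not> S j \<subseteq> E)"
    using P J by (intro pr_mono) auto
  also have "\<dots> \<le> exp (- f J)"
    using janson[OF P(1) _ P(3) fin, of S] P(2) J(1) I(3) unfolding f_def by auto
  also have "\<dots> \<le> exp (- \<mu>\<^sup>2 / (2 * \<Delta>))" using fJ by simp
  finally show ?thesis .
qed


text \<open>Janson's inequality for copies of a fixed graph given by a positive proportion of all
  maps. Pairs of maps \<phi>, \<psi> are grouped by the set \<open>J\<close> of vertices that \<psi>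
  sends into the image of \<phi>. Such a coincidence loses a factor n for each vertex of
  \<open>J\<close> and gains a factor 1/p for each edge that can be shared, so the least expected
  number \<open>M\<close> of copies of a subgraph controls the whole sum.\<close>

lemma janson_embed:
  fixes \<F> :: "('b \<Rightarrow> nat) set"
  assumes V: "finite V" "EF \<subseteq> nsets V 2" "EF \<noteq> {}"
    and P: "finite P" "0 < p" "p \<le> 1"
    and \<F>: "\<F> \<subseteq> V \<rightarrow>\<^sub>E {1..n}" "\<And>\<phi>. \<phi> \<in> \<F> \<Longrightarrow> inj_on \<phi> V" "\<And>\<phi> e. \<phi> \<in> \<F> \<Longrightarrow> e \<in> EF \<Longrightarrow> \<phi> ` e \<in> P"
    and card_\<F>: "0 < \<gamma>" "\<gamma> * real n ^ card V \<le> card \<F>"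
    and M: "0 < M" "\<And>J. J \<subseteq> V \<Longrightarrow> {e \<in> EF. e \<subseteq> J} \<noteq> {} \<Longrightarrow> M \<le> real n ^ card J * p ^ card {e \<in> EF. e \<subseteq> J}"
  shows "pr P p (\<lambda>E. \<forall>\<phi>\<in>\<F>. \<not> (`) \<phi> ` EF \<subseteq> E) \<le> exp (- \<gamma> * M / (2 * (2 * card V) ^ card V))"
proof -
  define k m where "k = card V" and "m = card EF"
  define S where "S = (\<lambda>\<phi>::'b \<Rightarrow> nat. (`) \<phi> ` EF)"
  have eV: "e \<subseteq> V" if "e \<in> EF" for e using V that by (auto simp: nsets_def)
  have fEF: "finite EF" using V by (auto intro: finite_subset finite_imp_finite_nsets)
  have fF: "finite \<F>" using \<F>(1) V by (auto intro: finite_subset finite_PiE)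
  have "{e \<in> EF. e \<subseteq> V} = EF" using eV by auto
  then have MV: "M \<le> real n ^ k * p ^ m" using M(2)[of V] V(3) by (simp add: k_def m_def)
  obtain e0 where "e0 \<in> EF" using V by auto
  then have k2: "k \<ge> 2"
    using V card_mono[of V e0] by (auto simp: nsets_def k_def)
  have n: "n > 0"
  proof (rule ccontr)
    assume "\<not> n > 0"
    then show False using MV M k2 by (simp add: power_0_left)
  qed
  have F_ne: "\<F> \<noteq> {}"
  proof
    assume "\<F> = {}"
    then have "\<gamma> * real n ^ card V \<le> 0" using card_\<F> by simp
    moreover have "0 < \<gamma> * real n ^ card V" using card_\<F>(1) n by simp
    ultimately show False by simp
  qed
  have cS: "card (S \<phi>) = m" if "\<phi> \<in> \<F>" for \<phi>
  proof -
    have "inj_on ((`) \<phi>) EF"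
      using inj_on_subset[OF inj_on_image_Pow[OF \<F>(2)[OF that]]] eV by blast
    then show ?thesis by (simp add: S_def card_image m_def)
  qed
  have fS: "finite (S \<phi>)" for \<phi> using fEF by (simp add: S_def)
  define Jof where "Jof = (\<lambda>\<phi> \<psi>. {a \<in> V. (\<psi> a :: nat) \<in> \<phi> ` V})"
  \<comment> \<open>Bound for one row of the correlation sum: 2^k choices of \<open>J\<close>, at
    most k^k ways to map \<open>J\<close> into the image of \<phi>, and the division by
    \<open>M\<close> from the hypothesis on subgraphs.\<close>
  define K where "K = (2 * real k) ^ k * real n ^ k * p ^ (2 * m) / M"
  have row: "(\<Sum>\<psi>\<in>{\<psi> \<in> \<F>. S \<psi> \<inter> S \<phi> \<noteq> {}}. p ^ card (S \<phi> \<union> S \<psi>)) \<le> K" if \<phi>: "\<phi> \<in> \<F>" for \<phi>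
  proof -
    let ?A = "{\<psi> \<in> \<F>. S \<psi> \<inter> S \<phi> \<noteq> {}}"
    \<comment> \<open>Common edges lie inside \<open>J\<close>, so the union of both edge sets has
      at least 2m - e(J) elements.\<close>
    have weight: "p ^ card (S \<phi> \<union> S \<psi>) * M \<le> real n ^ card (Jof \<phi> \<psi>) * p ^ (2 * m)" if \<psi>: "\<psi> \<in> ?A" for \<psi>
    proof -
      let ?J = "Jof \<phi> \<psi>" let ?EJ = "{e \<in> EF. e \<subseteq> ?J}"
      have sub: "S \<phi> \<inter> S \<psi> \<subseteq> (`) \<psi> ` ?EJ"
      proof
        fix x assume x: "x \<in> S \<phi> \<inter> S \<psi>"
        then obtain e e' where e: "e \<in> EF" "x = \<psi> ` e" "e' \<in> EF" "x = \<phi> ` e'" by (auto simp: S_def)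
        moreover have "\<psi> ` e \<subseteq> \<phi> ` V" using e(2,4) eV[OF e(3)] by blast
          ultimately have "e \<subseteq> ?J" using eV[OF e(1)] by (auto simp: Jof_def)
        then show "x \<in> (`) \<psi> ` ?EJ" using e by auto
      qed
      have "card (S \<phi> \<inter> S \<psi>) \<le> card ?EJ"
        using surj_card_le[OF _ sub] fEF by simp
      moreover have "card (S \<phi>) + card (S \<psi>) = card (S \<phi> \<union> S \<psi>) + card (S \<phi> \<inter> S \<psi>)"
        by (rule card_Un_Int[OF fS fS])
      ultimately have le: "2 * m \<le> card (S \<phi> \<union> S \<psi>) + card ?EJ"
        using cS \<phi> \<psi> by auto
      have "?EJ \<noteq> {}" using sub \<psi> by blast
      then have "M \<le> real n ^ card ?J * p ^ card ?EJ" by (intro M(2)) (auto simp: Jof_def)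
      then have "p ^ card (S \<phi> \<union> S \<psi>) * M \<le> p ^ card (S \<phi> \<union> S \<psi>) * (real n ^ card ?J * p ^ card ?EJ)"
        using P by (intro mult_left_mono) auto
      also have "\<dots> = real n ^ card ?J * p ^ (card (S \<phi> \<union> S \<psi>) + card ?EJ)" by (simp add: power_add)
      also have "\<dots> \<le> real n ^ card ?J * p ^ (2 * m)"
        using P le by (intro mult_left_mono power_decreasing) auto
      finally show ?thesis .
    qed
    have cnt: "real (card {\<psi> \<in> ?A. Jof \<phi> \<psi> = J}) \<le> real k ^ k * real n ^ (k - card J)" if J: "J \<subseteq> V" for J
    proof -
      let ?B = "\<lambda>a. if a \<in> J then \<phi> ` V else {1..n}"
      have "{\<psi> \<in> ?A. Jof \<phi> \<psi> = J} \<subseteq> Pi\<^sub>E V ?B"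
      proof
        fix \<psi> assume \<psi>: "\<psi> \<in> {\<psi> \<in> ?A. Jof \<phi> \<psi> = J}"
        then have "\<psi> \<in> V \<rightarrow>\<^sub>E {1..n}" using \<F>(1) by auto
        moreover have "a \<in> J \<longleftrightarrow> \<psi> a \<in> \<phi> ` V" if "a \<in> V" for a
          using \<psi> that by (auto simp: Jof_def)
        ultimately show "\<psi> \<in> Pi\<^sub>E V ?B" by (simp add: PiE_iff)
      qed
      then have "card {\<psi> \<in> ?A. Jof \<phi> \<psi> = J} \<le> card (Pi\<^sub>E V ?B)"
        using V by (intro card_mono finite_PiE) auto
      also have "\<dots> = (\<Prod>a\<in>V. card (?B a))" by (rule card_PiE[OF V(1)])
      also have "\<dots> \<le> (\<Prod>a\<in>V. if a \<in> J then k else n)"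
        using V by (intro prod_mono) (auto simp: k_def card_image_le)
      also have "\<dots> = k ^ card J * n ^ card (V - J)"
        using J V by (subst prod.If_cases) (auto simp: Int_absorb1 Diff_eq[symmetric])
      also have "card (V - J) = k - card J" using J V by (simp add: k_def card_Diff_subset finite_subset)
      also have "k ^ card J * n ^ (k - card J) \<le> k ^ k * n ^ (k - card J)"
        using k2 J V by (intro mult_right_mono power_increasing) (auto simp: k_def card_mono)
      finally show ?thesis
        by (metis (mono_tags, lifting) of_nat_le_iff of_nat_mult of_nat_power)
    qed
    have "(\<Sum>\<psi>\<in>?A. p ^ card (S \<phi> \<union> S \<psi>)) * M \<le> (\<Sum>\<psi>\<in>?A. real n ^ card (Jof \<phi> \<psi>) * p ^ (2 * m))"
      unfolding sum_distrib_right by (intro sum_mono weight)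
    also have "\<dots> = (\<Sum>J\<in>Pow V. \<Sum>\<psi>\<in>{\<psi> \<in> ?A. Jof \<phi> \<psi> = J}. real n ^ card (Jof \<phi> \<psi>) * p ^ (2 * m))"
      using fF V by (intro sum.group[symmetric]) (auto simp: Jof_def)
    also have "\<dots> = (\<Sum>J\<in>Pow V. real (card {\<psi> \<in> ?A. Jof \<phi> \<psi> = J}) * (real n ^ card J * p ^ (2 * m)))"
      by (intro sum.cong refl) simp
    also have "\<dots> \<le> (\<Sum>J\<in>Pow V. (real k ^ k * real n ^ (k - card J)) * (real n ^ card J * p ^ (2 * m)))"
      using P by (intro sum_mono mult_right_mono cnt) auto
    also have "\<dots> = (\<Sum>J\<in>Pow V. real k ^ k * real n ^ k * p ^ (2 * m))"
    proof (rule sum.cong[OF refl])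
      fix J assume "J \<in> Pow V"
      then have "card J \<le> k" using V by (simp add: k_def card_mono)
      then have "real n ^ k = real n ^ (k - card J) * real n ^ card J"
        by (metis le_add_diff_inverse2 power_add)
      then show "(real k ^ k * real n ^ (k - card J)) * (real n ^ card J * p ^ (2 * m)) = real k ^ k * real n ^ k * p ^ (2 * m)"
        by simp
    qed
    also have "\<dots> = (2 * real k) ^ k * real n ^ k * p ^ (2 * m)"
      using V by (simp add: card_Pow k_def power_mult_distrib)
    finally show ?thesis using M(1) by (simp add: K_def field_simps)
  qed
  have K0: "K > 0" using k2 n P M by (simp add: K_def)
  have "pr P p (\<lambda>E. \<forall>\<phi>\<in>\<F>. \<not> S \<phi> \<subseteq> E) \<le> exp (- (real (card \<F>) * p ^ m)\<^sup>2 / (2 * (real (card \<F>) * K)))"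
  proof (rule janson_extended[OF P fF F_ne])
    show "S \<phi> \<subseteq> P" if "\<phi> \<in> \<F>" for \<phi> using \<F>(3)[OF that] by (auto simp: S_def)
    show "S \<phi> \<noteq> {}" if "\<phi> \<in> \<F>" for \<phi> using V(3) by (auto simp: S_def)
    show "real (card \<F>) * p ^ m = (\<Sum>\<phi>\<in>\<F>. p ^ card (S \<phi>))" by (simp add: cS)
    show "(\<Sum>\<phi>\<in>\<F>. \<Sum>\<psi>\<in>{\<psi> \<in> \<F>. S \<psi> \<inter> S \<phi> \<noteq> {}}. p ^ card (S \<phi> \<union> S \<psi>)) \<le> real (card \<F>) * K"
      using sum_mono[of \<F>, OF row] by simp
  qed
  also have "\<dots> \<le> exp (- \<gamma> * M / (2 * (2 * card V) ^ card V))"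
  proof -
    have c0: "real (card \<F>) > 0" using F_ne fF by (simp add: card_gt_0_iff)
    have "(real (card \<F>) * p ^ m)\<^sup>2 / (2 * (real (card \<F>) * K)) = (p ^ m)\<^sup>2 * real (card \<F>) / (2 * K)"
      using c0 K0 by (simp add: power2_eq_square field_simps)
    also have "\<dots> = real (card \<F>) * M / (2 * ((2 * real k) ^ k * real n ^ k))"
      using P M n k2 by (simp add: K_def power_mult[symmetric] mult.commute[of 2 m] field_simps)
    also have "\<dots> \<ge> (\<gamma> * real n ^ k) * M / (2 * ((2 * real k) ^ k * real n ^ k))"
      using card_\<F> M by (intro divide_right_mono mult_right_mono) (auto simp: k_def)
    also have "(\<gamma> * real n ^ k) * M / (2 * ((2 * real k) ^ k * real n ^ k)) = \<gamma> * M / (2 * (2 * real k) ^ k)"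
      using n k2 by (simp add: field_simps)
    finally show ?thesis by (simp add: k_def)
  qed
  finally show ?thesis unfolding S_def .
qed


section \<open>Trees, cores of bipartite graphs and copies of the target graph\<close>

text \<open>A path in \<open>Z\<close> between two different neighbours of \<open>z\<close>,
  shortened to have distinct vertices, would close a cycle through \<open>z\<close>.\<close>

lemma tree_attach_unique:
  assumes T: "tree T" and Z: "z \<notin> Z" "y \<in> Z" "y' \<in> Z" "{y, z} \<in> edges T" "{y', z} \<in> edges T"
    and conn: "(\<lambda>x y. {x, y} \<in> edges T \<and> x \<in> Z \<and> y \<in> Z)\<^sup>*\<^sup>* y y'"
  shows "y' = y"
proof (rule ccontr)
  assume neq: "y' \<noteq> y"
  let ?r = "\<lambda>x y. {x, y} \<in> edges T \<and> x \<in> Z \<and> y \<in> Z"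
  obtain xs0 where "rtrancl_path ?r y xs0 y'"
    using conn by (auto simp: rtranclp_eq_rtrancl_path)
  then obtain xs where xs: "rtrancl_path ?r y xs y'" "distinct (y # xs)"
    by (rule rtrancl_path_distinct)
  have ne: "xs \<noteq> []" using xs(1) neq by (auto elim: rtrancl_path.cases)
  have last: "last xs = y'" using rtrancl_path_last[OF xs(1) ne] .
  have nth: "?r ((y # xs) ! i) (xs ! i)" if "i < length xs" for i
    using rtrancl_path_nth[OF xs(1) that] .
  have "set xs \<subseteq> Z" using nth by (auto simp: in_set_conv_nth)
  then have "z \<notin> set (y # xs)" using Z by auto
  then have dist: "distinct (z # y # xs)" using xs(2) by simp
  have "cycle_in T (z # y # xs)"
    unfolding cycle_in_def
  proof (intro conjI allI impI)
    show "length (z # y # xs) \<ge> 3" using ne by (cases xs) auto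
    fix i assume i: "i < length (z # y # xs)"
    consider "i = 0" | "i = Suc (length xs)" | j where "i = Suc j" "j < length xs"
      using i by (cases i) (auto simp: less_Suc_eq)
    then show "{(z # y # xs) ! i, (z # y # xs) ! (Suc i mod length (z # y # xs))} \<in> edges T"
    proof cases
      case 1
      then show ?thesis using Z by (simp add: insert_commute)
    next
      case 2
      then have "(z # y # xs) ! i = y'" using last ne by (simp add: last_conv_nth)
      then show ?thesis using 2 Z by simp
    next
      case 3
      then show ?thesis using nth[of j] by simp
    qed
  qed (rule dist)
  then show False using T by (auto simp: tree_def)
qed

text \<open>Building a tree leaf by leaf from a chosen root. A largest set that has \<open>P\<close>
  and is connected within itself is everything: otherwise some edge leaves it, and by acyclicity the
  new endpoint has only one neighbour in it. The edge count and the greedy embedding below are both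
  instances.\<close>

lemma tree_induct:
  assumes T: "tree T" and u: "u \<in> vertices T" and base: "P {u}"
    and step: "\<And>Z y z. Z \<subseteq> vertices T \<Longrightarrow> u \<in> Z \<Longrightarrow> P Z \<Longrightarrow> y \<in> Z \<Longrightarrow> z \<in> vertices T - Z \<Longrightarrow>
       {y, z} \<in> edges T \<Longrightarrow> (\<And>y'. y' \<in> Z \<Longrightarrow> {y', z} \<in> edges T \<Longrightarrow> y' = y) \<Longrightarrow> P (insert z Z)"
  shows "P (vertices T)"
proof -
  let ?V = "vertices T"
  let ?r = "\<lambda>Z x y. {x, y} \<in> edges T \<and> x \<in> Z \<and> y \<in> Z"
  define good where "good = (\<lambda>Z. Z \<subseteq> ?V \<and> u \<in> Z \<and> P Z \<and> (\<forall>a\<in>Z. (?r Z)\<^sup>*\<^sup>* u a))"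
  have fin: "finite ?V" and edges: "edges T \<subseteq> nsets ?V 2"
    using T by (auto simp: tree_def simple_graph_def)
  have "good {u}" using u base by (auto simp: good_def)
  moreover have bounded: "\<forall>Z. good Z \<longrightarrow> card Z \<le> card ?V"
    using fin by (auto simp: good_def intro: card_mono)
  ultimately obtain Z where Z: "good Z" "\<And>Z'. good Z' \<Longrightarrow> card Z' \<le> card Z"
    using ex_has_greatest_nat[of good "{u}" card "Suc (card ?V)"] by (auto simp: less_Suc_eq_le)
  have fZ: "finite Z" using Z(1) fin finite_subset by (auto simp: good_def)
  have "Z = ?V"
  proof (rule ccontr)
    assume "Z \<noteq> ?V"
    then obtain w where w: "w \<in> ?V" "w \<notin> Z" using Z(1) by (auto simp: good_def)
    have "(\<lambda>x y. {x, y} \<in> edges T)\<^sup>*\<^sup>* u w"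
      using T u w by (auto simp: tree_def connected_graph_def)
    \<comment> \<open>A walk from \<open>u\<close> to a vertex outside \<open>Z\<close> uses an edge
      leaving \<open>Z\<close>.\<close>
    then have "w \<notin> Z \<longrightarrow> (\<exists>y z. y \<in> Z \<and> z \<notin> Z \<and> {y, z} \<in> edges T)"
    proof (induction rule: rtranclp_induct)
      case base
      then show ?case using Z(1) by (auto simp: good_def)
    next
      case (step a b)
      then show ?case by blast
    qed
    then obtain y z where yz: "y \<in> Z" "z \<notin> Z" "{y, z} \<in> edges T" using w by blast
    have z: "z \<in> ?V - Z" using yz edges by auto
    have sym: "symp (?r Z)" by (auto simp: symp_def insert_commute)
    have uniq: "y' = y" if "y' \<in> Z" "{y', z} \<in> edges T" for y'
    proof (rule tree_attach_unique[OF T yz(2,1) that(1) yz(3) that(2)])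
      have "(?r Z)\<^sup>*\<^sup>* y u" "(?r Z)\<^sup>*\<^sup>* u y'"
        using Z(1) yz that symp_rtranclp[OF sym] by (auto simp: good_def dest: sympD)
      then show "(?r Z)\<^sup>*\<^sup>* y y'" by simp
    qed
    have mono: "(?r (insert z Z))\<^sup>*\<^sup>* a b" if "(?r Z)\<^sup>*\<^sup>* a b" for a b
      using that by (rule rtranclp_mono[THEN predicate2D, rotated]) auto
    have "good (insert z Z)"
      unfolding good_def
    proof (intro conjI ballI)
      show "P (insert z Z)" by (rule step[OF _ _ _ yz(1) z yz(3) uniq]) (use Z(1) in \<open>auto simp: good_def\<close>)
      fix a assume a: "a \<in> insert z Z"
      have "(?r (insert z Z))\<^sup>*\<^sup>* u y" using Z(1) yz mono by (auto simp: good_def)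
      then have "(?r (insert z Z))\<^sup>*\<^sup>* u z"
        by (rule rtranclp.rtrancl_into_rtrancl) (use yz in auto)
      then show "(?r (insert z Z))\<^sup>*\<^sup>* u a"
        using a Z(1) mono by (auto simp: good_def)
    qed (use Z(1) z in \<open>auto simp: good_def\<close>)
    then show False using Z(2)[of "insert z Z"] z fZ by simp
  qed
  then show ?thesis using Z(1) by (simp add: good_def)
qed

text \<open>Each new leaf brings at most one edge into \<open>J\<close>. The bound is not lowered to
  \<open>card J - 1\<close>, which keeps \<open>J = {}\<close> uniform and is sharp enough for
  \<open>G_edges_subset_le\<close>.\<close>

lemma tree_edges_subset_le:
  assumes T: "tree T" and J: "J \<subseteq> vertices T"
  shows "card {e \<in> edges T. e \<subseteq> J} \<le> card J"
proof -
  have fin: "finite (vertices T)" and edges: "edges T \<subseteq> nsets (vertices T) 2"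
    using T by (auto simp: tree_def simple_graph_def)
  obtain u where u: "u \<in> vertices T" using T by (auto simp: tree_def connected_graph_def)
  have "\<forall>J\<subseteq>vertices T. card {e \<in> edges T. e \<subseteq> J} \<le> card J"
  proof (rule tree_induct[OF T u, of "\<lambda>Z. \<forall>J\<subseteq>Z. card {e \<in> edges T. e \<subseteq> J} \<le> card J"])
    show "\<forall>J\<subseteq>{u}. card {e \<in> edges T. e \<subseteq> J} \<le> card J"
    proof (intro allI impI)
      fix J assume J: "J \<subseteq> {u}"
      have "\<not> e \<subseteq> {u}" if "e \<in> edges T" for e
        using that edges card_mono[of "{u}" e] by (auto simp: nsets_def)
      then have "{e \<in> edges T. e \<subseteq> J} = {}" using J by blast
      then show "card {e \<in> edges T. e \<subseteq> J} \<le> card J" by (metis card.empty le0)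
    qed
  next
    fix Z y z
    assume Z: "Z \<subseteq> vertices T" and IH: "\<forall>J\<subseteq>Z. card {e \<in> edges T. e \<subseteq> J} \<le> card J"
      and z: "z \<in> vertices T - Z" and uniq: "\<And>y'. y' \<in> Z \<Longrightarrow> {y', z} \<in> edges T \<Longrightarrow> y' = y"
    show "\<forall>J\<subseteq>insert z Z. card {e \<in> edges T. e \<subseteq> J} \<le> card J"
    proof (intro allI impI)
      fix J assume J: "J \<subseteq> insert z Z"
      have fJ: "finite J" using J Z z fin by (meson Diff_iff finite_insert finite_subset)
      show "card {e \<in> edges T. e \<subseteq> J} \<le> card J"
      proof (cases "z \<in> J")
        case True
        have "{e \<in> edges T. e \<subseteq> J} \<subseteq> insert {y, z} {e \<in> edges T. e \<subseteq> J - {z}}"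
        proof
          fix e assume e: "e \<in> {e \<in> edges T. e \<subseteq> J}"
          then have "e \<in> nsets (vertices T) 2" using edges by auto
          then obtain a b where ab: "e = {a, b}" "a \<noteq> b" by (rule nsets2_E)
          show "e \<in> insert {y, z} {e \<in> edges T. e \<subseteq> J - {z}}"
          proof (cases "z \<in> e")
            case True
            then obtain y' where y': "e = {y', z}" "y' \<noteq> z" using ab by auto
            then have "y' = y" using e J uniq by auto
            then show ?thesis using y' by simp
          qed (use e in auto)
        qed
        then have "card {e \<in> edges T. e \<subseteq> J} \<le> card (insert {y, z} {e \<in> edges T. e \<subseteq> J - {z}})"
          using fJ by (intro card_mono) auto
        also have "\<dots> \<le> Suc (card {e \<in> edges T. e \<subseteq> J - {z}})" by (rule card_insert_le_m1) auto
        also have "\<dots> \<le> Suc (card (J - {z}))"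
        proof -
          have "J - {z} \<subseteq> Z" using J by auto
          then show ?thesis using IH by simp
        qed
        also have "\<dots> = card J" using True fJ by (rule card_Suc_Diff1[rotated])
        finally show ?thesis .
      qed (use IH J in auto)
    qed
  qed
  then show ?thesis using J by blast
qed

text \<open>Vertices of degree below \<open>D\<close> are deleted until none is left. Each deletion
  costs fewer than \<open>D\<close> edges, and there are at most \<open>card A + card U\<close>
  deletions. A core with many edges is where trees embed greedily.\<close>

lemma bipartite_core:
  assumes "finite A" "finite U"
  shows "\<exists>A'\<subseteq>A. \<exists>U'\<subseteq>U. (\<forall>a\<in>A'. D \<le> card {u \<in> U'. r a u}) \<and> (\<forall>u\<in>U'. D \<le> card {a \<in> A'. r a u}) \<and>
     card {(a, u). a \<in> A \<and> u \<in> U \<and> r a u} \<le> card {(a, u). a \<in> A' \<and> u \<in> U' \<and> r a u} + D * (card A + card U)"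
  using assms
proof (induction "card A + card U" arbitrary: A U rule: less_induct)
  case less
  have fin: "finite {(a, u). a \<in> A \<and> u \<in> U \<and> r a u}" if "finite A" "finite U" for A U
    by (rule finite_subset[of _ "A \<times> U"]) (use that in auto)
  consider (good) "\<forall>a\<in>A. D \<le> card {u \<in> U. r a u}" "\<forall>u\<in>U. D \<le> card {a \<in> A. r a u}"
    | (left) a where "a \<in> A" "card {u \<in> U. r a u} < D"
    | (right) u where "u \<in> U" "card {a \<in> A. r a u} < D"
    by (meson not_le)
  then show ?case
  proof cases
    case good
    show ?thesis by (rule exI[of _ A], rule conjI, simp, rule exI[of _ U]) (use good in auto)
  next
    case left
    have "card {(x, u). x \<in> A \<and> u \<in> U \<and> r x u} \<le>
        card ({(x, u). x \<in> A - {a} \<and> u \<in> U \<and> r x u} \<union> Pair a ` {u \<in> U. r a u})"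
      using fin[of "A - {a}" U] less.prems by (intro card_mono) auto
    also have "\<dots> \<le> card {(x, u). x \<in> A - {a} \<and> u \<in> U \<and> r x u} + card {u \<in> U. r a u}"
      using less.prems by (intro order_trans[OF card_Un_le] add_left_mono card_image_le) auto
    finally have 1: "card {(x, u). x \<in> A \<and> u \<in> U \<and> r x u} \<le> card {(x, u). x \<in> A - {a} \<and> u \<in> U \<and> r x u} + D"
      using left by linarith
    have cA: "card A = Suc (card (A - {a}))" using left less.prems by (intro card.remove)
    obtain A' U' where *: "A' \<subseteq> A - {a}" "U' \<subseteq> U" "\<forall>a\<in>A'. D \<le> card {u \<in> U'. r a u}" "\<forall>u\<in>U'. D \<le> card {a \<in> A'. r a u}"
      "card {(x, u). x \<in> A - {a} \<and> u \<in> U \<and> r x u} \<le> card {(a, u). a \<in> A' \<and> u \<in> U' \<and> r a u} + D * (card (A - {a}) + card U)"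
      using less.hyps[of "A - {a}" U] less.prems cA by auto
    show ?thesis
      by (rule exI[of _ A'], rule conjI, use * in blast, rule exI[of _ U']) (use * 1 cA in auto)
  next
    case right
    have "card {(x, y). x \<in> A \<and> y \<in> U \<and> r x y} \<le>
        card ({(x, y). x \<in> A \<and> y \<in> U - {u} \<and> r x y} \<union> (\<lambda>x. (x, u)) ` {x \<in> A. r x u})"
      using fin[of A "U - {u}"] less.prems by (intro card_mono) auto
    also have "\<dots> \<le> card {(x, y). x \<in> A \<and> y \<in> U - {u} \<and> r x y} + card {x \<in> A. r x u}"
      using less.prems by (intro order_trans[OF card_Un_le] add_left_mono card_image_le) auto
    finally have 1: "card {(x, y). x \<in> A \<and> y \<in> U \<and> r x y} \<le> card {(x, y). x \<in> A \<and> y \<in> U - {u} \<and> r x y} + D"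
      using right by linarith
    have cA: "card U = Suc (card (U - {u}))" using right less.prems by (intro card.remove)
    obtain A' U' where *: "A' \<subseteq> A" "U' \<subseteq> U - {u}" "\<forall>a\<in>A'. D \<le> card {u \<in> U'. r a u}" "\<forall>u\<in>U'. D \<le> card {a \<in> A'. r a u}"
      "card {(x, y). x \<in> A \<and> y \<in> U - {u} \<and> r x y} \<le> card {(a, u). a \<in> A' \<and> u \<in> U' \<and> r a u} + D * (card A + card (U - {u}))"
      using less.hyps[of A "U - {u}"] less.prems cA by auto
    show ?thesis
      by (rule exI[of _ A'], rule conjI, use * in blast, rule exI[of _ U']) (use * 1 cA in auto)
  qed
qed

section \<open>Copies of cliques and of the target graph\<close>

lemma contains_complete_iff:
  "contains_copy \<Gamma> (complete_graph k) \<longleftrightarrow>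
     (\<exists>K\<subseteq>vertices \<Gamma>. finite K \<and> card K = k \<and> nsets K 2 \<subseteq> edges \<Gamma>)"
proof
  assume "contains_copy \<Gamma> (complete_graph k)"
  then obtain f where f: "inj_on f {1..k}" "f ` {1..k} \<subseteq> vertices \<Gamma>" "\<And>e. e \<in> nsets {1..k} 2 \<Longrightarrow> f ` e \<in> edges \<Gamma>"
    by (auto simp: contains_copy_def complete_graph_def)
  have "nsets (f ` {1..k}) 2 \<subseteq> edges \<Gamma>"
  proof
    fix e assume "e \<in> nsets (f ` {1..k}) 2"
    then obtain x y where xy: "e = {x, y}" "x \<in> f ` {1..k}" "y \<in> f ` {1..k}" "x \<noteq> y"
      by (rule nsets2_E) auto
    then obtain a b where "a \<in> {1..k}" "x = f a" "b \<in> {1..k}" "y = f b" by blast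
    with xy have ab: "e = {f a, f b}" "a \<in> {1..k}" "b \<in> {1..k}" "f a \<noteq> f b" by auto
    then have "{a, b} \<in> nsets {1..k} 2" by auto
    then show "e \<in> edges \<Gamma>" using f(3)[of "{a, b}"] ab by simp
  qed
  then show "\<exists>K\<subseteq>vertices \<Gamma>. finite K \<and> card K = k \<and> nsets K 2 \<subseteq> edges \<Gamma>"
    using f by (intro exI[of _ "f ` {1..k}"]) (auto simp: card_image)
next
  assume "\<exists>K\<subseteq>vertices \<Gamma>. finite K \<and> card K = k \<and> nsets K 2 \<subseteq> edges \<Gamma>"
  then obtain K where K: "K \<subseteq> vertices \<Gamma>" "finite K" "card K = k" "nsets K 2 \<subseteq> edges \<Gamma>" by blast
  then obtain f where f: "bij_betw f {1..k} K" using ex_bij_betw_nat_finite_1 by blast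
  have "f ` e \<in> edges \<Gamma>" if "e \<in> nsets {1..k} 2" for e
  proof -
    have "f ` e \<in> nsets K 2"
      using that f inj_on_subset[of f "{1..k}" e]
      by (auto simp: nsets_def bij_betw_def card_image)
    then show ?thesis using K by auto
  qed
  then show "contains_copy \<Gamma> (complete_graph k)"
    using f K unfolding contains_copy_def complete_graph_def bij_betw_def
    by (intro exI[of _ f]) simp
qed

lemma contains_copy_mono:
  assumes "contains_copy \<Gamma> H" "vertices \<Gamma> \<subseteq> vertices \<Gamma>'" "edges \<Gamma> \<subseteq> edges \<Gamma>'"
  shows "contains_copy \<Gamma>' H"
proof -
  obtain f where "inj_on f (vertices H)" "f ` vertices H \<subseteq> vertices \<Gamma>" "\<forall>e\<in>edges H. f ` e \<in> edges \<Gamma>"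
    using assms(1) by (auto simp: contains_copy_def)
  then show ?thesis
    unfolding contains_copy_def using assms(2,3) by (intro exI[of _ f]) auto
qed

text \<open>With \<open>v\<close> put on the side of \<open>u\<close>, every edge of
  \<open>G\<close> except \<open>{v, u}\<close> crosses the bipartition given by \<open>c\<close>.
  Both embedding lemmas of this locale treat that one edge separately.\<close>

locale tree_plus_vertex =
  fixes T :: "'a graph" and v :: 'a and S :: "'a set" and u :: 'a and c :: "'a \<Rightarrow> bool"
  assumes tree: "tree T" and v: "v \<notin> vertices T" and S: "S \<subseteq> vertices T" and u: "u \<in> S"
    and proper: "proper_coloring T c" and side: "\<And>x. x \<in> S \<Longrightarrow> x \<noteq> u \<Longrightarrow> c x \<noteq> c u"
begin

abbreviation "G \<equiv> add_vertex T v S"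
abbreviation "D \<equiv> card (vertices T)"

lemma finite_T: "finite (vertices T)" and edges_T: "edges T \<subseteq> nsets (vertices T) 2"
  using tree by (auto simp: tree_def simple_graph_def)

lemma u_T: "u \<in> vertices T"
  using u S by auto

lemma D_pos: "D > 0"
  using finite_T u_T by (auto simp: card_gt_0_iff)

lemma edge_T: "e \<in> edges T \<Longrightarrow> \<exists>a b. e = {a, b} \<and> a \<in> vertices T \<and> b \<in> vertices T \<and> a \<noteq> b \<and> c a = c u \<and> c b \<noteq> c u"
proof -
  assume e: "e \<in> edges T"
  then have "e \<in> nsets (vertices T) 2" using edges_T by auto
  then obtain a b where ab: "e = {a, b}" "a \<in> vertices T" "b \<in> vertices T" "a \<noteq> b"
    by (rule nsets2_E)
  then have "c a \<noteq> c b" using proper e by (auto simp: proper_coloring_def)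
  then show ?thesis using ab
    by (cases "c a = c u") (blast, metis insert_commute)
qed

text \<open>A forest together with a star at \<open>v\<close>: both have at most
  \<open>card J\<close> edges inside \<open>J\<close>. Average degree at most 4 in every subset is
  what \<open>sparse_pattern\<close> compares with t - 1.\<close>

lemma G_edges_subset_le:
  assumes "J \<subseteq> vertices G"
  shows "card {e \<in> edges G. e \<subseteq> J} \<le> 2 * card J"
proof -
  let ?J = "J - {v}"
  have fJ: "finite J" using assms finite_T finite_subset by (auto simp: add_vertex_def)
  have "{e \<in> edges G. e \<subseteq> J} \<subseteq> {e \<in> edges T. e \<subseteq> ?J} \<union> (\<lambda>x. {v, x}) ` ?J"
  proof
    fix e assume e: "e \<in> {e \<in> edges G. e \<subseteq> J}"
    then consider "e \<in> edges T" | x where "x \<in> S" "e = {v, x}" by (auto simp: add_vertex_def)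
    then show "e \<in> {e \<in> edges T. e \<subseteq> ?J} \<union> (\<lambda>x. {v, x}) ` ?J"
    proof cases
      case 1
      then have "v \<notin> e" using edges_T v by (auto simp: nsets_def)
      then show ?thesis using 1 e by auto
    next
      case 2
      then have "x \<noteq> v" using S v by auto
      then show ?thesis using 2 e by auto
    qed
  qed
  then have "card {e \<in> edges G. e \<subseteq> J} \<le> card {e \<in> edges T. e \<subseteq> ?J} + card ((\<lambda>x. {v, x}) ` ?J)"
    using fJ by (intro order_trans[OF card_mono card_Un_le]) (auto intro!: finite_subset[of _ "Pow J"])
  also have "\<dots> \<le> card ?J + card ?J"
    using fJ assms by (intro add_mono tree_edges_subset_le[OF tree] card_image_le) (auto simp: add_vertex_def)
  also have "\<dots> \<le> 2 * card J" using fJ card_mono[of J ?J] by auto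
  finally show ?thesis .
qed

lemma G_simple: "finite (vertices G)" "edges G \<subseteq> nsets (vertices G) 2"
proof -
  show "finite (vertices G)" using finite_T by (simp add: add_vertex_def)
  have "edges T \<subseteq> nsets (vertices G) 2"
    using edges_T nsets_mono[of "vertices T" "vertices G" 2] by (auto simp: add_vertex_def)
  moreover have "{v, x} \<in> nsets (vertices G) 2" if "x \<in> S" for x
    using that S v by (auto simp: add_vertex_def)
  ultimately show "edges G \<subseteq> nsets (vertices G) 2" by (auto simp: add_vertex_def)
qed

text \<open>The class opposite to \<open>u\<close> goes to \<open>X\<close>, the class of
  \<open>u\<close> together with \<open>v\<close> goes to \<open>Y\<close>, and the exceptional edge
  \<open>{v, u}\<close> goes to \<open>{a, b}\<close>. All other edges of \<open>G\<close> cross, so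
  completeness between \<open>X\<close> and \<open>Y\<close> supplies them.\<close>

lemma copy_blowup:
  assumes B: "\<And>x y. x \<in> X \<Longrightarrow> y \<in> Y \<Longrightarrow> {x, y} \<in> B" and ab: "a \<in> Y" "b \<in> Y" "a \<noteq> b" "{a, b} \<in> B"
    and card: "D \<le> card X" "D < card Y" and disj: "X \<inter> Y = {}" and sub: "X \<subseteq> W" "Y \<subseteq> W"
  shows "contains_copy \<lparr>vertices = W, edges = B\<rparr> G"
proof -
  have "0 < card X" "0 < card Y" using card D_pos by linarith+
  then have fX: "finite X" and fY: "finite Y" by (auto intro: card_ge_0_finite)
  let ?X = "{x \<in> vertices T. c x \<noteq> c u}" and ?Y = "{x \<in> vertices T. c x = c u} - {u}"
  have "card ?X \<le> card X" using card_mono[of "vertices T" ?X] finite_T card by auto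
  then obtain f where f: "f ` ?X \<subseteq> X" "inj_on f ?X"
    using card_le_inj[of ?X X] finite_T fX by auto
  \<comment> \<open>Two places of \<open>Y\<close> are reserved for \<open>u\<close> and
    \<open>v\<close>; at least \<open>D - 1\<close> remain, enough for the rest of the class of
    \<open>u\<close>. This is why \<open>D < card Y\<close> is required.\<close>
  have "card ?Y \<le> card (vertices T - {u})" using finite_T by (intro card_mono) auto
  also have "\<dots> = D - 1" using u_T finite_T by simp
  also have "\<dots> \<le> card (Y - {a, b})" using ab fY card by (simp add: card_Diff_subset)
  finally obtain g where g: "g ` ?Y \<subseteq> Y - {a, b}" "inj_on g ?Y"
    using card_le_inj[of ?Y "Y - {a, b}"] finite_T fY by auto
  define h where "h = (\<lambda>x. if x = v then b else if x = u then a else if c x = c u then g x else f x)"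
  have hv: "h v = b" and hu: "h u = a" using v u_T by (auto simp: h_def)
  have hX: "h x = f x" "h x \<in> X" if "x \<in> ?X" for x using that f v by (auto simp: h_def)
  have hY: "h x = g x" "h x \<in> Y - {a, b}" if "x \<in> ?Y" for x using that g v by (auto simp: h_def)
  have Vsplit: "vertices G = insert v (insert u (?X \<union> ?Y))" using u_T by (auto simp: add_vertex_def)
  have "inj_on h ?X" "inj_on h ?Y" using f(2) g(2) hX(1) hY(1) by (simp_all add: inj_on_def)
  moreover have "h x \<noteq> h y" if "x \<in> ?X" "y \<in> ?Y" for x y
    using hX(2)[OF that(1)] hY(2)[OF that(2)] disj by auto
  then have "h ` (?X - ?Y) \<inter> h ` (?Y - ?X) = {}" by blast
  ultimately have "inj_on h (?X \<union> ?Y)" unfolding inj_on_Un by simp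
  moreover have "h x \<noteq> a \<and> h x \<noteq> b" if "x \<in> ?X \<union> ?Y" for x
    using that
  proof
    assume "x \<in> ?X"
    from hX(2)[OF this] show ?thesis using disj ab by auto
  next
    assume "x \<in> ?Y"
    from hY(2)[OF this] show ?thesis by auto
  qed
  then have "a \<notin> h ` (?X \<union> ?Y)" "b \<notin> h ` (?X \<union> ?Y)" by blast+
  ultimately have inj: "inj_on h (vertices G)"
    unfolding Vsplit using v u_T hv hu ab by (auto simp: inj_on_insert)
  have im: "h ` vertices G \<subseteq> W" unfolding Vsplit using hX(2) hY(2) hv hu ab sub by blast
  have "h ` e \<in> B" if e: "e \<in> edges G" for e
  proof -
    consider "e \<in> edges T" | "e = {v, u}" | x where "x \<in> S" "x \<noteq> u" "e = {v, x}"
      using e by (auto simp: add_vertex_def)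
    then show ?thesis
    proof cases
      case 1
      then obtain x y where xy: "e = {x, y}" "x \<in> vertices T" "y \<in> vertices T" "c x = c u" "c y \<noteq> c u"
        using edge_T by blast
      then have "h y \<in> X" using hX(2)[of y] by simp
      moreover have "h x \<in> Y" using hY(2)[of x] hu ab xy by (cases "x = u") auto
      ultimately show ?thesis using B[of "h y" "h x"] xy by (simp add: insert_commute)
    next
      case 2
      then show ?thesis using hv hu ab by (simp add: insert_commute)
    next
      case 3
      then have "h x \<in> X" using side[of x] S hX(2)[of x] by auto
      then show ?thesis using B[of "h x" b] 3 hv ab by (simp add: insert_commute)
    qed
  qed
  then show ?thesis using inj im by (auto simp: contains_copy_def)
qed

text \<open>Greedy embedding with \<open>u\<close> placed at \<open>x0\<close>. A new leaf has one
  embedded neighbour, whose image has at least \<open>D\<close> neighbours in the core, while fewer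
  than \<open>D\<close> vertices are in use.\<close>

lemma tree_into_core:
  assumes A: "\<And>a. a \<in> A \<Longrightarrow> D \<le> card {y \<in> U. {a, y} \<in> B}" and U: "\<And>y. y \<in> U \<Longrightarrow> D \<le> card {a \<in> A. {a, y} \<in> B}"
    and x0: "x0 \<in> U"
  shows "\<exists>f. inj_on f (vertices T) \<and> f u = x0 \<and> (\<forall>z\<in>vertices T. if c z = c u then f z \<in> U else f z \<in> A) \<and>
     (\<forall>e\<in>edges T. f ` e \<in> B)"
proof -
  define Q where "Q = (\<lambda>Z f. inj_on f Z \<and> f u = x0 \<and> (\<forall>z\<in>Z. if c z = c u then f z \<in> U else f z \<in> A) \<and>
     (\<forall>e\<in>edges T. e \<subseteq> Z \<longrightarrow> f ` e \<in> B))"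
  have "\<exists>f. Q (vertices T) f"
  proof (rule tree_induct[OF tree u_T, of "\<lambda>Z. \<exists>f. Q Z f"])
    have "Q {u} (\<lambda>_. x0)"
      using x0 edge_T by (fastforce simp: Q_def)
    then show "\<exists>f. Q {u} f" by blast
  next
    fix Z y z
    assume Z: "Z \<subseteq> vertices T" "u \<in> Z" and ex: "\<exists>f. Q Z f" and y: "y \<in> Z" and z: "z \<in> vertices T - Z"
      and yz: "{y, z} \<in> edges T" and uniq: "\<And>y'. y' \<in> Z \<Longrightarrow> {y', z} \<in> edges T \<Longrightarrow> y' = y"
    obtain f where f: "Q Z f" using ex by blast
    have fZ: "finite Z" using Z finite_T finite_subset by auto
    have "card Z < D" using Z z finite_T by (intro psubset_card_mono) auto
    then have small: "card (f ` Z) < D" using card_image_le[OF fZ, of f] by linarith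
    have new: "\<exists>w. w \<in> N \<and> w \<notin> f ` Z" if "D \<le> card N" for N
    proof (rule ccontr)
      assume "\<not> ?thesis"
      then have "N \<subseteq> f ` Z" by auto
      then show False using card_mono[of "f ` Z" N] fZ that small by auto
    qed
    have cyz: "c y \<noteq> c z" using yz proper by (auto simp: proper_coloring_def)
    obtain w where w: "w \<notin> f ` Z" "if c z = c u then w \<in> U else w \<in> A" "{f y, w} \<in> B"
    proof (cases "c z = c u")
      case True
      then have "f y \<in> A" using f y cyz by (auto simp: Q_def)
      then show thesis using new[OF A] that True by auto
    next
      case False
      then have "c y = c u" using cyz by auto
      then have "f y \<in> U" using f y by (auto simp: Q_def)
      then obtain w where "w \<in> A" "{w, f y} \<in> B" "w \<notin> f ` Z" using new[OF U] by blast
      then show thesis using that[of w] False by (simp add: insert_commute)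
    qed
    let ?f = "f(z := w)"
    have "Q (insert z Z) ?f"
      unfolding Q_def
    proof (intro conjI ballI impI)
      show "inj_on ?f (insert z Z)" using f w z by (auto simp: Q_def inj_on_def)
      show "?f u = x0" using f Z z by (auto simp: Q_def)
      fix e assume e: "e \<in> edges T" "e \<subseteq> insert z Z"
      show "?f ` e \<in> B"
      proof (cases "z \<in> e")
        case True
        obtain a b where "e = {a, b}" "a \<noteq> b" using edge_T[OF e(1)] by blast
        then obtain y' where y': "e = {y', z}" "y' \<noteq> z" using True by auto
        then have "y' = y" using e uniq by auto
        then show ?thesis using y' w by simp
      next
        case False
        then have "?f ` e = f ` e" by (intro image_cong) auto
        moreover have "f ` e \<in> B" using f e False by (auto simp: Q_def)
        ultimately show ?thesis by simp
      qed
    next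
      fix x assume "x \<in> insert z Z"
      then show "if c x = c u then ?f x \<in> U else ?f x \<in> A" using f w by (auto simp: Q_def)
    qed
    then show "\<exists>f. Q (insert z Z) f" by blast
  qed
  then show ?thesis using edges_T by (fastforce simp: Q_def nsets_def)
qed

text \<open>Here \<open>x1\<close> plays \<open>v\<close> and \<open>x0\<close> plays
  \<open>u\<close>. The other neighbours of \<open>v\<close> lie in the class opposite to
  \<open>u\<close>, which is embedded in \<open>A\<close>, and \<open>A\<close> consists of
  neighbours of \<open>x1\<close>. So any \<open>x0\<close> in the core side \<open>U\<close>
  completes a copy once \<open>{x1, x0}\<close> is an edge.\<close>

lemma copy_from_core:
  assumes A: "\<And>a. a \<in> A \<Longrightarrow> D \<le> card {y \<in> U. {a, y} \<in> B}" and U: "\<And>y. y \<in> U \<Longrightarrow> D \<le> card {a \<in> A. {a, y} \<in> B}"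
    and x0: "x0 \<in> U"
    and x1: "x1 \<notin> A" "x1 \<notin> U" "\<And>a. a \<in> A \<Longrightarrow> {x1, a} \<in> B" "{x1, x0} \<in> B"
    and sub: "A \<subseteq> W" "U \<subseteq> W" "x1 \<in> W"
  shows "contains_copy \<lparr>vertices = W, edges = B\<rparr> G"
proof -
  obtain f where f: "inj_on f (vertices T)" "f u = x0" "\<And>z. z \<in> vertices T \<Longrightarrow> if c z = c u then f z \<in> U else f z \<in> A"
     "\<And>e. e \<in> edges T \<Longrightarrow> f ` e \<in> B"
    using tree_into_core[OF A U x0] by blast
  let ?f = "f(v := x1)"
  have fAU: "f z \<in> A \<union> U" if "z \<in> vertices T" for z using f(3)[OF that] by (auto split: if_splits)
  have "inj_on ?f (vertices G)"
    using f(1) fAU x1 v by (auto simp: add_vertex_def inj_on_def)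
  moreover have "?f ` vertices G \<subseteq> W" using fAU sub by (fastforce simp: add_vertex_def)
  moreover have "?f ` e \<in> B" if e: "e \<in> edges G" for e
  proof -
    consider "e \<in> edges T" | "e = {v, u}" | x where "x \<in> S" "x \<noteq> u" "e = {v, x}"
      using e by (auto simp: add_vertex_def)
    then show ?thesis
    proof cases
      case 1
      then have "v \<notin> e" using edges_T v by (auto simp: nsets_def)
      then have "?f ` e = f ` e" by (intro image_cong) auto
      then show ?thesis using f(4) 1 by simp
    next
      case 2
      moreover have "u \<noteq> v" using v u_T by auto
      ultimately show ?thesis using f(2) x1 by (simp add: insert_commute)
    next
      case 3
      then have "f x \<in> A" using side[of x] f(3)[of x] S by auto
      moreover have "x \<noteq> v" using 3 S v by auto
      ultimately show ?thesis using x1(3)[of "f x"] 3 by (simp add: insert_commute)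
    qed
  qed
  ultimately show ?thesis
    unfolding contains_copy_def by (intro exI[of _ ?f]) (simp del: fun_upd_apply)
qed

end


section \<open>Pairs closing a blue copy\<close>

lemma card_pairs_eq:
  assumes "finite A" "finite U"
  shows "card {(a, x). a \<in> A \<and> x \<in> U \<and> r a x} = (\<Sum>a\<in>A. card {x \<in> U. r a x})"
proof -
  have "{(a, x). a \<in> A \<and> x \<in> U \<and> r a x} = Sigma A (\<lambda>a. {x \<in> U. r a x})" by auto
  then show ?thesis using assms by simp
qed

text \<open>Density is required in every linear-sized subset of \<open>W\<close>, so that it can be
  used again inside neighbourhoods.\<close>

definition pair_dense :: "nat \<Rightarrow> real \<Rightarrow> real \<Rightarrow> nat set \<Rightarrow> (nat \<Rightarrow> nat \<Rightarrow> bool) \<Rightarrow> bool" where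
  "pair_dense n \<delta> \<epsilon> W r \<longleftrightarrow> (\<forall>U\<subseteq>W. \<delta> * real n \<le> card U \<longrightarrow>
     \<epsilon> * (real n)\<^sup>2 \<le> card {(x, y). x \<in> U \<and> y \<in> U \<and> r x y})"

text \<open>Cliques are built by choosing a vertex with a large neighbourhood and recursing into it.
  The neighbourhood is smaller than \<open>U\<close> by an amount depending on \<open>g\<close>, so
  each level needs density at a new threshold; \<Delta> collects these. Both \<gamma> and \<Delta>
  are chosen before \<open>n\<close>, \<open>W\<close> and \<open>r\<close>, hence finitely many
  density statements suffice uniformly. Lists sorted with respect to \<open>r\<close> stand for
  ordered cliques, so \<open>r\<close> need not be symmetric.\<close>

lemma multilevel_cliques:
  fixes g :: "real \<Rightarrow> real"
  assumes g: "\<And>\<delta>. 0 < \<delta> \<Longrightarrow> 0 < g \<delta>" and \<delta>: "0 < \<delta>"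
  shows "\<exists>\<gamma>>0. \<exists>\<Delta>. finite \<Delta> \<and> (\<forall>\<delta>'\<in>\<Delta>. 0 < \<delta>') \<and>
    (\<forall>n (W :: nat set) r. W \<subseteq> {1..n} \<longrightarrow>
      (\<forall>\<delta>'\<in>\<Delta>. pair_dense n \<delta>' (g \<delta>') W r) \<longrightarrow>
      (\<forall>U\<subseteq>W. \<delta> * real n \<le> card U \<longrightarrow> \<gamma> * real n ^ s \<le> card {xs. length xs = s \<and> set xs \<subseteq> U \<and> sorted_wrt r xs}))"
  using \<delta>
proof (induction s arbitrary: \<delta>)
  case 0
  have "{xs :: nat list. length xs = 0 \<and> set xs \<subseteq> U \<and> sorted_wrt r xs} = {[]}" for U r by auto
  then show ?case by (intro exI[of _ 1] conjI exI[of _ "{}"]) simp_all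
next
  case (Suc s)
  let ?d = "g \<delta> / 2"
  let ?L = "\<lambda>s U (r :: nat \<Rightarrow> nat \<Rightarrow> bool). {xs. length xs = s \<and> set xs \<subseteq> U \<and> sorted_wrt r xs}"
  have d: "?d > 0" using g Suc.prems by simp
  obtain \<gamma> \<Delta> where \<gamma>: "\<gamma> > 0" "finite \<Delta>" "\<forall>\<delta>'\<in>\<Delta>. 0 < \<delta>'"
    and IH: "\<forall>n (W :: nat set) r. W \<subseteq> {1..n} \<longrightarrow> (\<forall>\<delta>'\<in>\<Delta>. pair_dense n \<delta>' (g \<delta>') W r) \<longrightarrow>
      (\<forall>U\<subseteq>W. ?d * real n \<le> card U \<longrightarrow> \<gamma> * real n ^ s \<le> card (?L s U r))"
    using Suc.IH[OF d] by (elim exE conjE) (rule that)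
  have "?d * \<gamma> * real n ^ Suc s \<le> card (?L (Suc s) U r)"
    if W: "W \<subseteq> {1..n}" and level: "\<forall>\<delta>'\<in>insert \<delta> \<Delta>. pair_dense n \<delta>' (g \<delta>') W r"
      and U: "U \<subseteq> W" "\<delta> * real n \<le> card U" for n and W U :: "nat set" and r
  proof (cases "n = 0")
    case False
    define N where "N = (\<lambda>x. {y \<in> U. r x y})"
    \<comment> \<open>Vertices of at least half the average degree. As every degree is at most n,
      they are at least \<open>g \<delta> / 2 * real n\<close> in number, the same constant as for
      the neighbourhoods.\<close>
    define A where "A = {x \<in> U. ?d * real n \<le> card (N x)}"
    have fU: "finite U" using finite_subset[OF subset_trans[OF U(1) W] finite_atLeastAtMost] .
    have cU: "card U \<le> n" using U W card_mono[of "{1..n}" U] by auto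
    have cN: "card (N x) \<le> n" for x using fU cU card_mono[of U "N x"] by (auto simp: N_def)
    have "g \<delta> * (real n)\<^sup>2 \<le> card {(x, y). x \<in> U \<and> y \<in> U \<and> r x y}" using level U by (simp add: pair_dense_def)
    also have "\<dots> = (\<Sum>x\<in>U. real (card (N x)))" by (simp add: card_pairs_eq fU N_def)
    also have "\<dots> = (\<Sum>x\<in>A. real (card (N x))) + (\<Sum>x\<in>U - A. real (card (N x)))"
      using fU by (intro sum.subset_diff[of A U, THEN trans]) (auto simp: A_def)
    also have "(\<Sum>x\<in>A. real (card (N x))) \<le> (\<Sum>x\<in>A. real n)" by (intro sum_mono) (simp add: cN)
    also have "(\<Sum>x\<in>U - A. real (card (N x))) \<le> (\<Sum>x\<in>U - A. ?d * real n)"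
      by (intro sum_mono) (auto simp: A_def)
    also have "\<dots> \<le> real n * (?d * real n)"
      using d fU cU card_mono[of U "U - A"] by (auto intro!: mult_right_mono)
    finally have "g \<delta> * (real n)\<^sup>2 \<le> real (card A) * real n + real n * (?d * real n)" by simp
    then have "real n * (?d * real n) \<le> real n * real (card A)" by (simp add: power2_eq_square algebra_simps)
    then have cA: "?d * real n \<le> card A" using False by simp
    have fL: "finite (?L s U r)" if "finite U" for s U and r :: "nat \<Rightarrow> nat \<Rightarrow> bool"
      by (rule finite_subset[OF _ finite_lists_length_eq[OF that, of s]]) auto
    have fN: "finite (N x)" for x using fU by (simp add: N_def)
    have "(\<lambda>(x, ys). x # ys) ` Sigma A (\<lambda>x. ?L s (N x) r) \<subseteq> ?L (Suc s) U r"
      by (auto simp: A_def N_def)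
    moreover have "inj_on (\<lambda>(x, ys). x # ys) (Sigma A (\<lambda>x. ?L s (N x) r))" by (auto simp: inj_on_def)
    ultimately have "card (Sigma A (\<lambda>x. ?L s (N x) r)) \<le> card (?L (Suc s) U r)"
      using fL[OF fU] by (intro card_inj_on_le) auto
    moreover have "card (Sigma A (\<lambda>x. ?L s (N x) r)) = (\<Sum>x\<in>A. card (?L s (N x) r))"
      using fU fL[OF fN] by (intro card_SigmaI) (auto simp: A_def)
    ultimately have "real (\<Sum>x\<in>A. card (?L s (N x) r)) \<le> real (card (?L (Suc s) U r))"
      by (simp only: of_nat_le_iff)
    moreover have "real (card A) * (\<gamma> * real n ^ s) \<le> (\<Sum>x\<in>A. real (card (?L s (N x) r)))"
    proof -
      have "(\<Sum>x\<in>A. \<gamma> * real n ^ s) \<le> (\<Sum>x\<in>A. real (card (?L s (N x) r)))"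
      proof (rule sum_mono)
        fix x assume "x \<in> A"
        then show "\<gamma> * real n ^ s \<le> real (card (?L s (N x) r))"
          using level U W by (intro IH[rule_format, of W]) (auto simp: A_def N_def)
      qed
      then show ?thesis by simp
    qed
    moreover have "?d * real n * (\<gamma> * real n ^ s) \<le> real (card A) * (\<gamma> * real n ^ s)"
      using cA \<gamma> by (intro mult_right_mono) auto
    moreover have "?d * \<gamma> * real n ^ Suc s = ?d * real n * (\<gamma> * real n ^ s)" by simp
    ultimately show ?thesis unfolding of_nat_sum by linarith
  qed simp
  then show ?case using d \<gamma> Suc.prems
    by (intro exI[of _ "?d * \<gamma>"] conjI exI[of _ "insert \<delta> \<Delta>"]) auto
qed

section \<open>Edge counts in ordered pairs and one-sided regularity\<close>

definition edge_count :: "nat set set \<Rightarrow> nat set \<Rightarrow> nat set \<Rightarrow> nat" where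
  "edge_count E A U = card {(a, x). a \<in> A \<and> x \<in> U \<and> {a, x} \<in> E}"

text \<open>Upper half of a discrepancy condition. The additive linear term covers small sets, for
  which deviations of order n are the best that survives a union bound over all pairs of
  sets.\<close>

definition upper_regular :: "nat \<Rightarrow> real \<Rightarrow> nat set set \<Rightarrow> bool" where
  "upper_regular n q E \<longleftrightarrow> (\<forall>A\<subseteq>{1..n}. \<forall>U\<subseteq>{1..n}.
     real (edge_count E A U) \<le> 4 * q * card A * card U + 8 * n)"

context tree_plus_vertex
begin

text \<open>Irreflexivity is built in so that lists sorted with respect to this relation are
  distinct.\<close>

definition closes :: "nat set set \<Rightarrow> nat set \<Rightarrow> nat \<Rightarrow> nat \<Rightarrow> bool" where
  "closes B W x y \<longleftrightarrow> x \<noteq> y \<and> contains_copy \<lparr>vertices = W, edges = insert {x, y} B\<rparr> G"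

text \<open>Blue walks of length two starting at \<open>x\<close> are blue edges between
  \<open>N x\<close> and \<open>U\<close>. All but O(n) of them lie in a core, and every vertex on
  the far side of that core closes a copy with \<open>x\<close>. So most walks from \<open>x\<close>
  end in \<open>C x\<close>, and upper regularity of the host graph allows only O(q deg(x) |C x|) +
  O(n) of them. Since the walks number at least \<kappa>^2 n^3 q^2 and typical degrees are O(qn),
  the sets \<open>C x\<close> have total size of order n^2. The hypothesis \<open>big\<close> lets
  the O(n) errors be absorbed.\<close>

lemma many_closing_pairs:
  assumes reg: "upper_regular n q E" and q: "0 \<le> q" "q \<le> 1" and B: "B \<subseteq> E" "B \<subseteq> nsets {1..n} 2"
    and U: "U \<subseteq> W" "W \<subseteq> {1..n}" and \<kappa>: "\<kappa> > 0" "\<kappa> * (real n)\<^sup>2 * q \<le> card {e \<in> B. e \<subseteq> U}"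
    and big: "2 * (73 + 2 * real D) \<le> \<kappa>\<^sup>2 * (real n * q\<^sup>2)"
  shows "\<kappa>\<^sup>2 / 64 * (real n)\<^sup>2 \<le> card {(x, y). x \<in> U \<and> y \<in> U \<and> closes B W x y}"
proof -
  have n: "n > 0"
  proof (rule Nat.gr0I)
    assume "n = 0"
    then show False using big by simp
  qed
  have q0: "q > 0"
  proof (rule ccontr)
    assume "\<not> q > 0"
    then have "q = 0" using q by simp
    then show False using big by simp
  qed
  have fU: "finite U" using finite_subset[OF subset_trans[OF U] finite_atLeastAtMost] .
  have cU: "card U \<le> n" using U card_mono[of "{1..n}" U] by auto
  define N where "N = (\<lambda>x. {y \<in> U. {x, y} \<in> B})"
  define deg where "deg = (\<lambda>x. real (card (N x)))"
  define C where "C = (\<lambda>x. {y \<in> U. closes B W x y})"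
  have fN: "finite (N x)" and NU: "N x \<subseteq> U" for x using fU by (auto simp: N_def)
  have cN: "card (N x) \<le> n" for x using fU cU card_mono[of U "N x"] NU[of x] by auto
  have cC: "card (C x) \<le> n" for x using fU cU card_mono[of U "C x"] by (auto simp: C_def)
  have ec: "real (edge_count B A U) = (\<Sum>a\<in>A. deg a)" if "finite A" for A
    unfolding edge_count_def deg_def N_def by (subst card_pairs_eq[OF that fU]) simp
  have "{e \<in> B. e \<subseteq> U} \<subseteq> (\<lambda>(x, y). {x, y}) ` {(a, x). a \<in> U \<and> x \<in> U \<and> {a, x} \<in> B}"
  proof
    fix e assume e: "e \<in> {e \<in> B. e \<subseteq> U}"
    then have "e \<in> nsets {1..n} 2" using B by auto
    then obtain x y where "e = {x, y}" by (rule nsets2_E)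
    then show "e \<in> (\<lambda>(x, y). {x, y}) ` {(a, x). a \<in> U \<and> x \<in> U \<and> {a, x} \<in> B}"
      using e by (intro image_eqI[of _ _ "(x, y)"]) auto
  qed
  then have "card {e \<in> B. e \<subseteq> U} \<le> edge_count B U U"
    unfolding edge_count_def using fU by (intro surj_card_le) (auto intro: finite_subset[of _ "U \<times> U"])
  then have degsum: "\<kappa> * (real n)\<^sup>2 * q \<le> (\<Sum>x\<in>U. deg x)" using \<kappa> ec[OF fU] by simp
  \<comment> \<open>Cauchy-Schwarz turns the edge count into a lower bound for walks of length two,
    counted by their middle vertex.\<close>
  have "(\<kappa> * (real n)\<^sup>2 * q)\<^sup>2 \<le> (\<Sum>x\<in>U. deg x)\<^sup>2" using degsum \<kappa> q by (intro power_mono) auto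
  also have "\<dots> \<le> (\<Sum>x\<in>U. (deg x)\<^sup>2) * card U"
    using Cauchy_Schwarz_ineq_sum[of deg "\<lambda>_. 1" U] by simp
  also have "\<dots> \<le> (\<Sum>x\<in>U. (deg x)\<^sup>2) * n" using cU by (intro mult_left_mono sum_nonneg) auto
  finally have "real n * (\<kappa>\<^sup>2 * real n ^ 3 * q\<^sup>2) \<le> real n * (\<Sum>x\<in>U. (deg x)\<^sup>2)"
    by (simp add: power_mult_distrib power2_eq_square power3_eq_cube mult_ac)
  then have walks: "\<kappa>\<^sup>2 * real n ^ 3 * q\<^sup>2 \<le> (\<Sum>x\<in>U. (deg x)\<^sup>2)" using n by simp
  \<comment> \<open>The same walks counted by an end vertex instead.\<close>
  have walk_eq: "(\<Sum>x\<in>U. (deg x)\<^sup>2) = (\<Sum>x\<in>U. real (edge_count B (N x) U))"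
  proof -
    have "(\<Sum>x\<in>U. real (edge_count B (N x) U)) = (\<Sum>x\<in>U. \<Sum>a\<in>{a \<in> U. {x, a} \<in> B}. deg a)"
      by (simp add: ec fN) (simp add: N_def)
    also have "\<dots> = (\<Sum>a\<in>U. \<Sum>x\<in>{x \<in> U. {x, a} \<in> B}. deg a)"
      by (rule sum.swap_restrict[OF fU fU])
    also have "\<dots> = (\<Sum>a\<in>U. (deg a)\<^sup>2)"
      by (intro sum.cong refl) (simp add: deg_def N_def insert_commute power2_eq_square)
    finally show ?thesis by simp
  qed
  \<comment> \<open>Of the error \<open>(9 + 2 * D) * n\<close>, the part 8n comes from upper
    regularity, n from edges to \<open>x\<close> itself and 2Dn from passing to the core.\<close>
  have each: "real (edge_count B (N x) U) \<le> 4 * q * (deg x * card (C x)) + (9 + 2 * D) * n" if x: "x \<in> U" for x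
  proof -
    \<comment> \<open>The vertex \<open>x\<close> is removed from \<open>U\<close> because it will
      play \<open>v\<close> and must not be used again.\<close>
    obtain A' U' where core: "A' \<subseteq> N x" "U' \<subseteq> U - {x}" "\<forall>a\<in>A'. D \<le> card {y \<in> U'. {a, y} \<in> B}"
      "\<forall>y\<in>U'. D \<le> card {a \<in> A'. {a, y} \<in> B}"
      "edge_count B (N x) (U - {x}) \<le> edge_count B A' U' + D * (card (N x) + card (U - {x}))"
      using bipartite_core[of "N x" "U - {x}" D "\<lambda>a y. {a, y} \<in> B"] fN fU unfolding edge_count_def by auto
    have x_notin: "x \<notin> N x"
    proof
      assume "x \<in> N x"
      then have "{x, x} \<in> nsets {1..n} 2" using B by (auto simp: N_def)
      then show False by (simp add: nsets_def)
    qed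
    have "closes B W x y" if y: "y \<in> U'" for y
      unfolding closes_def
    proof
      show "x \<noteq> y" using y core by auto
      have fin: "finite A'" "finite U'" using core(1,2) fN[of x] fU by (auto intro: finite_subset)
      show "contains_copy \<lparr>vertices = W, edges = insert {x, y} B\<rparr> G"
      proof (rule copy_from_core[of A' U' _ y x])
        fix a assume "a \<in> A'"
        then have "D \<le> card {z \<in> U'. {a, z} \<in> B}" using core(3) by blast
        also have "\<dots> \<le> card {z \<in> U'. {a, z} \<in> insert {x, y} B}" using fin by (intro card_mono) auto
        finally show "D \<le> card {z \<in> U'. {a, z} \<in> insert {x, y} B}" .
      next
        fix z assume "z \<in> U'"
        then have "D \<le> card {a \<in> A'. {a, z} \<in> B}" using core(4) by blast
        also have "\<dots> \<le> card {a \<in> A'. {a, z} \<in> insert {x, y} B}" using fin by (intro card_mono) auto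
        finally show "D \<le> card {a \<in> A'. {a, z} \<in> insert {x, y} B}" .
      qed (use core(1,2) x_notin x U fin y in \<open>auto simp: N_def\<close>)
    qed
    then have "U' \<subseteq> C x" using core by (auto simp: C_def)
    have "edge_count B (N x) U \<le> edge_count B (N x) (U - {x}) + n"
    proof -
      have "{(a, y). a \<in> N x \<and> y \<in> U \<and> {a, y} \<in> B} \<subseteq>
          {(a, y). a \<in> N x \<and> y \<in> U - {x} \<and> {a, y} \<in> B} \<union> (\<lambda>a. (a, x)) ` N x" by auto
      then have "edge_count B (N x) U \<le> edge_count B (N x) (U - {x}) + card ((\<lambda>a. (a, x)) ` N x)"
        unfolding edge_count_def using fN[of x] fU
        by (intro order_trans[OF card_mono card_Un_le]) (auto intro: finite_subset[of _ "N x \<times> U"])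
      then show ?thesis using card_image_le[OF fN, of "\<lambda>a. (a, x)" x] cN[of x] by linarith
    qed
    also have "edge_count B (N x) (U - {x}) \<le> edge_count B A' U' + D * (n + n)"
      using core(5) cN[of x] cU card_Diff1_le[of U x]
      by (meson add_le_mono le_trans mult_le_mono2 nat_add_left_cancel_le)
    also have "edge_count B A' U' \<le> edge_count E (N x) (C x)"
      unfolding edge_count_def using core(1) \<open>U' \<subseteq> C x\<close> B(1) fN[of x] fU
      by (intro card_mono) (auto simp: C_def intro: finite_subset[of _ "N x \<times> U"])
    finally have "edge_count B (N x) U \<le> edge_count E (N x) (C x) + D * (n + n) + n" by simp
    then have "real (edge_count B (N x) U) \<le> real (edge_count E (N x) (C x) + D * (n + n) + n)"
      by (simp only: of_nat_le_iff)
    moreover have "real (edge_count E (N x) (C x)) \<le> 4 * q * card (N x) * card (C x) + 8 * n"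
    proof -
      have "N x \<subseteq> {1..n}" "C x \<subseteq> {1..n}" using NU[of x] U by (auto simp: C_def)
      then show ?thesis using reg unfolding upper_regular_def by blast
    qed
    ultimately show ?thesis by (simp add: deg_def algebra_simps)
  qed
  \<comment> \<open>Degrees above twice the regular value 4qn. For this set the main term of upper
    regularity accounts for at most half of the degree sum, so the additive term 8n bounds the other
    half.\<close>
  define Hi where "Hi = {x \<in> U. 8 * q * n < deg x}"
  have fHi: "finite Hi" and HiU: "Hi \<subseteq> U" using fU by (auto simp: Hi_def)
  have Hi_deg: "(\<Sum>x\<in>Hi. deg x) \<le> 16 * n"
  proof -
    have "real (edge_count B Hi U) \<le> real (edge_count E Hi U)"
      unfolding edge_count_def of_nat_le_iff using fHi fU B
      by (intro card_mono) (auto intro: finite_subset[of _ "Hi \<times> U"])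
    also have "\<dots> \<le> 4 * q * card Hi * card U + 8 * n"
      using reg HiU U unfolding upper_regular_def by (meson order_trans)
    also have "\<dots> \<le> 4 * q * card Hi * n + 8 * n" using q cU by (simp add: mult_left_mono)
    finally have up: "(\<Sum>x\<in>Hi. deg x) \<le> 4 * q * card Hi * n + 8 * n" using ec[OF fHi] by simp
    have "(\<Sum>x\<in>Hi. 8 * q * n) \<le> (\<Sum>x\<in>Hi. deg x)" by (intro sum_mono) (auto simp: Hi_def)
    then have "8 * q * card Hi * n \<le> (\<Sum>x\<in>Hi. deg x)" by (simp add: mult_ac)
    then show ?thesis using up by linarith
  qed
  have "(\<Sum>x\<in>U. deg x * card (C x)) = (\<Sum>x\<in>Hi. deg x * card (C x)) + (\<Sum>x\<in>U - Hi. deg x * card (C x))"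
    using sum.subset_diff[OF HiU fU, of "\<lambda>x. deg x * card (C x)"] by simp
  also have "(\<Sum>x\<in>Hi. deg x * card (C x)) \<le> (\<Sum>x\<in>Hi. deg x * n)"
    using cC by (intro sum_mono mult_left_mono) (auto simp: deg_def)
  also have "\<dots> \<le> 16 * n * n"
    using Hi_deg by (simp add: sum_distrib_right[symmetric] mult_right_mono)
  also have "(\<Sum>x\<in>U - Hi. deg x * card (C x)) \<le> (\<Sum>x\<in>U - Hi. 8 * q * n * card (C x))"
    by (intro sum_mono mult_right_mono) (auto simp: Hi_def)
  also have "\<dots> \<le> (\<Sum>x\<in>U. 8 * q * n * card (C x))"
    using fU q by (intro sum_mono2) auto
  finally have degC: "(\<Sum>x\<in>U. deg x * card (C x)) \<le> 16 * n * n + 8 * q * n * (\<Sum>x\<in>U. real (card (C x)))"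
    by (simp add: sum_distrib_left)
  let ?\<Sigma> = "\<Sum>x\<in>U. real (card (C x))"
  have "\<kappa>\<^sup>2 * real n ^ 3 * q\<^sup>2 \<le> (\<Sum>x\<in>U. 4 * q * (deg x * card (C x)) + (9 + 2 * D) * n)"
    using walks each unfolding walk_eq by (meson order_trans sum_mono)
  also have "\<dots> = 4 * q * (\<Sum>x\<in>U. deg x * card (C x)) + card U * ((9 + 2 * real D) * n)"
    by (simp add: sum.distrib sum_distrib_left)
  also have "\<dots> \<le> 4 * q * (16 * n * n + 8 * q * n * ?\<Sigma>) + n * ((9 + 2 * real D) * n)"
    using degC q cU by (intro add_mono mult_left_mono mult_right_mono) auto
  also have "\<dots> \<le> 64 * (real n)\<^sup>2 + 32 * q\<^sup>2 * n * ?\<Sigma> + (9 + 2 * D) * (real n)\<^sup>2"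
  proof -
    have "q * (real n)\<^sup>2 \<le> 1 * (real n)\<^sup>2" using q by (intro mult_right_mono) auto
    then show ?thesis by (simp add: power2_eq_square algebra_simps)
  qed
  also have "\<dots> = (73 + 2 * D) * (real n)\<^sup>2 + 32 * q\<^sup>2 * n * ?\<Sigma>" by (simp add: algebra_simps)
  \<comment> \<open>Here 73 = 64 + 9, from the vertices in \<open>Hi\<close> and from the error in
    \<open>each\<close>. The hypothesis \<open>big\<close> makes this at most half of the walk
    count; the other half gives 1/2 : 32 = 1/64.\<close>
  also have "(73 + 2 * D) * (real n)\<^sup>2 \<le> \<kappa>\<^sup>2 * (real n * q\<^sup>2) / 2 * (real n)\<^sup>2"
    using big by (intro mult_right_mono) auto
  finally have "\<kappa>\<^sup>2 * real n ^ 3 * q\<^sup>2 / 2 \<le> 32 * q\<^sup>2 * n * ?\<Sigma>"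
    by (simp add: power2_eq_square power3_eq_cube algebra_simps)
  then have "(32 * q\<^sup>2 * n) * (\<kappa>\<^sup>2 / 64 * (real n)\<^sup>2) \<le> (32 * q\<^sup>2 * n) * ?\<Sigma>"
    by (simp add: power2_eq_square power3_eq_cube mult_ac)
  then have "\<kappa>\<^sup>2 / 64 * (real n)\<^sup>2 \<le> ?\<Sigma>" using q0 n by (simp add: mult_le_cancel_left)
  also have "?\<Sigma> = real (card {(x, y). x \<in> U \<and> y \<in> U \<and> closes B W x y})"
    by (simp add: card_pairs_eq[OF fU fU] C_def)
  finally show ?thesis .
qed

end


section \<open>The regime of edge probabilities\<close>

text \<open>Pairs far above the threshold, as a filter: n^2 p^(t-1) tends to infinity, and so does n
  because p is at most 1. Working with pairs rather than sequences allows p to be rescaled and makes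
  all bounds uniform in the dense graph.\<close>

definition regime :: "nat \<Rightarrow> (nat \<times> real) filter" where
  "regime t = inf (filtercomap (\<lambda>(n, p). (real n)\<^sup>2 * p ^ (t - 1)) at_top) (principal {(n, p). 0 \<le> p \<and> p \<le> 1})"

lemma eventually_regime:
  "eventually P (regime t) \<longleftrightarrow> (\<exists>L. \<forall>n p. 0 \<le> p \<longrightarrow> p \<le> 1 \<longrightarrow> L \<le> (real n)\<^sup>2 * p ^ (t - 1) \<longrightarrow> P (n, p))"
  unfolding regime_def eventually_inf_principal eventually_filtercomap_at_top_linorder
  by (auto simp: Ball_def)

lemma regime_prob: "\<forall>\<^sub>F (n, p) in regime t. 0 \<le> p \<and> p \<le> 1"
  unfolding eventually_regime by auto

lemma filterlim_regime_main: "filterlim (\<lambda>(n, p). (real n)\<^sup>2 * p ^ (t - 1)) at_top (regime t)"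
  unfolding filterlim_at_top eventually_regime by auto

lemma filterlim_regime_sqrt: "filterlim (\<lambda>(n, p). sqrt ((real n)\<^sup>2 * p ^ (t - 1))) at_top (regime t)"
  using filterlim_compose[OF sqrt_at_top filterlim_regime_main] by (simp add: case_prod_unfold)

text \<open>As t - 1 \<ge> 4, n^2 p^(t-1) is at most (n p^2)^2.\<close>

lemma filterlim_regime_np2:
  assumes "t \<ge> 5"
  shows "filterlim (\<lambda>(n, p). real n * p\<^sup>2) at_top (regime t)"
proof (rule filterlim_at_top_mono[OF filterlim_regime_sqrt])
  show "\<forall>\<^sub>F x in regime t. (case x of (n, p) \<Rightarrow> sqrt ((real n)\<^sup>2 * p ^ (t - 1))) \<le> (case x of (n, p) \<Rightarrow> real n * p\<^sup>2)"
    using regime_prob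
  proof eventually_elim
    case (elim x)
    obtain n p where x: "x = (n, p)" by (cases x)
    have "p ^ (t - 1) \<le> p ^ 4" using elim x assms by (intro power_decreasing) auto
    then have "(real n)\<^sup>2 * p ^ (t - 1) \<le> (real n * p\<^sup>2)\<^sup>2"
      by (simp add: power_mult_distrib mult_left_mono flip: power_mult)
    then show ?case using elim x by (simp add: real_le_lsqrt)
  qed
qed

lemma filterlim_regime_np:
  assumes "t \<ge> 5"
  shows "filterlim (\<lambda>(n, p). real n * p) at_top (regime t)"
proof (rule filterlim_at_top_mono[OF filterlim_regime_np2[OF assms]])
  show "\<forall>\<^sub>F x in regime t. (case x of (n, p) \<Rightarrow> real n * p\<^sup>2) \<le> (case x of (n, p) \<Rightarrow> real n * p)"
    using regime_prob
    by eventually_elim (auto simp: power2_eq_square mult_left_le intro!: mult_left_mono)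
qed

lemma filterlim_regime_n:
  assumes "t \<ge> 5"
  shows "filterlim (\<lambda>(n, p). real n) at_top (regime t)"
proof (rule filterlim_at_top_mono[OF filterlim_regime_np[OF assms]])
  show "\<forall>\<^sub>F x in regime t. (case x of (n, p) \<Rightarrow> real n * p) \<le> (case x of (n, p) \<Rightarrow> real n)"
    using regime_prob by eventually_elim (auto simp: mult_left_le)
qed

text \<open>A constant factor in p changes n^2 p^(t-1) by a constant factor only. Both exposure
  rounds therefore stay in the regime.\<close>

lemma filterlim_regime_scale:
  assumes "0 < \<eta>" "\<eta> \<le> 1"
  shows "filterlim (\<lambda>(n, p). (n, \<eta> * p)) (regime t) (regime t)"
  unfolding filterlim_def le_filter_def eventually_filtermap
proof (intro allI impI)
  fix P assume "eventually P (regime t)"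
  then obtain L where L: "\<And>n p. 0 \<le> p \<Longrightarrow> p \<le> 1 \<Longrightarrow> L \<le> (real n)\<^sup>2 * p ^ (t - 1) \<Longrightarrow> P (n, p)"
    unfolding eventually_regime by blast
  have "P (n, \<eta> * p)" if "0 \<le> p" "p \<le> 1" "L / \<eta> ^ (t - 1) \<le> (real n)\<^sup>2 * p ^ (t - 1)" for n p
  proof (rule L)
    show "0 \<le> \<eta> * p" using assms that by simp
    show "\<eta> * p \<le> 1" using mult_mono[of \<eta> 1 p 1] assms that by simp
    show "L \<le> (real n)\<^sup>2 * (\<eta> * p) ^ (t - 1)"
      using that(3) assms(1) by (simp add: divide_le_eq power_mult_distrib mult_ac)
  qed
  then show "\<forall>\<^sub>F x in regime t. P (case x of (n, p) \<Rightarrow> (n, \<eta> * p))"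
    unfolding eventually_regime by auto
qed

text \<open>As np tends to infinity, the term of order n^2 p outweighs any multiple of n.\<close>

lemma tendsto_regime_exp:
  assumes "t \<ge> 5" "0 < b"
  shows "((\<lambda>(n, p). exp (a * real n - b * ((real n)\<^sup>2 * p))) \<longlongrightarrow> 0) (regime t)"
proof -
  have "filterlim (\<lambda>(n, p). b * ((real n)\<^sup>2 * p) - a * real n) at_top (regime t)"
  proof (rule filterlim_at_top_mono[OF filterlim_regime_n[OF assms(1)]])
    show "\<forall>\<^sub>F x in regime t. (case x of (n, p) \<Rightarrow> real n) \<le> (case x of (n, p) \<Rightarrow> b * ((real n)\<^sup>2 * p) - a * real n)"
      using filterlim_regime_np[OF assms(1), unfolded filterlim_at_top, rule_format, of "(a + 1) / b"]
    proof eventually_elim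
      case (elim x)
      obtain n p where x: "x = (n, p)" by (cases x)
      have "a + 1 \<le> b * (n * p)" using elim x assms(2) by (simp add: divide_le_eq mult.commute)
      then have "real n * (a + 1) \<le> real n * (b * (n * p))" by (intro mult_left_mono) auto
      then show ?case using x by (simp add: power2_eq_square algebra_simps)
    qed
  qed
  then have "filterlim (\<lambda>x. - (case x of (n, p) \<Rightarrow> b * ((real n)\<^sup>2 * p) - a * real n)) at_bot (regime t)"
    by (simp add: filterlim_uminus_at_top[symmetric] filterlim_uminus_at_bot)
  from filterlim_compose[OF exp_at_bot this] show ?thesis
    by (simp add: case_prod_unfold)
qed

section \<open>Tail bounds for edges and cliques, and sums over small edge sets\<close>

lemma card_pairs_le: "card (nsets {1..n} 2) \<le> n\<^sup>2"
proof -
  have "nsets {1..n} 2 \<subseteq> (\<lambda>(x, y). {x, y}) ` ({1..n} \<times> {1..n})"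
  proof
    fix e assume "e \<in> nsets {1..n} 2"
    then obtain x y where "e = {x, y}" "x \<in> {1..n}" "y \<in> {1..n}" by (rule nsets2_E)
    then show "e \<in> (\<lambda>(x, y). {x, y}) ` ({1..n} \<times> {1..n})" by (intro image_eqI[of _ _ "(x, y)"]) auto
  qed
  then have "card (nsets {1..n} 2) \<le> card ({1..n} \<times> {1..n})" by (rule surj_card_le[rotated]) simp
  then show ?thesis by (simp add: power2_eq_square)
qed

lemma finite_pairs: "finite (nsets {1..n :: nat} 2)"
  by (rule finite_imp_finite_nsets) simp

lemma edge_count_le_card:
  assumes "finite E" "\<And>a x. a \<in> A \<Longrightarrow> x \<in> U \<Longrightarrow> {a, x} \<in> E \<Longrightarrow> {a, x} \<in> Z"
  shows "edge_count E A U \<le> 2 * card (E \<inter> Z)"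
proof -
  let ?F = "\<lambda>e. {(a, x). {a, x} = e}"
  have F: "finite (?F e) \<and> card (?F e) \<le> 2" for e :: "nat set"
  proof (cases "\<exists>b c. e = {b, c}")
    case True
    then obtain b c where e: "e = {b, c}" by blast
    have sub: "?F e \<subseteq> {(b, c), (c, b)}" by (auto simp: e doubleton_eq_iff)
    have "card (?F e) \<le> card {(b, c), (c, b)}" by (rule card_mono[OF _ sub]) simp
    also have "\<dots> \<le> 2" using card_length[of "[(b, c), (c, b)]"] by simp
    finally show ?thesis using finite_subset[OF sub] by simp
  next
    case False
    then have "?F e = {}" by blast
    then show ?thesis by simp
  qed
  have fin: "finite (E \<inter> Z)" using assms by simp
  have "edge_count E A U \<le> card (\<Union>e\<in>E \<inter> Z. ?F e)"
    unfolding edge_count_def using assms fin F by (intro card_mono finite_UN_I) auto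
  also have "\<dots> \<le> (\<Sum>e\<in>E \<inter> Z. card (?F e))" by (rule card_UN_le[OF fin])
  also have "\<dots> \<le> (\<Sum>e\<in>E \<inter> Z. 2)" using F by (intro sum_mono) blast
  finally show ?thesis by simp
qed

text \<open>A Chernoff bound via the exponential moment with base e. Each of the 4^n pairs of sets
  fails with probability at most exp(-4n).\<close>

lemma pr_not_upper_regular:
  assumes "0 \<le> p" "p \<le> 1"
  shows "pr (nsets {1..n} 2) p (\<lambda>E. \<not> upper_regular n p E) \<le> (1 / 2) ^ n"
proof -
  let ?P = "nsets {1..n} 2"
  have each: "pr ?P p (\<lambda>E. real (edge_count E A U) > 4 * p * card A * card U + 8 * n) \<le> exp (- (4 * real n))"
    if A: "A \<subseteq> {1..n}" and U: "U \<subseteq> {1..n}" for A U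
  proof -
    define Z where "Z = {e \<in> ?P. \<exists>a\<in>A. \<exists>x\<in>U. e = {a, x}}"
    have fAU: "finite A" "finite U" using A U finite_subset by auto
    have "Z \<subseteq> (\<lambda>(a, x). {a, x}) ` (A \<times> U)" by (auto simp: Z_def)
    then have "card Z \<le> card (A \<times> U)" by (rule surj_card_le[rotated]) (use fAU in simp)
    then have cZ: "real (card Z) \<le> card A * card U" by (simp add: card_cartesian_product flip: of_nat_mult)
    \<comment> \<open>Half of the forbidden count, because an edge gives at most two ordered
      pairs.\<close>
    let ?k = "2 * p * card A * card U + 4 * n"
    have "pr ?P p (\<lambda>E. real (edge_count E A U) > 4 * p * card A * card U + 8 * n) \<le>
        expect ?P p (\<lambda>E. exp (- ?k) * exp 1 ^ card (E \<inter> Z))"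
    proof (rule expect_mono[OF assms])
      fix E assume E: "E \<subseteq> ?P"
      then have fE: "finite E" using finite_pairs finite_subset by blast
      have "{a, x} \<in> Z" if ax: "a \<in> A" "x \<in> U" "{a, x} \<in> E" for a x
      proof -
        have "{a, x} \<in> ?P" by (rule subsetD[OF E ax(3)])
        then show ?thesis using ax(1,2) by (auto simp: Z_def simp del: doubleton_in_nsets_2)
      qed
      then have "edge_count E A U \<le> 2 * card (E \<inter> Z)"
        by (rule edge_count_le_card[OF fE])
      then have le: "real (edge_count E A U) \<le> 2 * real (card (E \<inter> Z))" by linarith
      have eq: "exp (- ?k) * exp 1 ^ card (E \<inter> Z) = exp (card (E \<inter> Z) - ?k)"
        by (simp add: exp_of_nat_mult[symmetric] exp_add[symmetric])
      show "of_bool (real (edge_count E A U) > 4 * p * card A * card U + 8 * n) \<le> exp (- ?k) * exp 1 ^ card (E \<inter> Z)"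
        unfolding eq using le by (auto simp: of_bool_def)
    qed
    also have "\<dots> = exp (- ?k) * (1 - p + p * exp 1) ^ card Z"
      unfolding expect_cmult by (subst expect_power_card[OF finite_pairs]) (auto simp: Z_def)
    also have "(1 - p + p * exp 1) ^ card Z \<le> exp (2 * p) ^ card Z"
    proof (rule power_mono)
      have "1 - p + p * exp 1 \<le> 1 + 2 * p"
        using mult_left_mono[OF exp_le assms(1)] by simp
      also have "\<dots> \<le> exp (2 * p)" by (rule exp_ge_add_one_self)
      finally show "1 - p + p * exp 1 \<le> exp (2 * p)" .
      show "0 \<le> 1 - p + p * exp 1" using assms by simp
    qed
    also have "exp (- ?k) * exp (2 * p) ^ card Z = exp (2 * p * card Z - ?k)"
      by (simp add: exp_of_nat_mult[symmetric] exp_add[symmetric] mult_ac)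
    also have "\<dots> \<le> exp (- (4 * real n))"
      using mult_left_mono[OF cZ, of "2 * p"] assms by (simp add: mult_ac)
    finally show ?thesis by simp
  qed
  let ?AU = "Pow {1..n} \<times> Pow {1..n}"
  have "pr ?P p (\<lambda>E. \<not> upper_regular n p E) \<le>
      (\<Sum>i\<in>?AU. pr ?P p (\<lambda>E. real (edge_count E (fst i) (snd i)) > 4 * p * card (fst i) * card (snd i) + 8 * n))"
  proof (rule pr_union_bound[OF assms])
    fix E assume "\<not> upper_regular n p E"
    then obtain A U where "A \<subseteq> {1..n}" "U \<subseteq> {1..n}" "real (edge_count E A U) > 4 * p * card A * card U + 8 * n"
      unfolding upper_regular_def not_all not_imp not_le by blast
    then show "\<exists>i\<in>?AU. real (edge_count E (fst i) (snd i)) > 4 * p * card (fst i) * card (snd i) + 8 * n"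
      by (intro bexI[of _ "(A, U)"]) auto
  qed simp
  also have "\<dots> \<le> (\<Sum>i\<in>?AU. exp (- (4 * real n)))"
    by (intro sum_mono each) auto
  also have "\<dots> = (2 ^ n * 2 ^ n) * exp (real n * (- 4))"
    by (simp add: card_cartesian_product card_Pow mult.commute)
  also have "\<dots> = (2 * 2 * exp (- 4)) ^ n"
    unfolding exp_of_nat_mult power_mult_distrib ..
  also have "\<dots> = (4 * exp (- 4)) ^ n" by (rule arg_cong[where f = "\<lambda>x. x ^ n"]) simp
  also have "\<dots> \<le> (1 / 2) ^ n"
  proof (rule power_mono)
    have "2 \<le> exp (1 :: real)" using exp_ge_add_one_self[of "1 :: real"] by linarith
    then have "2 ^ 4 \<le> exp (1 :: real) ^ 4" by (rule power_mono) simp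
    moreover have "exp (1 :: real) ^ 4 = exp 4" using exp_of_nat_mult[of 4 "1 :: real"] by simp
    moreover have "8 \<le> (2 :: real) ^ 4" by simp
    ultimately have "8 \<le> exp (4 :: real)" by (metis order_trans)
    then have "4 * inverse (exp 4) \<le> 4 * inverse (8 :: real)"
      by (intro mult_left_mono le_imp_inverse_le) auto
    then show "4 * exp (- 4) \<le> (1 / 2 :: real)" by (simp add: exp_minus)
  qed simp
  finally show ?thesis .
qed

lemma nsets_set_conv_nth:
  assumes "distinct xs"
  shows "(`) (\<lambda>i\<in>{..<length xs}. xs ! i) ` nsets {..<length xs} 2 = nsets (set xs) 2"
proof -
  have bij: "bij_betw (\<lambda>i\<in>{..<length xs}. xs ! i) {..<length xs} (set xs)"
    using bij_betw_nth[OF assms refl refl] by (subst bij_betw_cong[of _ _ "(!) xs"]) auto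
  then show ?thesis using bij_betw_nsets[OF bij, of 2] by (simp add: bij_betw_def)
qed

text \<open>A list is read as the map taking an index to its entry, so \<open>janson_embed\<close>
  applies to the complete graph on the indices. Its subgraphs matter only through their number j of
  vertices.\<close>

lemma janson_cliques:
  assumes s: "s \<ge> 2" and P: "finite P" "0 < p" "p \<le> 1"
    and L: "\<And>xs. xs \<in> L \<Longrightarrow> length xs = s \<and> distinct xs \<and> set xs \<subseteq> {1..n} \<and> nsets (set xs) 2 \<subseteq> P"
    and cL: "0 < \<gamma>" "\<gamma> * real n ^ s \<le> card L"
    and M: "0 < M" "\<And>j. 2 \<le> j \<Longrightarrow> j \<le> s \<Longrightarrow> M \<le> real n ^ j * p ^ (j choose 2)"
  shows "pr P p (\<lambda>E. \<forall>xs\<in>L. \<not> nsets (set xs) 2 \<subseteq> E) \<le> exp (- \<gamma> * M / (2 * (2 * s) ^ s))"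
proof -
  define \<phi> where "\<phi> = (\<lambda>xs :: nat list. \<lambda>i\<in>{..<s}. xs ! i)"
  have \<phi>_edges: "(`) (\<phi> xs) ` nsets {..<s} 2 = nsets (set xs) 2" if "xs \<in> L" for xs
    using nsets_set_conv_nth[of xs] L[OF that] by (simp add: \<phi>_def)
  have inj: "inj_on \<phi> L"
  proof (rule inj_onI)
    fix xs ys assume *: "xs \<in> L" "ys \<in> L" "\<phi> xs = \<phi> ys"
    have "xs ! i = ys ! i" if "i < s" for i
      using fun_cong[OF *(3), of i] that by (simp add: \<phi>_def)
    then show "xs = ys" using L[OF *(1)] L[OF *(2)] by (intro nth_equalityI) auto
  qed
  have ne: "nsets {..<s} 2 \<noteq> {}" using s by (simp add: nsets_eq_empty_iff)
  have "pr P p (\<lambda>E. \<forall>\<psi>\<in>\<phi> ` L. \<not> (`) \<psi> ` nsets {..<s} 2 \<subseteq> E)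
      \<le> exp (- \<gamma> * M / (2 * (2 * card {..<s}) ^ card {..<s}))"
  proof (rule janson_embed[OF _ subset_refl ne P _ _ _ cL(1) _ M(1)])
    show "\<phi> ` L \<subseteq> {..<s} \<rightarrow>\<^sub>E {1..n}"
    proof
      fix \<psi> assume "\<psi> \<in> \<phi> ` L"
      then obtain xs where xs: "xs \<in> L" "\<psi> = \<phi> xs" by blast
      have "xs ! i \<in> {1..n}" if "i < s" for i
        using L[OF xs(1)] that by (metis nth_mem subsetD)
      then show "\<psi> \<in> {..<s} \<rightarrow>\<^sub>E {1..n}" using xs by (auto simp: \<phi>_def)
    qed
    show "inj_on \<psi> {..<s}" if "\<psi> \<in> \<phi> ` L" for \<psi>
      using that L by (force simp: \<phi>_def inj_on_def nth_eq_iff_index_eq)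
    show "\<psi> ` e \<in> P" if \<psi>: "\<psi> \<in> \<phi> ` L" and e: "e \<in> nsets {..<s} 2" for \<psi> e
    proof -
      obtain xs where xs: "xs \<in> L" "\<psi> = \<phi> xs" using \<psi> by blast
      then have "\<psi> ` e \<in> nsets (set xs) 2" using \<phi>_edges[OF xs(1)] e by blast
      then show ?thesis using L[OF xs(1)] by blast
    qed
    show "\<gamma> * real n ^ card {..<s} \<le> real (card (\<phi> ` L))"
      using cL by (simp add: card_image[OF inj])
    show "M \<le> real n ^ card J * p ^ card {e \<in> nsets {..<s} 2. e \<subseteq> J}"
      if J: "J \<subseteq> {..<s}" "{e \<in> nsets {..<s} 2. e \<subseteq> J} \<noteq> {}" for J
    proof -
      have eq: "{e \<in> nsets {..<s} 2. e \<subseteq> J} = nsets J 2" using J(1) by (auto simp: nsets_def)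
      have fJ: "finite J" using J finite_subset by auto
      have "card J \<le> s" using card_mono[OF _ J(1)] by simp
      moreover have "card J \<ge> 2" using J(2) fJ unfolding eq by (simp add: nsets_eq_empty_iff)
      moreover have "card (nsets J 2) = card J choose 2"
        unfolding nsets_def using n_subsets[OF fJ, of 2] fJ
        by (metis (no_types, lifting) Collect_cong finite_subset)
      ultimately show ?thesis unfolding eq using M(2)[of "card J"] by simp
    qed
  qed simp
  also have "(\<lambda>E. \<forall>\<psi>\<in>\<phi> ` L. \<not> (`) \<psi> ` nsets {..<s} 2 \<subseteq> E) = (\<lambda>E. \<forall>xs\<in>L. \<not> nsets (set xs) 2 \<subseteq> E)"
    using \<phi>_edges by (auto simp: fun_eq_iff)
  finally show ?thesis by simp
qed

text \<open>With j = i + 2, the quotient of the two sides is n^i p^(i(i+3)/2), whose square is (n^2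
  p^(i+3))^i. It is at least 1 exactly because i + 3 \<le> t - 1; this is why K_(t-2) is the largest
  clique with a rate of order n^2 p.\<close>

lemma clique_rate_pairs:
  assumes p: "0 < p" "p \<le> 1" and X: "1 \<le> (real n)\<^sup>2 * p ^ (t - 1)" and j: "2 \<le> j" "j + 2 \<le> t"
  shows "(real n)\<^sup>2 * p \<le> real n ^ j * p ^ (j choose 2)"
proof -
  obtain i where i: "j = i + 2" using j by (metis add.commute le_Suc_ex)
  have c2: "2 * (j choose 2) = (i + 3) * i + 2"
    using choose_two[of j] i by (simp add: algebra_simps)
  then have c: "j choose 2 = Suc ((j choose 2) - 1)" by (cases "j choose 2") auto
  have "p ^ (t - 1) \<le> p ^ (i + 3)" using p i j by (intro power_decreasing) auto
  then have "1 \<le> (real n)\<^sup>2 * p ^ (i + 3)" using X by (meson mult_left_mono order_trans zero_le_power2)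
  then have "1 \<le> ((real n)\<^sup>2 * p ^ (i + 3)) ^ i" by (rule one_le_power)
  also have "\<dots> = (real n ^ i * p ^ ((j choose 2) - 1))\<^sup>2"
    using c2 by (simp add: power_mult_distrib power_mult[symmetric] mult.commute diff_mult_distrib2)
  finally have "1 \<le> real n ^ i * p ^ ((j choose 2) - 1)"
    using p by (simp add: power2_nonneg_ge_1_iff)
  then have "(real n)\<^sup>2 * p * 1 \<le> (real n)\<^sup>2 * p * (real n ^ i * p ^ ((j choose 2) - 1))"
    using p by (intro mult_left_mono) auto
  also have "\<dots> = real n ^ j * (p * p ^ ((j choose 2) - 1))" by (simp add: i power_add mult_ac power2_eq_square)
  also have "p * p ^ ((j choose 2) - 1) = p ^ (j choose 2)" by (subst c) simp
  finally show ?thesis by simp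
qed

text \<open>The binomial theorem, read off from the generating function of a uniformly random
  subset.\<close>

lemma sum_Pow_power_card:
  assumes "finite P"
  shows "(\<Sum>B\<in>Pow P. (z :: real) ^ card B) = (1 + z) ^ card P"
proof -
  have "(1 / 2) ^ card P * (\<Sum>B\<in>Pow P. z ^ card B) = expect P (1 / 2) (\<lambda>E. z ^ card (E \<inter> P))"
    unfolding expect_def sum_distrib_left
  proof (rule sum.cong[OF refl])
    fix E assume "E \<in> Pow P"
    then have E: "E \<subseteq> P" by simp
    then have "card P = card E + card (P - E)"
      using assms by (metis add.commute card_Diff_subset card_mono finite_subset le_add_diff_inverse2)
    then show "(1 / 2) ^ card P * z ^ card E = (1 / 2) ^ card E * (1 - 1 / 2) ^ card (P - E) * z ^ card (E \<inter> P)"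
      using E by (simp add: power_add Int_absorb2)
  qed
  also have "\<dots> = (1 / 2 * (1 + z)) ^ card P"
    by (subst expect_power_card[OF assms subset_refl]) (simp add: add_divide_distrib)
  also have "\<dots> = (1 / 2) ^ card P * (1 + z) ^ card P" by (rule power_mult_distrib)
  finally show ?thesis by simp
qed

text \<open>An exponential tilt: on the sets counted, exp(y (b - |B|)) is at least 1, and after
  inserting this factor the sum may run over all subsets.\<close>

lemma sum_small_subsets_le:
  assumes "finite P" "0 \<le> q" "0 \<le> y"
  shows "(\<Sum>B | B \<subseteq> P \<and> real (card B) \<le> b. q ^ card B) \<le> exp (y * b + exp (- y) * q * card P)"
proof -
  have "(\<Sum>B | B \<subseteq> P \<and> real (card B) \<le> b. q ^ card B) \<le>
     (\<Sum>B | B \<subseteq> P \<and> real (card B) \<le> b. exp (y * b) * (exp (- y) * q) ^ card B)"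
  proof (rule sum_mono)
    fix B assume B: "B \<in> {B. B \<subseteq> P \<and> real (card B) \<le> b}"
    have "1 \<le> exp (y * (b - card B))" using B assms by simp
    also have "\<dots> = exp (y * b) * exp (- y) ^ card B"
      by (simp add: exp_of_nat_mult[symmetric] exp_add[symmetric] algebra_simps)
    finally have "1 * q ^ card B \<le> exp (y * b) * exp (- y) ^ card B * q ^ card B"
      using assms by (intro mult_right_mono) auto
    then show "q ^ card B \<le> exp (y * b) * (exp (- y) * q) ^ card B" by (simp add: power_mult_distrib mult_ac)
  qed
  also have "\<dots> \<le> (\<Sum>B\<in>Pow P. exp (y * b) * (exp (- y) * q) ^ card B)"
    using assms by (intro sum_mono2) auto
  also have "\<dots> = exp (y * b) * (1 + exp (- y) * q) ^ card P"
    by (simp add: sum_distrib_left[symmetric] sum_Pow_power_card assms)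
  also have "\<dots> \<le> exp (y * b) * exp (exp (- y) * q) ^ card P"
    using assms by (intro mult_left_mono power_mono) auto
  also have "\<dots> = exp (y * b + exp (- y) * q * card P)"
    by (simp add: exp_of_nat_mult[symmetric] exp_add[symmetric] mult_ac)
  finally show ?thesis .
qed


section \<open>Robust cliques\<close>

lemma two_power_le_exp: "(2 :: real) ^ n \<le> exp (real n)"
proof -
  have "2 \<le> exp (1 :: real)" using exp_ge_add_one_self[of "1 :: real"] by linarith
  then have "2 ^ n \<le> exp (1 :: real) ^ n" by (rule power_mono) simp
  also have "\<dots> = exp (real n)" using exp_of_nat_mult[of n "1 :: real"] by simp
  finally show ?thesis .
qed

lemma sorted_wrt_nsets:
  assumes "sorted_wrt r xs" "e \<in> nsets (set xs) 2"
  shows "\<exists>x y. e = {x, y} \<and> r x y"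
proof -
  obtain a b where ab: "e = {a, b}" "a \<in> set xs" "b \<in> set xs" "a \<noteq> b"
    using assms(2) by (rule nsets2_E)
  then obtain i j where ij: "i < length xs" "xs ! i = a" "j < length xs" "xs ! j = b"
    by (meson in_set_conv_nth)
  have "i \<noteq> j" using ab ij by auto
  then consider "i < j" | "j < i" by linarith
  then show ?thesis
  proof cases
    case 1
    then have "r a b" using sorted_wrt_nth_less[OF assms(1) 1 ij(3)] ij by simp
    then show ?thesis using ab by blast
  next
    case 2
    then have "r b a" using sorted_wrt_nth_less[OF assms(1) 2 ij(1)] ij by simp
    then show ?thesis using ab(1) by (metis insert_commute)
  qed
qed

lemma sorted_wrt_distinct:
  assumes "sorted_wrt r xs" "\<And>x. \<not> r x x"
  shows "distinct xs"
  using assms by (induction xs) auto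

text \<open>Resilience: deleting a small proportion of the edges leaves a clique in every large set.
  It will be applied with \<open>B\<close> the blue edges, to show that a graph without a red clique
  has many of them. The proportion is relative to \<open>q\<close>.\<close>

definition robust_cliques :: "nat \<Rightarrow> nat \<Rightarrow> real \<Rightarrow> real \<Rightarrow> real \<Rightarrow> nat set set \<Rightarrow> bool" where
  "robust_cliques n s \<delta> \<kappa> q E \<longleftrightarrow> (\<forall>U\<subseteq>{1..n}. \<forall>B\<subseteq>E. \<delta> * real n \<le> card U \<longrightarrow> card B \<le> \<kappa> * ((real n)\<^sup>2 * q) \<longrightarrow>
     (\<exists>K\<subseteq>U. finite K \<and> card K = s \<and> nsets K 2 \<subseteq> E - B))"

lemma card_pairs_sub_le:
  fixes U :: "nat set"
  assumes "finite U" "finite B"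
  shows "real (card U) ^ 2 \<le> card {(x, y). x \<in> U \<and> y \<in> U \<and> x \<noteq> y \<and> {x, y} \<notin> B} + (card U + 2 * card B)"
proof -
  let ?R = "{(x, y). x \<in> U \<and> y \<in> U \<and> x \<noteq> y \<and> {x, y} \<notin> B}"
  have fin: "finite ?R" "finite {(x, y). x \<in> U \<and> y \<in> U \<and> {x, y} \<in> B}"
    by (rule finite_subset[of _ "U \<times> U"]; use assms in auto)+
  have "U \<times> U \<subseteq> ?R \<union> ((\<lambda>x. (x, x)) ` U \<union> {(x, y). x \<in> U \<and> y \<in> U \<and> {x, y} \<in> B})" by auto
  then have "card (U \<times> U) \<le> card (?R \<union> ((\<lambda>x. (x, x)) ` U \<union> {(x, y). x \<in> U \<and> y \<in> U \<and> {x, y} \<in> B}))"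
    using assms fin by (intro card_mono) auto
  also have "\<dots> \<le> card ?R + (card ((\<lambda>x. (x, x)) ` U) + card {(x, y). x \<in> U \<and> y \<in> U \<and> {x, y} \<in> B})"
    by (intro order_trans[OF card_Un_le] add_left_mono card_Un_le)
  also have "\<dots> \<le> card ?R + (card U + 2 * card B)"
    using card_image_le[OF assms(1), of "\<lambda>x. (x, x)"] edge_count_le_card[OF assms(2), of U U UNIV]
    by (simp add: edge_count_def)
  finally have "real (card (U \<times> U)) \<le> real (card ?R + (card U + 2 * card B))"
    by (simp only: of_nat_le_iff)
  then show ?thesis by (simp add: card_cartesian_product power2_eq_square)
qed

text \<open>Of the \<delta>^2 n^2 ordered pairs, the diagonal and the pairs in \<open>B\<close> each
  remove at most a quarter.\<close>

lemma pair_dense_avoiding: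
  assumes \<delta>: "\<delta> > 0" and B: "finite B" "8 * real (card B) \<le> \<delta>\<^sup>2 * (real n)\<^sup>2" and n: "4 \<le> \<delta>\<^sup>2 * real n"
  shows "pair_dense n \<delta> (\<delta>\<^sup>2 / 2) {1..n} (\<lambda>x y. x \<noteq> y \<and> {x, y} \<notin> B)"
  unfolding pair_dense_def
proof (intro allI impI)
  fix V assume V: "V \<subseteq> {1..n}" "\<delta> * real n \<le> card V"
  have fV: "finite V" using V finite_subset by auto
  have Vn: "real (card V) \<le> real n" using card_mono[OF _ V(1)] by simp
  have "(\<delta> * real n)\<^sup>2 \<le> (real (card V))\<^sup>2" using V \<delta> by (intro power_mono) auto
  also have "\<dots> \<le> card {(x, y). x \<in> V \<and> y \<in> V \<and> x \<noteq> y \<and> {x, y} \<notin> B} + (real (card V) + 2 * real (card B))"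
    using card_pairs_sub_le[OF fV B(1)] by simp
  finally have "\<delta>\<^sup>2 * (real n)\<^sup>2 \<le> card {(x, y). x \<in> V \<and> y \<in> V \<and> x \<noteq> y \<and> {x, y} \<notin> B} + (real (card V) + 2 * real (card B))"
    by (simp add: power_mult_distrib)
  moreover have "4 * real n \<le> \<delta>\<^sup>2 * (real n)\<^sup>2"
    using mult_right_mono[OF n, of "real n"] by (simp add: power2_eq_square mult.assoc)
  ultimately show "\<delta>\<^sup>2 / 2 * (real n)\<^sup>2 \<le> card {(x, y). x \<in> V \<and> y \<in> V \<and> x \<noteq> y \<and> {x, y} \<notin> B}"
    using Vn B(2) by linarith
qed

text \<open>A union bound over the sets \<open>U\<close> and the deleted edge sets \<open>B\<close>.
  Merely counting the sets \<open>B\<close> would introduce a factor log(1/q) into the exponent.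
  Instead the event \<open>B \<subseteq> E\<close> is kept: it contributes q^|B|, and with this
  weight the sum over small \<open>B\<close> is only exp of a small multiple of n^2 q, less than
  Janson's inequality gains on the remaining pairs.\<close>

lemma robust_cliques_likely:
  assumes t: "t \<ge> 5" and s: "s \<ge> 2" "s + 2 \<le> t" and \<delta>: "\<delta> > 0"
  shows "\<exists>\<kappa>>0. ((\<lambda>(n, q). pr (nsets {1..n} 2) q (\<lambda>E. \<not> robust_cliques n s \<delta> \<kappa> q E)) \<longlongrightarrow> 0) (regime t)"
proof -
  obtain \<gamma> \<Delta> where \<gamma>: "\<gamma> > 0" "finite \<Delta>" "\<forall>\<delta>'\<in>\<Delta>. 0 < \<delta>'"
    and cliques: "\<forall>n (W :: nat set) r. W \<subseteq> {1..n} \<longrightarrow> (\<forall>\<delta>'\<in>\<Delta>. pair_dense n \<delta>' (\<delta>'\<^sup>2 / 2) W r) \<longrightarrow>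
      (\<forall>U\<subseteq>W. \<delta> * real n \<le> card U \<longrightarrow> \<gamma> * real n ^ s \<le> card {xs. length xs = s \<and> set xs \<subseteq> U \<and> sorted_wrt r xs})"
    by (rule multilevel_cliques[of "\<lambda>\<delta>'. \<delta>'\<^sup>2 / 2" \<delta> s, THEN exE], simp, rule \<delta>, elim exE conjE) (rule that)
  define c where "c = \<gamma> / (2 * (2 * real s) ^ s)"
  have c: "c > 0" using \<gamma> s by (simp add: c_def)
  \<comment> \<open>The element 1 makes the minimum meaningful when \<Delta> is empty.\<close>
  define \<delta>0 where "\<delta>0 = Min (insert 1 \<Delta>)"
  have \<delta>0: "\<delta>0 > 0" "\<And>\<delta>'. \<delta>' \<in> \<Delta> \<Longrightarrow> \<delta>0 \<le> \<delta>'" using \<gamma> by (auto simp: \<delta>0_def)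
  \<comment> \<open>The tilt comes first: it brings the term exp(-y) below c/4. Then \<kappa> is
    taken so small that y \<kappa> is below c/4 too, leaving half of the exponent c.\<close>
  define y where "y = max 0 (ln (4 / c))"
  have y: "y \<ge> 0" "exp (- y) \<le> c / 4"
  proof -
    have "exp (- y) \<le> exp (- ln (4 / c))" by (simp add: y_def)
    also have "\<dots> = c / 4" using c by (simp add: exp_minus)
    finally show "exp (- y) \<le> c / 4" .
  qed (simp add: y_def)
  \<comment> \<open>The first bound keeps all pairs outside \<open>B\<close> dense at every
    threshold in \<Delta>; the second limits the entropy of the choice of \<open>B\<close>.\<close>
  define \<kappa> where "\<kappa> = min (\<delta>0\<^sup>2 / 8) (c / (4 * (y + 1)))"
  have \<kappa>: "\<kappa> > 0" "\<kappa> \<le> \<delta>0\<^sup>2 / 8" "y * \<kappa> \<le> c / 4"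
  proof -
    show "\<kappa> > 0" using \<delta>0 c y by (simp add: \<kappa>_def)
    have "y * \<kappa> \<le> y * (c / (4 * (y + 1)))" using y by (intro mult_left_mono) (auto simp: \<kappa>_def)
    also have "\<dots> \<le> c / 4" using y c by (simp add: field_simps)
    finally show "y * \<kappa> \<le> c / 4" .
    show "\<kappa> \<le> \<delta>0\<^sup>2 / 8" unfolding \<kappa>_def by (rule min.cobounded1)
  qed
  have bound: "pr (nsets {1..n} 2) q (\<lambda>E. \<not> robust_cliques n s \<delta> \<kappa> q E) \<le> exp (1 * real n - c / 2 * ((real n)\<^sup>2 * q))"
    if q: "0 \<le> q" "q \<le> 1" and n: "4 \<le> \<delta>0\<^sup>2 * real n" and X: "1 \<le> (real n)\<^sup>2 * q ^ (t - 1)" for n q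
  proof -
    let ?P = "nsets {1..n} 2"
    have n0: "n > 0" using n by (auto intro!: Nat.gr0I)
    have q0: "q > 0" using X t q by (cases "q = 0") (auto simp: power_0_left)
    define \<B> where "\<B> = {B. B \<subseteq> ?P \<and> real (card B) \<le> \<kappa> * ((real n)\<^sup>2 * q)}"
    define \<U> where "\<U> = {U. U \<subseteq> {1..n} \<and> \<delta> * real n \<le> card U}"
    have f\<B>: "finite \<B>"
      by (rule finite_subset[of _ "Pow ?P"]) (use finite_pairs in \<open>auto simp: \<B>_def\<close>)
    have f\<U>: "finite \<U>"
      by (rule finite_subset[of _ "Pow {1..n}"]) (auto simp: \<U>_def)
    define bad where "bad = (\<lambda>(U :: nat set) B E. \<forall>K\<subseteq>U. finite K \<longrightarrow> card K = s \<longrightarrow> \<not> nsets K 2 \<subseteq> E - B)"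
    have each: "pr ?P q (\<lambda>E. B \<subseteq> E \<and> bad U B E) \<le> q ^ card B * exp (- c * ((real n)\<^sup>2 * q))"
      if U: "U \<in> \<U>" and B: "B \<in> \<B>" for U B
    proof -
      have BP: "B \<subseteq> ?P" and cB: "real (card B) \<le> \<kappa> * ((real n)\<^sup>2 * q)" using B by (auto simp: \<B>_def)
      have fB: "finite B" by (rule finite_subset[OF BP finite_pairs])
      define r where "r = (\<lambda>x y. x \<noteq> y \<and> {x, y} \<notin> B)"
      have dense: "pair_dense n \<delta>' (\<delta>'\<^sup>2 / 2) {1..n} r" if \<delta>': "\<delta>' \<in> \<Delta>" for \<delta>'
        unfolding r_def
      proof (rule pair_dense_avoiding[OF _ fB])
        have sq: "\<delta>0\<^sup>2 \<le> \<delta>'\<^sup>2" using \<delta>0 \<delta>' by (intro power_mono) auto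
        have "real (card B) \<le> \<kappa> * ((real n)\<^sup>2 * 1)"
          using q \<kappa> by (intro order_trans[OF cB] mult_left_mono) auto
        also have "\<dots> \<le> \<delta>'\<^sup>2 / 8 * (real n)\<^sup>2"
          unfolding mult_1_right using \<kappa>(2) sq by (intro mult_right_mono) auto
        finally show "8 * real (card B) \<le> \<delta>'\<^sup>2 * (real n)\<^sup>2" by simp
        show "4 \<le> \<delta>'\<^sup>2 * real n" using n mult_right_mono[OF sq, of "real n"] by linarith
      qed (use \<gamma> \<delta>' in auto)
      define L where "L = {xs. length xs = s \<and> set xs \<subseteq> U \<and> sorted_wrt r xs}"
      have cL: "\<gamma> * real n ^ s \<le> card L"
        unfolding L_def using cliques dense U by (auto simp: \<U>_def)
      have L_edges: "nsets (set xs) 2 \<subseteq> ?P - B" and L_dist: "distinct xs" if "xs \<in> L" for xs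
      proof -
        have sorted: "sorted_wrt r xs" and sub: "set xs \<subseteq> {1..n}" using that U by (auto simp: L_def \<U>_def)
        show "distinct xs" using sorted by (rule sorted_wrt_distinct) (simp add: r_def)
        show "nsets (set xs) 2 \<subseteq> ?P - B"
        proof
          fix e assume e: "e \<in> nsets (set xs) 2"
          then have "e \<in> ?P" using nsets_mono[OF sub] by blast
          moreover have "e \<notin> B" using sorted_wrt_nsets[OF sorted e] by (auto simp: r_def)
          ultimately show "e \<in> ?P - B" by simp
        qed
      qed
      have "pr ?P q (\<lambda>E. B \<subseteq> E \<and> bad U B E) = q ^ card B * pr (?P - B) q (\<lambda>E. bad U B (E \<union> B))"
        by (rule pr_superset_and[OF finite_pairs BP])
      also have "pr (?P - B) q (\<lambda>E. bad U B (E \<union> B)) \<le> pr (?P - B) q (\<lambda>E. \<forall>xs\<in>L. \<not> nsets (set xs) 2 \<subseteq> E)"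
      proof (rule pr_mono[OF q], rule ballI, rule notI)
        fix E xs assume E: "E \<subseteq> ?P - B" "bad U B (E \<union> B)" and xs: "xs \<in> L" "nsets (set xs) 2 \<subseteq> E"
        have "set xs \<subseteq> U" "card (set xs) = s"
          using xs L_dist[OF xs(1)] by (auto simp: L_def distinct_card)
        moreover have "nsets (set xs) 2 \<subseteq> (E \<union> B) - B" using xs E L_edges[OF xs(1)] by auto
        ultimately show False using E(2) unfolding bad_def by blast
      qed
      also have "\<dots> \<le> exp (- \<gamma> * ((real n)\<^sup>2 * q) / (2 * (2 * s) ^ s))"
      proof (rule janson_cliques[OF s(1) _ q0 q(2) _ \<gamma>(1) cL])
        show "length xs = s \<and> distinct xs \<and> set xs \<subseteq> {1..n} \<and> nsets (set xs) 2 \<subseteq> ?P - B" if "xs \<in> L" for xs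
          using that L_edges[OF that] L_dist[OF that] U by (auto simp: L_def \<U>_def)
        show "(real n)\<^sup>2 * q \<le> real n ^ j * q ^ (j choose 2)" if "2 \<le> j" "j \<le> s" for j
          using that s by (intro clique_rate_pairs[OF q0 q(2) X]) auto
      qed (use finite_pairs n0 q0 in auto)
      also have "- \<gamma> * ((real n)\<^sup>2 * q) / (2 * (2 * s) ^ s) = - c * ((real n)\<^sup>2 * q)" by (simp add: c_def)
      finally show ?thesis using q by (simp add: mult_left_mono)
    qed
    have "pr ?P q (\<lambda>E. \<not> robust_cliques n s \<delta> \<kappa> q E) \<le>
        (\<Sum>i\<in>\<U> \<times> \<B>. pr ?P q (\<lambda>E. snd i \<subseteq> E \<and> bad (fst i) (snd i) E))"
    proof (rule pr_union_bound[OF q])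
      fix E assume E: "E \<subseteq> ?P" "\<not> robust_cliques n s \<delta> \<kappa> q E"
      then obtain U B where UB: "U \<subseteq> {1..n}" "B \<subseteq> E" "\<delta> * real n \<le> card U" "card B \<le> \<kappa> * ((real n)\<^sup>2 * q)"
        "bad U B E"
        unfolding robust_cliques_def bad_def by blast
      then have "(U, B) \<in> \<U> \<times> \<B>" using E by (auto simp: \<U>_def \<B>_def)
      then show "\<exists>i\<in>\<U> \<times> \<B>. snd i \<subseteq> E \<and> bad (fst i) (snd i) E"
        using UB by (intro bexI[of _ "(U, B)"]) auto
    qed (use f\<U> f\<B> in auto)
    also have "\<dots> \<le> (\<Sum>i\<in>\<U> \<times> \<B>. q ^ card (snd i) * exp (- c * ((real n)\<^sup>2 * q)))"
      by (intro sum_mono each) auto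
    also have "\<dots> = real (card \<U>) * ((\<Sum>B\<in>\<B>. q ^ card B) * exp (- c * ((real n)\<^sup>2 * q)))"
      using f\<U> f\<B> by (simp add: sum.cartesian_product' sum_distrib_right)
    also have "\<dots> \<le> exp (real n) * (exp (y * (\<kappa> * ((real n)\<^sup>2 * q)) + exp (- y) * q * (real n)\<^sup>2) * exp (- c * ((real n)\<^sup>2 * q)))"
    proof (rule mult_mono)
      have "card \<U> \<le> card (Pow {1..n})" by (intro card_mono) (auto simp: \<U>_def)
      then have "card \<U> \<le> 2 ^ n" by (simp add: card_Pow)
      then have "real (card \<U>) \<le> real (2 ^ n)" by (simp only: of_nat_le_iff)
      then show "real (card \<U>) \<le> exp (real n)"
        unfolding of_nat_power of_nat_numeral using two_power_le_exp by (rule order_trans)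
      have "real (card ?P) \<le> real (n\<^sup>2)" unfolding of_nat_le_iff by (rule card_pairs_le)
      then have "exp (- y) * q * card ?P \<le> exp (- y) * q * (real n)\<^sup>2"
        unfolding of_nat_power using q by (intro mult_left_mono) auto
      then have "exp (y * (\<kappa> * ((real n)\<^sup>2 * q)) + exp (- y) * q * card ?P) \<le>
          exp (y * (\<kappa> * ((real n)\<^sup>2 * q)) + exp (- y) * q * (real n)\<^sup>2)" by simp
      with sum_small_subsets_le[OF finite_pairs q(1) y(1), of n "\<kappa> * ((real n)\<^sup>2 * q)"]
      have "(\<Sum>B\<in>\<B>. q ^ card B) \<le> exp (y * (\<kappa> * ((real n)\<^sup>2 * q)) + exp (- y) * q * (real n)\<^sup>2)"
        unfolding \<B>_def by (rule order_trans)
      then show "(\<Sum>B\<in>\<B>. q ^ card B) * exp (- c * ((real n)\<^sup>2 * q)) \<le>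
         exp (y * (\<kappa> * ((real n)\<^sup>2 * q)) + exp (- y) * q * (real n)\<^sup>2) * exp (- c * ((real n)\<^sup>2 * q))"
        by (rule mult_right_mono) simp
      show "0 \<le> (\<Sum>B\<in>\<B>. q ^ card B) * exp (- c * ((real n)\<^sup>2 * q))"
        using q by (intro mult_nonneg_nonneg sum_nonneg) auto
    qed simp
    also have "\<dots> = exp (real n + (y * \<kappa> + exp (- y)) * ((real n)\<^sup>2 * q) - c * ((real n)\<^sup>2 * q))"
      by (simp add: exp_add[symmetric] algebra_simps)
    also have "\<dots> \<le> exp (1 * real n - c / 2 * ((real n)\<^sup>2 * q))"
    proof -
      have "(y * \<kappa> + exp (- y)) * ((real n)\<^sup>2 * q) \<le> (c / 2) * ((real n)\<^sup>2 * q)"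
        using \<kappa>(3) y(2) q by (intro mult_right_mono) auto
      then show ?thesis by simp
    qed
    finally show ?thesis .
  qed
  have "((\<lambda>(n, q). pr (nsets {1..n} 2) q (\<lambda>E. \<not> robust_cliques n s \<delta> \<kappa> q E)) \<longlongrightarrow> 0) (regime t)"
  proof (rule tendsto_sandwich[OF _ _ tendsto_const tendsto_regime_exp[OF t, of "c / 2" 1]])
    show "\<forall>\<^sub>F x in regime t. 0 \<le> (case x of (n, q) \<Rightarrow> pr (nsets {1..n} 2) q (\<lambda>E. \<not> robust_cliques n s \<delta> \<kappa> q E))"
      using regime_prob by eventually_elim (auto intro!: expect_nonneg)
    show "\<forall>\<^sub>F x in regime t. (case x of (n, q) \<Rightarrow> pr (nsets {1..n} 2) q (\<lambda>E. \<not> robust_cliques n s \<delta> \<kappa> q E)) \<le>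
        (case x of (n, p) \<Rightarrow> exp (1 * real n - c / 2 * ((real n)\<^sup>2 * p)))"
      using regime_prob filterlim_regime_main[of t, unfolded filterlim_at_top, rule_format, of 1]
        filterlim_regime_n[OF t, unfolded filterlim_at_top, rule_format, of "4 / \<delta>0\<^sup>2"]
    proof eventually_elim
      case (elim x)
      obtain n q where x: "x = (n, q)" by (cases x)
      have "4 \<le> \<delta>0\<^sup>2 * real n" using elim(3) \<delta>0(1) unfolding x by (simp add: divide_le_eq mult.commute)
      then show ?case using elim(1,2) bound[of q n] unfolding x by simp
    qed
  qed (use c in simp)
  then show ?thesis using \<kappa>(1) by blast
qed

section \<open>The deterministic part of the two-round argument\<close>

context tree_plus_vertex
begin

definition ramsey_everywhere :: "nat \<Rightarrow> nat \<Rightarrow> real \<Rightarrow> nat set set \<Rightarrow> bool" where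
  "ramsey_everywhere s n \<delta> E \<longleftrightarrow> (\<forall>W\<subseteq>{1..n}. \<delta> * real n \<le> card W \<longrightarrow> (\<forall>col :: nat set \<Rightarrow> color.
     (\<exists>K\<subseteq>W. finite K \<and> card K = s \<and> nsets K 2 \<subseteq> {e \<in> E. col e = Red}) \<or>
     contains_copy \<lparr>vertices = W, edges = {e \<in> E. col e = Blue}\<rparr> G))"

text \<open>The colouring is chosen after both rounds, so the blue graph of the first round may
  depend on the second. Hence \<open>sprinkle\<close> has to hold for all
  \<open>B \<subseteq> E1\<close> at once, and this is the source of the large union bound.\<close>

lemma ramsey_everywhere_if_cliques:
  assumes reg: "upper_regular n q E1" and q: "0 \<le> q" "q \<le> 1"
    and E: "E1 \<subseteq> nsets {1..n} 2"
    and rob: "\<And>\<delta>'. \<delta>' \<in> \<Delta> \<Longrightarrow> robust_cliques n s \<delta>' (\<kappa> \<delta>') q E1"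
    and \<kappa>: "\<And>\<delta>'. \<delta>' \<in> \<Delta> \<Longrightarrow> 0 < \<kappa> \<delta>' \<and> 2 * (73 + 2 * real D) \<le> (\<kappa> \<delta>')\<^sup>2 * (real n * q\<^sup>2)"
    and dense_cliques: "\<And>(W :: nat set) r. W \<subseteq> {1..n} \<Longrightarrow> (\<forall>\<delta>'\<in>\<Delta>. pair_dense n \<delta>' ((\<kappa> \<delta>')\<^sup>2 / 64) W r) \<Longrightarrow>
      \<delta> * real n \<le> card W \<Longrightarrow> \<gamma> * real n ^ s \<le> card {xs. length xs = s \<and> set xs \<subseteq> W \<and> sorted_wrt r xs}"
    and sprinkle: "\<And>W B. W \<subseteq> {1..n} \<Longrightarrow> B \<subseteq> E1 \<Longrightarrow>
      \<gamma> * real n ^ s \<le> card {xs. length xs = s \<and> set xs \<subseteq> W \<and> sorted_wrt (closes B W) xs} \<Longrightarrow>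
      \<exists>xs. length xs = s \<and> set xs \<subseteq> W \<and> sorted_wrt (closes B W) xs \<and> nsets (set xs) 2 \<subseteq> E2"
  shows "ramsey_everywhere s n \<delta> (E1 \<union> E2)"
  unfolding ramsey_everywhere_def
proof (intro allI impI)
  fix W and col :: "nat set \<Rightarrow> color"
  assume W: "W \<subseteq> {1..n}" "\<delta> * real n \<le> card W"
  let ?red = "\<exists>K\<subseteq>W. finite K \<and> card K = s \<and> nsets K 2 \<subseteq> {e \<in> E1 \<union> E2. col e = Red}"
  let ?blue = "contains_copy \<lparr>vertices = W, edges = {e \<in> E1 \<union> E2. col e = Blue}\<rparr> G"
  show "?red \<or> ?blue"
  proof (subst disj_commute, rule disjCI)
    assume no_red: "\<not> ?red"
    \<comment> \<open>Only first-round edges inside \<open>W\<close>. A blue edge of the second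
      round enters later as the single edge that completes a copy.\<close>
    define B where "B = {e \<in> E1. e \<subseteq> W \<and> col e = Blue}"
    have BE: "B \<subseteq> E1" by (auto simp: B_def)
    have "pair_dense n \<delta>' ((\<kappa> \<delta>')\<^sup>2 / 64) W (closes B W)" if \<delta>': "\<delta>' \<in> \<Delta>" for \<delta>'
      unfolding pair_dense_def
    proof (intro allI impI)
      fix U assume U: "U \<subseteq> W" "\<delta>' * real n \<le> card U"
      have "\<kappa> \<delta>' * (real n)\<^sup>2 * q \<le> card {e \<in> B. e \<subseteq> U}"
      proof (rule ccontr)
        assume "\<not> ?thesis"
        then have "real (card {e \<in> B. e \<subseteq> U}) \<le> \<kappa> \<delta>' * ((real n)\<^sup>2 * q)" by (simp add: mult.assoc)
        moreover have "{e \<in> B. e \<subseteq> U} \<subseteq> E1" using BE by auto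
        moreover have "U \<subseteq> {1..n}" using U W by auto
        ultimately obtain K where K: "K \<subseteq> U" "finite K" "card K = s" "nsets K 2 \<subseteq> E1 - {e \<in> B. e \<subseteq> U}"
          using rob[OF \<delta>', unfolded robust_cliques_def, rule_format, of U "{e \<in> B. e \<subseteq> U}"] U(2) by metis
        have "nsets K 2 \<subseteq> {e \<in> E1 \<union> E2. col e = Red}"
        proof
          fix e assume e: "e \<in> nsets K 2"
          then have "e \<subseteq> U" "e \<in> E1" "e \<notin> B" using K by (auto simp: nsets_def)
          then have "col e \<noteq> Blue" using U by (auto simp: B_def)
          then show "e \<in> {e \<in> E1 \<union> E2. col e = Red}" using \<open>e \<in> E1\<close> by (cases "col e") auto
        qed
        then show False using no_red K U by blast
      qed
      then show "(\<kappa> \<delta>')\<^sup>2 / 64 * (real n)\<^sup>2 \<le> card {(x, y). x \<in> U \<and> y \<in> U \<and> closes B W x y}"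
        using \<kappa>[OF \<delta>'] BE E U W q by (intro many_closing_pairs[OF reg]) auto
    qed
    then have "\<gamma> * real n ^ s \<le> card {xs. length xs = s \<and> set xs \<subseteq> W \<and> sorted_wrt (closes B W) xs}"
      using W by (intro dense_cliques) auto
    then obtain xs where xs: "length xs = s" "set xs \<subseteq> W" "sorted_wrt (closes B W) xs" "nsets (set xs) 2 \<subseteq> E2"
      using sprinkle[OF W(1) BE] by blast
    have "distinct xs" using xs(3) by (rule sorted_wrt_distinct) (simp add: closes_def)
    then have "card (set xs) = s" using xs by (simp add: distinct_card)
    then have "\<not> nsets (set xs) 2 \<subseteq> {e \<in> E1 \<union> E2. col e = Red}" using no_red xs by blast
    then obtain e where e: "e \<in> nsets (set xs) 2" "col e \<noteq> Red" using xs(4) by blast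
    then have blue: "col e = Blue" by (cases "col e") auto
    obtain x y where xy: "e = {x, y}" "closes B W x y" using sorted_wrt_nsets[OF xs(3) e(1)] by blast
    then have "contains_copy \<lparr>vertices = W, edges = insert e B\<rparr> G" by (simp add: closes_def)
    then show ?blue
      by (rule contains_copy_mono) (use e xs(4) blue in \<open>auto simp: B_def\<close>)
  qed
qed

end


section \<open>The Ramsey property of all large vertex sets\<close>

lemma upper_regular_likely:
  assumes t: "t \<ge> 5"
  shows "((\<lambda>(n, p). pr (nsets {1..n} 2) p (\<lambda>E. \<not> upper_regular n p E)) \<longlongrightarrow> 0) (regime t)"
proof (rule tendsto_sandwich[OF _ _ tendsto_const])
  show "\<forall>\<^sub>F x in regime t. 0 \<le> (case x of (n, p) \<Rightarrow> pr (nsets {1..n} 2) p (\<lambda>E. \<not> upper_regular n p E))"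
    using regime_prob by eventually_elim (auto intro!: expect_nonneg)
  show "\<forall>\<^sub>F x in regime t. (case x of (n, p) \<Rightarrow> pr (nsets {1..n} 2) p (\<lambda>E. \<not> upper_regular n p E)) \<le> (1 / 2) ^ fst x"
    using regime_prob
  proof eventually_elim
    case (elim x)
    then show ?case using pr_not_upper_regular[of "snd x" "fst x"] by (simp add: case_prod_unfold)
  qed
  have "filterlim (\<lambda>x. real (fst x)) at_top (regime t)"
    using filterlim_regime_n[OF t] by (simp add: case_prod_unfold)
  then have "filterlim fst sequentially (regime t)"
    by (simp add: filterlim_sequentially_iff_filterlim_real)
  then show "((\<lambda>x. (1 / 2 :: real) ^ fst x) \<longlongrightarrow> 0) (regime t)"
    by (rule filterlim_compose[rotated]) (simp add: LIMSEQ_power_zero)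
qed

lemma edges_le_edge_count:
  assumes "E \<subseteq> nsets {1..n} 2"
  shows "card E \<le> edge_count E {1..n} {1..n}"
proof -
  have "E \<subseteq> (\<lambda>(x, y). {x, y}) ` {(a, x). a \<in> {1..n} \<and> x \<in> {1..n} \<and> {a, x} \<in> E}"
  proof
    fix e assume e: "e \<in> E"
    then obtain x y where "e = {x, y}" "x \<in> {1..n}" "y \<in> {1..n}" using assms by (blast elim: nsets2_E)
    then show "e \<in> (\<lambda>(x, y). {x, y}) ` {(a, x). a \<in> {1..n} \<and> x \<in> {1..n} \<and> {a, x} \<in> E}"
      using e by (intro image_eqI[of _ _ "(x, y)"]) auto
  qed
  then show ?thesis
    unfolding edge_count_def by (rule surj_card_le[rotated]) (rule finite_subset[of _ "{1..n} \<times> {1..n}"]; auto)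
qed

context tree_plus_vertex
begin

text \<open>The first round is fixed and only \<open>E2\<close> is random. The sets \<open>B\<close>
  range over subsets of \<open>E1\<close>, whose size is bounded through upper regularity, and each
  choice is charged against the Janson bound for \<open>s\<close>-cliques.\<close>

lemma ramsey_everywhere_second_round:
  assumes s: "s \<ge> 2" "s + 2 \<le> t" and q: "0 \<le> q" "q \<le> 1" and r: "0 \<le> r" "r \<le> 1" "1 \<le> (real n)\<^sup>2 * r ^ (t - 1)"
    and \<gamma>: "\<gamma> > 0"
    and reg: "upper_regular n q E1" and E: "E1 \<subseteq> nsets {1..n} 2"
    and rob: "\<And>\<delta>'. \<delta>' \<in> \<Delta> \<Longrightarrow> robust_cliques n s \<delta>' (\<kappa> \<delta>') q E1"
    and \<kappa>: "\<And>\<delta>'. \<delta>' \<in> \<Delta> \<Longrightarrow> 0 < \<kappa> \<delta>' \<and> 2 * (73 + 2 * real D) \<le> (\<kappa> \<delta>')\<^sup>2 * (real n * q\<^sup>2)"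
    and dense_cliques: "\<And>(W :: nat set) r. W \<subseteq> {1..n} \<Longrightarrow> (\<forall>\<delta>'\<in>\<Delta>. pair_dense n \<delta>' ((\<kappa> \<delta>')\<^sup>2 / 64) W r) \<Longrightarrow>
      \<delta> * real n \<le> card W \<Longrightarrow> \<gamma> * real n ^ s \<le> card {xs. length xs = s \<and> set xs \<subseteq> W \<and> sorted_wrt r xs}"
  shows "pr (nsets {1..n} 2) r (\<lambda>E2. \<not> ramsey_everywhere s n \<delta> (E1 \<union> E2))
    \<le> exp (9 * real n + 4 * q * (real n)\<^sup>2 - \<gamma> / (2 * (2 * s) ^ s) * ((real n)\<^sup>2 * r))"
proof -
  let ?P = "nsets {1..n} 2"
  have r0: "r > 0" using r s by (cases "r = 0") (auto simp: power_0_left)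
  have n0: "n > 0" using r(3) by (auto intro!: Nat.gr0I)
  define L where "L = (\<lambda>W B. {xs. length xs = s \<and> set xs \<subseteq> W \<and> sorted_wrt (closes B W) xs})"
  \<comment> \<open>Having many cliques of closing pairs is part of the event. Where it fails the
    event is empty and costs nothing; where it holds Janson's inequality applies.\<close>
  define bad where "bad = (\<lambda>W B E2. \<gamma> * real n ^ s \<le> card (L W B) \<and> (\<forall>xs\<in>L W B. \<not> nsets (set xs) 2 \<subseteq> E2))"
  let ?I = "Pow {1..n} \<times> Pow E1"
  have fE: "finite E1" by (rule finite_subset[OF E finite_pairs])
  have "pr ?P r (\<lambda>E2. \<not> ramsey_everywhere s n \<delta> (E1 \<union> E2)) \<le> (\<Sum>i\<in>?I. pr ?P r (bad (fst i) (snd i)))"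
  proof (rule pr_union_bound[OF r(1,2)])
    fix E2 assume not: "\<not> ramsey_everywhere s n \<delta> (E1 \<union> E2)"
    have "\<exists>W B. W \<subseteq> {1..n} \<and> B \<subseteq> E1 \<and> bad W B E2"
    proof (rule ccontr)
      assume none: "\<not> (\<exists>W B. W \<subseteq> {1..n} \<and> B \<subseteq> E1 \<and> bad W B E2)"
      have "ramsey_everywhere s n \<delta> (E1 \<union> E2)"
      proof (rule ramsey_everywhere_if_cliques[OF reg q E, where \<Delta> = \<Delta> and \<kappa> = \<kappa> and \<gamma> = \<gamma>])
        fix W B assume WB: "W \<subseteq> {1..n}" "B \<subseteq> E1"
          "\<gamma> * real n ^ s \<le> card {xs. length xs = s \<and> set xs \<subseteq> W \<and> sorted_wrt (closes B W) xs}"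
        then have "\<not> bad W B E2" using none by blast
        then show "\<exists>xs. length xs = s \<and> set xs \<subseteq> W \<and> sorted_wrt (closes B W) xs \<and> nsets (set xs) 2 \<subseteq> E2"
          using WB(3) unfolding bad_def L_def by blast
      qed (fact rob \<kappa> dense_cliques)+
      then show False using not by contradiction
    qed
    then obtain W B where "W \<subseteq> {1..n}" "B \<subseteq> E1" "bad W B E2" by blast
    then show "\<exists>i\<in>?I. bad (fst i) (snd i) E2" by (intro bexI[of _ "(W, B)"]) auto
  qed (use fE in simp)
  also have "\<dots> \<le> (\<Sum>i\<in>?I. exp (- \<gamma> * ((real n)\<^sup>2 * r) / (2 * (2 * s) ^ s)))"
  proof (rule sum_mono)
    fix i assume i: "i \<in> ?I"
    obtain W B where iWB: "i = (W, B)" by (cases i)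
    then have W: "W \<subseteq> {1..n}" using i by simp
    show "pr ?P r (bad (fst i) (snd i)) \<le> exp (- \<gamma> * ((real n)\<^sup>2 * r) / (2 * (2 * s) ^ s))"
    proof (cases "\<gamma> * real n ^ s \<le> card (L W B)")
      case True
      then have "pr ?P r (bad (fst i) (snd i)) = pr ?P r (\<lambda>E2. \<forall>xs\<in>L W B. \<not> nsets (set xs) 2 \<subseteq> E2)"
        by (simp add: bad_def iWB)
      also have "\<dots> \<le> exp (- \<gamma> * ((real n)\<^sup>2 * r) / (2 * (2 * s) ^ s))"
      proof (rule janson_cliques[OF s(1) finite_pairs r0 r(2) _ \<gamma> True])
        fix xs assume xs: "xs \<in> L W B"
        then have "distinct xs" by (intro sorted_wrt_distinct[of "closes B W"]) (auto simp: L_def closes_def)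
        moreover have "set xs \<subseteq> {1..n}" using xs W by (auto simp: L_def)
        ultimately show "length xs = s \<and> distinct xs \<and> set xs \<subseteq> {1..n} \<and> nsets (set xs) 2 \<subseteq> ?P"
          using xs nsets_mono[of "set xs" "{1..n}" 2] by (simp add: L_def)
      next
        show "(real n)\<^sup>2 * r \<le> real n ^ j * r ^ (j choose 2)" if "2 \<le> j" "j \<le> s" for j
          using that s by (intro clique_rate_pairs[OF r0 r(2,3)]) auto
      qed (use n0 r0 in simp)
      finally show ?thesis .
    next
      case False
      then have "pr ?P r (bad (fst i) (snd i)) = expect ?P r (\<lambda>_. 0)" by (simp add: bad_def iWB)
      also have "\<dots> = 0" by (rule expect_const[OF finite_pairs])
      finally show ?thesis by simp
    qed
  qed
  also have "\<dots> = real (card ?I) * exp (- \<gamma> * ((real n)\<^sup>2 * r) / (2 * (2 * s) ^ s))" by simp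
  \<comment> \<open>There are 2^n vertex sets and 2^|E1| edge sets, with |E1| at most 4 q n^2 + 8n;
    base 2 is replaced by base e.\<close>
  also have "real (card ?I) \<le> exp (9 * real n + 4 * q * (real n)\<^sup>2)"
  proof -
    have "real (card E1) \<le> real (edge_count E1 {1..n} {1..n})"
      using edges_le_edge_count[OF E] by (simp only: of_nat_le_iff)
    also have "\<dots> \<le> 4 * q * card {1..n} * card {1..n} + 8 * n"
      using reg unfolding upper_regular_def by blast
    finally have cE: "real (card E1) \<le> 4 * q * (real n)\<^sup>2 + 8 * n" by (simp add: power2_eq_square mult.assoc)
    have "real (card ?I) = 2 ^ n * 2 ^ card E1"
      using fE by (simp add: card_cartesian_product card_Pow)
    also have "\<dots> \<le> exp (real n) * exp (real (card E1))"
      by (intro mult_mono two_power_le_exp) auto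
    also have "\<dots> \<le> exp (9 * real n + 4 * q * (real n)\<^sup>2)"
      using cE by (simp add: exp_add[symmetric])
    finally show ?thesis .
  qed
  also have "exp (9 * real n + 4 * q * (real n)\<^sup>2) * exp (- \<gamma> * ((real n)\<^sup>2 * r) / (2 * (2 * s) ^ s)) =
      exp (9 * real n + 4 * q * (real n)\<^sup>2 - \<gamma> / (2 * (2 * s) ^ s) * ((real n)\<^sup>2 * r))"
    by (simp add: exp_add[symmetric])
  finally show ?thesis by simp
qed

text \<open>The order of choices avoids a circle. First \<kappa> is fixed for every threshold,
  independently of q; it determines \<gamma>, \<Delta> and the exponent c of the second round; only
  then is \<eta> chosen in terms of c. With q = \<eta> p and r \<ge> p/2, the union bound costs at
  most c/4 and Janson's inequality gains at least c/2, in units of n^2 p.\<close>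

lemma ramsey_everywhere_likely:
  assumes t: "t \<ge> 5" and \<delta>: "\<delta> > 0"
  shows "((\<lambda>(n, p). pr (nsets {1..n} 2) p (\<lambda>E. \<not> ramsey_everywhere (t - 2) n \<delta> E)) \<longlongrightarrow> 0) (regime t)"
proof -
  define s where "s = t - 2"
  have s: "s \<ge> 2" "s + 2 \<le> t" using t by (auto simp: s_def)
  let ?lim = "\<lambda>\<delta>' k. ((\<lambda>(n, q). pr (nsets {1..n} 2) q (\<lambda>E. \<not> robust_cliques n s \<delta>' k q E)) \<longlongrightarrow> 0) (regime t)"
  \<comment> \<open>The guard is inside the existential so that \<open>choice\<close> gives a
    function of all \<delta>'. It is needed as the density function of
    \<open>multilevel_cliques\<close> before \<Delta> is known.\<close>
  have "\<forall>\<delta>'. \<exists>k. 0 < \<delta>' \<longrightarrow> 0 < k \<and> ?lim \<delta>' k"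
    using robust_cliques_likely[OF t s] by blast
  then have "\<exists>\<kappa>. \<forall>\<delta>'. 0 < \<delta>' \<longrightarrow> 0 < \<kappa> \<delta>' \<and> ?lim \<delta>' (\<kappa> \<delta>')" by (rule choice)
  then obtain \<kappa> where \<kappa>: "\<And>\<delta>'. 0 < \<delta>' \<Longrightarrow> 0 < \<kappa> \<delta>'" and \<kappa>_lim: "\<And>\<delta>'. 0 < \<delta>' \<Longrightarrow> ?lim \<delta>' (\<kappa> \<delta>')"
    by blast
  have g_pos: "0 < (\<kappa> \<delta>')\<^sup>2 / 64" if "0 < \<delta>'" for \<delta>' using \<kappa>[OF that] by simp
  obtain \<gamma> \<Delta> where \<gamma>: "\<gamma> > 0" "finite \<Delta>" "\<forall>\<delta>'\<in>\<Delta>. 0 < \<delta>'"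
    and cliques: "\<forall>n (W :: nat set) r. W \<subseteq> {1..n} \<longrightarrow> (\<forall>\<delta>'\<in>\<Delta>. pair_dense n \<delta>' ((\<kappa> \<delta>')\<^sup>2 / 64) W r) \<longrightarrow>
      (\<forall>U\<subseteq>W. \<delta> * real n \<le> card U \<longrightarrow> \<gamma> * real n ^ s \<le> card {xs. length xs = s \<and> set xs \<subseteq> U \<and> sorted_wrt r xs})"
    by (rule multilevel_cliques[of "\<lambda>\<delta>'. (\<kappa> \<delta>')\<^sup>2 / 64" \<delta> s, OF g_pos \<delta>, THEN exE], assumption, elim exE conjE) (rule that)
  have cliques': "\<gamma> * real n ^ s \<le> card {xs. length xs = s \<and> set xs \<subseteq> W \<and> sorted_wrt r xs}"
    if "W \<subseteq> {1..n}" "\<forall>\<delta>'\<in>\<Delta>. pair_dense n \<delta>' ((\<kappa> \<delta>')\<^sup>2 / 64) W r" "\<delta> * real n \<le> card W" for n W r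
    using cliques[rule_format, OF that(1) _ subset_refl that(3)] that(2) by blast
  define c where "c = \<gamma> / (2 * (2 * s) ^ s)"
  have c: "c > 0" using \<gamma> s by (simp add: c_def)
  \<comment> \<open>At most 1/2, so that the second round keeps at least half of p; at most c/16, so
    that the term 4 q n^2 is at most c/4 times n^2 p.\<close>
  define \<eta> where "\<eta> = min (1 / 2) (c / 16)"
  have \<eta>: "0 < \<eta>" "\<eta> \<le> 1 / 2" "4 * \<eta> \<le> c / 4" using c by (auto simp: \<eta>_def)
  define err where "err = (\<lambda>(n, q). pr (nsets {1..n} 2) q (\<lambda>E. \<not> upper_regular n q E) +
     (\<Sum>\<delta>'\<in>\<Delta>. pr (nsets {1..n} 2) q (\<lambda>E. \<not> robust_cliques n s \<delta>' (\<kappa> \<delta>') q E)))"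
  have err: "(err \<longlongrightarrow> 0) (regime t)"
  proof -
    have "((\<lambda>x. \<Sum>\<delta>'\<in>\<Delta>. case x of (n, q) \<Rightarrow> pr (nsets {1..n} 2) q (\<lambda>E. \<not> robust_cliques n s \<delta>' (\<kappa> \<delta>') q E)) \<longlongrightarrow> (\<Sum>\<delta>'\<in>\<Delta>. 0)) (regime t)"
      using \<gamma>(3) by (intro tendsto_sum \<kappa>_lim) auto
    from tendsto_add[OF upper_regular_likely[OF t] this] show ?thesis
      by (simp add: err_def case_prod_unfold)
  qed
  have bound: "pr (nsets {1..n} 2) p (\<lambda>E. \<not> ramsey_everywhere s n \<delta> E) \<le>
      err (n, \<eta> * p) + exp (9 * real n - c / 4 * ((real n)\<^sup>2 * p))"
    if p: "0 \<le> p" "p \<le> 1" and X: "1 \<le> (real n)\<^sup>2 * (1 / 2 * p) ^ (t - 1)"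
      and big: "\<And>\<delta>'. \<delta>' \<in> \<Delta> \<Longrightarrow> 2 * (73 + 2 * real D) / (\<kappa> \<delta>')\<^sup>2 \<le> real n * (\<eta> * p)\<^sup>2" for n p
  proof -
    let ?P = "nsets {1..n} 2"
    let ?e = "exp (9 * real n - c / 4 * ((real n)\<^sup>2 * p))"
    \<comment> \<open>The value of \<open>r\<close> solves q + r - q r = p, as
      \<open>expect_two_rounds\<close> requires.\<close>
    define q r where "q = \<eta> * p" and "r = (p - q) / (1 - q)"
    have q: "0 \<le> q" "q \<le> 1 / 2" "q \<le> p / 2" using \<eta> p mult_mono[of \<eta> "1 / 2" p 1] mult_right_mono[of \<eta> "1 / 2" p] by (auto simp: q_def)
    have r: "0 \<le> r" "r \<le> 1" using q p by (auto simp: r_def)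
    have "(1 - q) * r = p - q" using q by (simp add: r_def)
    then have pr_eq: "q + r - q * r = p" by (simp add: algebra_simps)
    have rp: "1 / 2 * p \<le> r"
    proof -
      have "p / 2 \<le> p - q" using q by simp
      also have "\<dots> \<le> r" using q p unfolding r_def by (simp add: le_divide_eq mult_left_le)
      finally show ?thesis by simp
    qed
    have Xr: "1 \<le> (real n)\<^sup>2 * r ^ (t - 1)"
      using X rp p by (elim order_trans) (intro mult_left_mono power_mono, auto)
    define good where "good = (\<lambda>E1. upper_regular n q E1 \<and> (\<forall>\<delta>'\<in>\<Delta>. robust_cliques n s \<delta>' (\<kappa> \<delta>') q E1))"
    have "pr ?P p (\<lambda>E. \<not> ramsey_everywhere s n \<delta> E) =
        expect ?P q (\<lambda>E1. pr ?P r (\<lambda>E2. \<not> ramsey_everywhere s n \<delta> (E1 \<union> E2)))"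
      by (subst expect_two_rounds[OF finite_pairs]) (simp add: pr_eq)
    also have "\<dots> \<le> expect ?P q (\<lambda>E1. of_bool (\<not> good E1) + ?e)"
    proof (rule expect_mono)
      fix E1 assume E1: "E1 \<subseteq> ?P"
      show "pr ?P r (\<lambda>E2. \<not> ramsey_everywhere s n \<delta> (E1 \<union> E2)) \<le> of_bool (\<not> good E1) + ?e"
      proof (cases "good E1")
        case True
        have big': "0 < \<kappa> \<delta>' \<and> 2 * (73 + 2 * real D) \<le> (\<kappa> \<delta>')\<^sup>2 * (real n * q\<^sup>2)" if "\<delta>' \<in> \<Delta>" for \<delta>'
        proof -
          have "0 < \<kappa> \<delta>'" using \<kappa> \<gamma>(3) that by blast
          then show ?thesis using big[OF that] by (simp add: q_def divide_le_eq mult.commute)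
        qed
        have "pr ?P r (\<lambda>E2. \<not> ramsey_everywhere s n \<delta> (E1 \<union> E2)) \<le>
            exp (9 * real n + 4 * q * (real n)\<^sup>2 - \<gamma> / (2 * (2 * s) ^ s) * ((real n)\<^sup>2 * r))"
          using True q big' cliques' unfolding good_def
          by (intro ramsey_everywhere_second_round[OF s _ _ r Xr \<gamma>(1) _ E1, where \<Delta> = \<Delta> and \<kappa> = \<kappa>]) auto
        also have "\<dots> \<le> ?e"
        proof -
          have "4 * q * (real n)\<^sup>2 \<le> c / 4 * ((real n)\<^sup>2 * p)"
            using mult_right_mono[OF \<eta>(3), of "p * (real n)\<^sup>2"] p by (simp add: q_def mult_ac)
          moreover have "c * ((real n)\<^sup>2 * (1 / 2 * p)) \<le> c * ((real n)\<^sup>2 * r)"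
            using c rp by (intro mult_left_mono) auto
          ultimately show ?thesis unfolding c_def[symmetric] by simp
        qed
        finally show ?thesis using True by simp
      next
        case False
        have "pr ?P r (\<lambda>E2. \<not> ramsey_everywhere s n \<delta> (E1 \<union> E2)) \<le> expect ?P r (\<lambda>_. 1)"
          by (rule expect_mono[OF r]) (simp add: of_bool_def)
        also have "\<dots> = 1" by (rule expect_const[OF finite_pairs])
        finally show ?thesis using False by (simp add: add_increasing2)
      qed
    qed (use q in auto)
    also have "\<dots> = pr ?P q (\<lambda>E1. \<not> good E1) + ?e"
      unfolding expect_add expect_const[OF finite_pairs] ..
    also have "pr ?P q (\<lambda>E1. \<not> good E1) \<le> pr ?P q (\<lambda>E. \<not> upper_regular n q E) +
        pr ?P q (\<lambda>E. \<exists>\<delta>'\<in>\<Delta>. \<not> robust_cliques n s \<delta>' (\<kappa> \<delta>') q E)"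
      by (rule pr_disj_le) (use q in \<open>auto simp: good_def\<close>)
    also have "pr ?P q (\<lambda>E. \<exists>\<delta>'\<in>\<Delta>. \<not> robust_cliques n s \<delta>' (\<kappa> \<delta>') q E) \<le>
        (\<Sum>\<delta>'\<in>\<Delta>. pr ?P q (\<lambda>E. \<not> robust_cliques n s \<delta>' (\<kappa> \<delta>') q E))"
      by (rule pr_union_bound) (use q \<gamma> in auto)
    finally show ?thesis by (simp add: err_def q_def)
  qed
  have lim: "((\<lambda>(n, p). err (n, \<eta> * p) + exp (9 * real n - c / 4 * ((real n)\<^sup>2 * p))) \<longlongrightarrow> 0) (regime t)"
  proof -
    have "((\<lambda>x. err (case x of (n, p) \<Rightarrow> (n, \<eta> * p))) \<longlongrightarrow> 0) (regime t)"
      using \<eta> by (intro filterlim_compose[OF err filterlim_regime_scale]) auto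
    from tendsto_add[OF this tendsto_regime_exp[OF t, of "c / 4" 9]] c show ?thesis
      by (simp add: case_prod_unfold)
  qed
  show ?thesis
    unfolding s_def[symmetric]
  proof (rule tendsto_sandwich[OF _ _ tendsto_const lim])
    show "\<forall>\<^sub>F x in regime t. 0 \<le> (case x of (n, p) \<Rightarrow> pr (nsets {1..n} 2) p (\<lambda>E. \<not> ramsey_everywhere s n \<delta> E))"
      using regime_prob by eventually_elim (auto intro!: expect_nonneg)
    have ev1: "\<forall>\<^sub>F x in regime t. 1 \<le> (case x of (n, p) \<Rightarrow> (real n)\<^sup>2 * (1 / 2 * p) ^ (t - 1))"
      using filterlim_compose[OF filterlim_regime_main filterlim_regime_scale[of "1 / 2" t]]
      unfolding filterlim_at_top by (simp add: case_prod_unfold)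
    have ev2: "\<forall>\<^sub>F x in regime t. \<forall>\<delta>'\<in>\<Delta>. 2 * (73 + 2 * real D) / (\<kappa> \<delta>')\<^sup>2 \<le> (case x of (n, p) \<Rightarrow> real n * (\<eta> * p)\<^sup>2)"
    proof (rule eventually_ball_finite[OF \<gamma>(2)], rule ballI)
      fix \<delta>'
      show "\<forall>\<^sub>F x in regime t. 2 * (73 + 2 * real D) / (\<kappa> \<delta>')\<^sup>2 \<le> (case x of (n, p) \<Rightarrow> real n * (\<eta> * p)\<^sup>2)"
        using filterlim_compose[OF filterlim_regime_np2[OF t] filterlim_regime_scale[of \<eta> t]] \<eta>
        unfolding filterlim_at_top by (simp add: case_prod_unfold)
    qed
    show "\<forall>\<^sub>F x in regime t. (case x of (n, p) \<Rightarrow> pr (nsets {1..n} 2) p (\<lambda>E. \<not> ramsey_everywhere s n \<delta> E)) \<le>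
        (case x of (n, p) \<Rightarrow> err (n, \<eta> * p) + exp (9 * real n - c / 4 * ((real n)\<^sup>2 * p)))"
      using regime_prob ev1 ev2
    proof eventually_elim
      case (elim x)
      obtain n p where x: "x = (n, p)" by (cases x)
      show ?case using elim bound[of p n] unfolding x by auto
    qed
  qed
qed

end

section \<open>Cliques on t - 1 vertices in every large set\<close>

definition cliques_everywhere :: "nat \<Rightarrow> nat \<Rightarrow> real \<Rightarrow> nat set set \<Rightarrow> bool" where
  "cliques_everywhere s n \<delta> E \<longleftrightarrow> (\<forall>W\<subseteq>{1..n}. \<delta> * real n \<le> card W \<longrightarrow>
     (\<exists>K\<subseteq>W. finite K \<and> card K = s \<and> nsets K 2 \<subseteq> E))"

text \<open>With j = i + 2, the square of n^(i+1) p^(j choose 2) is (n^2 p^j)^(i+1), which is at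
  least n^2 p^(t-1) since j \<le> t - 1. The remaining factor n pays for the choice of a vertex
  set.\<close>

lemma clique_rate_vertices:
  assumes p: "0 < p" "p \<le> 1" and X: "1 \<le> (real n)\<^sup>2 * p ^ (t - 1)" and j: "2 \<le> j" "j + 1 \<le> t"
  shows "real n * sqrt ((real n)\<^sup>2 * p ^ (t - 1)) \<le> real n ^ j * p ^ (j choose 2)"
proof -
  let ?X = "(real n)\<^sup>2 * p ^ (t - 1)"
  obtain i where i: "j = i + 2" using j by (metis add.commute le_Suc_ex)
  have c2: "2 * (j choose 2) = j * (i + 1)"
    using choose_two[of j] i by (simp add: algebra_simps)
  have "p ^ (t - 1) \<le> p ^ j" using p i j by (intro power_decreasing) auto
  then have "?X \<le> (real n)\<^sup>2 * p ^ j" by (rule mult_left_mono) simp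
  then have "?X ^ (i + 1) \<le> ((real n)\<^sup>2 * p ^ j) ^ (i + 1)"
    using p by (intro power_mono) auto
  moreover have "?X ^ 1 \<le> ?X ^ (i + 1)" using X by (intro power_increasing) auto
  ultimately have "?X \<le> ((real n)\<^sup>2 * p ^ j) ^ (i + 1)" by simp
  also have "\<dots> = (real n ^ (i + 1) * p ^ (j choose 2))\<^sup>2"
    using c2 by (simp add: power_mult_distrib power_mult[symmetric] mult.commute del: power_Suc)
  finally have "sqrt ?X \<le> real n ^ (i + 1) * p ^ (j choose 2)"
    using p by (intro real_le_lsqrt) auto
  then have "real n * sqrt ?X \<le> real n * (real n ^ (i + 1) * p ^ (j choose 2))" by (intro mult_left_mono) auto
  then show ?thesis by (simp add: i mult_ac)
qed

text \<open>No edges are deleted here, so the union bound has only 2^n terms. An exponent of 2n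
  suffices against them, and the rate n sqrt(n^2 p^(t-1)) eventually provides it.\<close>

lemma cliques_everywhere_likely:
  assumes t: "t \<ge> 5" and \<delta>: "\<delta> > 0"
  shows "((\<lambda>(n, p). pr (nsets {1..n} 2) p (\<lambda>E. \<not> cliques_everywhere (t - 1) n \<delta> E)) \<longlongrightarrow> 0) (regime t)"
proof -
  define s where "s = t - 1"
  have s: "s \<ge> 2" "s + 1 \<le> t" using t by (auto simp: s_def)
  obtain \<gamma> \<Delta> where \<gamma>: "\<gamma> > 0" "finite \<Delta>" "\<forall>\<delta>'\<in>\<Delta>. 0 < \<delta>'"
    and cliques: "\<forall>n (W :: nat set) r. W \<subseteq> {1..n} \<longrightarrow> (\<forall>\<delta>'\<in>\<Delta>. pair_dense n \<delta>' (\<delta>'\<^sup>2 / 2) W r) \<longrightarrow>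
      (\<forall>U\<subseteq>W. \<delta> * real n \<le> card U \<longrightarrow> \<gamma> * real n ^ s \<le> card {xs. length xs = s \<and> set xs \<subseteq> U \<and> sorted_wrt r xs})"
    by (rule multilevel_cliques[of "\<lambda>\<delta>'. \<delta>'\<^sup>2 / 2" \<delta> s, THEN exE], simp, rule \<delta>, elim exE conjE) (rule that)
  define c where "c = \<gamma> / (2 * (2 * s) ^ s)"
  have c: "c > 0" using \<gamma> s by (simp add: c_def)
  define \<delta>0 where "\<delta>0 = Min (insert 1 \<Delta>)"
  have \<delta>0: "\<delta>0 > 0" "\<And>\<delta>'. \<delta>' \<in> \<Delta> \<Longrightarrow> \<delta>0 \<le> \<delta>'" using \<gamma> by (auto simp: \<delta>0_def)
  have bound: "pr (nsets {1..n} 2) p (\<lambda>E. \<not> cliques_everywhere s n \<delta> E) \<le> exp (- real n)"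
    if p: "0 \<le> p" "p \<le> 1" and X: "1 \<le> (real n)\<^sup>2 * p ^ (t - 1)" and X2: "2 / c \<le> sqrt ((real n)\<^sup>2 * p ^ (t - 1))"
      and n: "4 \<le> \<delta>0\<^sup>2 * real n" for n p
  proof -
    let ?P = "nsets {1..n} 2" and ?X = "(real n)\<^sup>2 * p ^ (t - 1)"
    have n0: "n > 0" using n by (auto intro!: Nat.gr0I)
    have p0: "p > 0" using X t p by (cases "p = 0") (auto simp: power_0_left)
    have dense: "pair_dense n \<delta>' (\<delta>'\<^sup>2 / 2) {1..n} (\<noteq>)" if \<delta>': "\<delta>' \<in> \<Delta>" for \<delta>'
    proof -
      have "\<delta>0\<^sup>2 \<le> \<delta>'\<^sup>2" using \<delta>0 \<delta>' by (intro power_mono) auto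
      then have "4 \<le> \<delta>'\<^sup>2 * real n" using n mult_right_mono[of "\<delta>0\<^sup>2" "\<delta>'\<^sup>2" "real n"] by linarith
      then show ?thesis using pair_dense_avoiding[of \<delta>' "{}" n] \<gamma>(3) \<delta>' by simp
    qed
    define \<U> where "\<U> = {U. U \<subseteq> {1..n} \<and> \<delta> * real n \<le> card U}"
    have f\<U>: "finite \<U>"
      by (rule finite_subset[of _ "Pow {1..n}"]) (auto simp: \<U>_def)
    define L where "L = (\<lambda>U :: nat set. {xs. length xs = s \<and> set xs \<subseteq> U \<and> sorted_wrt (\<noteq>) xs})"
    have L_dist: "distinct xs" "card (set xs) = s" if "xs \<in> L U" for xs U
    proof -
      show "distinct xs" using that by (intro sorted_wrt_distinct[of "(\<noteq>)"]) (auto simp: L_def)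
      then show "card (set xs) = s" using that by (simp add: distinct_card L_def)
    qed
    have "pr ?P p (\<lambda>E. \<not> cliques_everywhere s n \<delta> E) \<le> (\<Sum>U\<in>\<U>. pr ?P p (\<lambda>E. \<forall>xs\<in>L U. \<not> nsets (set xs) 2 \<subseteq> E))"
    proof (rule pr_union_bound[OF p f\<U>])
      fix E assume "\<not> cliques_everywhere s n \<delta> E"
      then obtain W where W: "W \<subseteq> {1..n}" "\<delta> * real n \<le> card W"
        "\<And>K. K \<subseteq> W \<Longrightarrow> finite K \<Longrightarrow> card K = s \<Longrightarrow> \<not> nsets K 2 \<subseteq> E"
        unfolding cliques_everywhere_def by blast
      have "\<not> nsets (set xs) 2 \<subseteq> E" if "xs \<in> L W" for xs
        using that L_dist[OF that] by (intro W(3)) (auto simp: L_def)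
      then show "\<exists>U\<in>\<U>. \<forall>xs\<in>L U. \<not> nsets (set xs) 2 \<subseteq> E" using W(1,2) by (auto simp: \<U>_def)
    qed
    also have "\<dots> \<le> (\<Sum>U\<in>\<U>. exp (- \<gamma> * (real n * sqrt ?X) / (2 * (2 * s) ^ s)))"
    proof (rule sum_mono)
      fix U assume U: "U \<in> \<U>"
      have cL: "\<gamma> * real n ^ s \<le> card (L U)"
        unfolding L_def using cliques dense U by (auto simp: \<U>_def)
      show "pr ?P p (\<lambda>E. \<forall>xs\<in>L U. \<not> nsets (set xs) 2 \<subseteq> E) \<le> exp (- \<gamma> * (real n * sqrt ?X) / (2 * (2 * s) ^ s))"
      proof (rule janson_cliques[OF s(1) finite_pairs p0 p(2) _ \<gamma>(1) cL])
        fix xs assume xs: "xs \<in> L U"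
        then have sub: "set xs \<subseteq> {1..n}" using U by (auto simp: L_def \<U>_def)
        show "length xs = s \<and> distinct xs \<and> set xs \<subseteq> {1..n} \<and> nsets (set xs) 2 \<subseteq> ?P"
          using xs L_dist[OF xs] sub nsets_mono[OF sub] by (simp add: L_def)
      next
        show "real n * sqrt ?X \<le> real n ^ j * p ^ (j choose 2)" if "2 \<le> j" "j \<le> s" for j
          using that s by (intro clique_rate_vertices[OF p0 p(2) X]) auto
      qed (use n0 p0 in simp)
    qed
    also have "\<dots> = real (card \<U>) * exp (- (real n * (c * sqrt ?X)))"
      by (simp add: c_def)
    also have "\<dots> \<le> exp (real n) * exp (- (real n * 2))"
    proof (rule mult_mono)
      have "card \<U> \<le> card (Pow {1..n})" by (intro card_mono) (auto simp: \<U>_def)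
      then have "card \<U> \<le> 2 ^ n" by (simp add: card_Pow)
      then have "real (card \<U>) \<le> real (2 ^ n)" by (simp only: of_nat_le_iff)
      then show "real (card \<U>) \<le> exp (real n)"
        unfolding of_nat_power of_nat_numeral using two_power_le_exp by (rule order_trans)
      have "2 \<le> c * sqrt ?X" using X2 c by (simp add: divide_le_eq mult.commute)
      then have "real n * 2 \<le> real n * (c * sqrt ?X)" by (intro mult_left_mono) auto
      then show "exp (- (real n * (c * sqrt ?X))) \<le> exp (- (real n * 2))" by simp
    qed auto
    also have "\<dots> = exp (- real n)" by (simp add: exp_add[symmetric])
    finally show ?thesis .
  qed
  show ?thesis
    unfolding s_def[symmetric]
  proof (rule tendsto_sandwich[OF _ _ tendsto_const])
    show "\<forall>\<^sub>F x in regime t. 0 \<le> (case x of (n, p) \<Rightarrow> pr (nsets {1..n} 2) p (\<lambda>E. \<not> cliques_everywhere s n \<delta> E))"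
      using regime_prob by eventually_elim (auto intro!: expect_nonneg)
    show "\<forall>\<^sub>F x in regime t. (case x of (n, p) \<Rightarrow> pr (nsets {1..n} 2) p (\<lambda>E. \<not> cliques_everywhere s n \<delta> E)) \<le> exp (- (case x of (n, p) \<Rightarrow> real n))"
      using regime_prob filterlim_regime_main[of t, unfolded filterlim_at_top, rule_format, of 1]
        filterlim_regime_sqrt[of t, unfolded filterlim_at_top, rule_format, of "2 / c"]
        filterlim_regime_n[OF t, unfolded filterlim_at_top, rule_format, of "4 / \<delta>0\<^sup>2"]
    proof eventually_elim
      case (elim x)
      obtain n p where x: "x = (n, p)" by (cases x)
      have "4 \<le> \<delta>0\<^sup>2 * real n" using elim(4) \<delta>0(1) unfolding x by (simp add: divide_le_eq mult.commute)
      then show ?case using elim(1,2,3) bound[of p n] unfolding x by simp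
    qed
    have "filterlim (\<lambda>x. - (case x of (n, p) \<Rightarrow> real n)) at_bot (regime t)"
      using filterlim_regime_n[OF t] by (simp add: filterlim_uminus_at_bot)
    from filterlim_compose[OF exp_at_bot this]
    show "((\<lambda>x. exp (- (case x of (n, p) \<Rightarrow> real n))) \<longlongrightarrow> 0) (regime t)" .
  qed
qed


section \<open>Sparse patterns with a large common neighbourhood\<close>

lemma two_times_choose_two: "2 * (k choose 2) = k * (k - 1)"
proof -
  have "even (k * (k - 1))" by (cases k) auto
  then show ?thesis unfolding choose_two by (rule dvd_mult_div_cancel)
qed

text \<open>Every set of vertices spans average degree at most \<open>m\<close>. For m = t - 1 the
  extreme case is K_t, so this says that the graph appears as soon as K_t does.\<close>

definition sparse :: "nat \<Rightarrow> 'b set \<Rightarrow> 'b set set \<Rightarrow> bool" where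
  "sparse m V E \<longleftrightarrow> finite V \<and> E \<subseteq> nsets V 2 \<and> (\<forall>J\<subseteq>V. 2 * card {e \<in> E. e \<subseteq> J} \<le> m * card J)"

lemma sparse_complete: "sparse (t - 1) {1..t :: nat} (nsets {1..t} 2)"
  unfolding sparse_def
proof (intro conjI allI impI)
  fix J :: "nat set" assume J: "J \<subseteq> {1..t}"
  then have fJ: "finite J" using finite_subset by blast
  have cJ: "card J \<le> t" using card_mono[OF _ J] by simp
  have sub: "{e \<in> nsets {1..t} 2. e \<subseteq> J} \<subseteq> {e. e \<subseteq> J \<and> card e = 2}" by (auto simp: nsets_def)
  have "finite {e. e \<subseteq> J \<and> card e = 2}" by (rule finite_subset[of _ "Pow J"]) (use fJ in auto)
  then have "card {e \<in> nsets {1..t} 2. e \<subseteq> J} \<le> card J choose 2"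
    using card_mono[OF _ sub] n_subsets[OF fJ, of 2] by simp
  then have "2 * card {e \<in> nsets {1..t} 2. e \<subseteq> J} \<le> 2 * (card J choose 2)" by simp
  also have "\<dots> = card J * (card J - 1)"
    by (rule two_times_choose_two)
  also have "\<dots> \<le> (t - 1) * card J" using cJ by (subst mult.commute) (intro mult_le_mono1 diff_le_mono)
  finally show "2 * card {e \<in> nsets {1..t} 2. e \<subseteq> J} \<le> (t - 1) * card J" .
qed auto

lemma sparse_image:
  assumes "sparse m V E" "inj_on f V"
  shows "sparse m (f ` V) ((`) f ` E)"
  unfolding sparse_def
proof (intro conjI allI impI)
  show "finite (f ` V)" using assms by (simp add: sparse_def)
  have eV: "e \<subseteq> V" if "e \<in> E" for e using that assms(1) by (auto simp: sparse_def nsets_def)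
  show "(`) f ` E \<subseteq> nsets (f ` V) 2"
  proof
    fix e' assume "e' \<in> (`) f ` E"
    then obtain e where e: "e \<in> E" "e' = f ` e" by blast
    then have "e \<in> nsets V 2" using assms(1) by (auto simp: sparse_def)
    then show "e' \<in> nsets (f ` V) 2"
      using e inj_on_subset[OF assms(2) eV[OF e(1)]] by (auto simp: nsets_def card_image)
  qed
  fix J assume J: "J \<subseteq> f ` V"
  define I where "I = {x \<in> V. f x \<in> J}"
  have fI: "finite I" using assms(1) by (simp add: I_def sparse_def)
  have JI: "J = f ` I" using J by (auto simp: I_def)
  have inj: "inj_on f I" using inj_on_subset[OF assms(2)] by (auto simp: I_def)
  have sub: "{e \<in> (`) f ` E. e \<subseteq> J} \<subseteq> (`) f ` {e \<in> E. e \<subseteq> I}"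
  proof
    fix e' assume "e' \<in> {e \<in> (`) f ` E. e \<subseteq> J}"
    then obtain e where e: "e \<in> E" "e' = f ` e" "f ` e \<subseteq> J" by blast
    then have "e \<subseteq> I" using eV[OF e(1)] by (auto simp: I_def)
    then show "e' \<in> (`) f ` {e \<in> E. e \<subseteq> I}" using e by blast
  qed
  have "finite {e \<in> E. e \<subseteq> I}" by (rule finite_subset[of _ "Pow I"]) (use fI in auto)
  then have "card {e \<in> (`) f ` E. e \<subseteq> J} \<le> card {e \<in> E. e \<subseteq> I}" by (rule surj_card_le[OF _ sub])
  moreover have "2 * card {e \<in> E. e \<subseteq> I} \<le> m * card I" using assms(1) by (auto simp: sparse_def I_def)
  moreover have "card J = card I" using JI inj by (simp add: card_image)
  ultimately show "2 * card {e \<in> (`) f ` E. e \<subseteq> J} \<le> m * card J" by simp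
qed

lemma sparse_union:
  assumes "sparse m V E" "sparse m V' E'" "V \<inter> V' = {}"
  shows "sparse m (V \<union> V') (E \<union> E')"
  unfolding sparse_def
proof (intro conjI allI impI)
  show "finite (V \<union> V')" using assms by (simp add: sparse_def)
  show "E \<union> E' \<subseteq> nsets (V \<union> V') 2"
    using assms nsets_mono[of V "V \<union> V'" 2] nsets_mono[of V' "V \<union> V'" 2] by (auto simp: sparse_def)
  fix J assume J: "J \<subseteq> V \<union> V'"
  have fJ: "finite J" using J assms(1,2) finite_subset by (auto simp: sparse_def)
  have eV: "e \<subseteq> V" if "e \<in> E" for e using that assms(1) by (auto simp: sparse_def nsets_def)
  have eV': "e \<subseteq> V'" if "e \<in> E'" for e using that assms(2) by (auto simp: sparse_def nsets_def)
  have "{e \<in> E \<union> E'. e \<subseteq> J} \<subseteq> {e \<in> E. e \<subseteq> J \<inter> V} \<union> {e \<in> E'. e \<subseteq> J \<inter> V'}"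
    using eV eV' by blast
  then have "card {e \<in> E \<union> E'. e \<subseteq> J} \<le> card {e \<in> E. e \<subseteq> J \<inter> V} + card {e \<in> E'. e \<subseteq> J \<inter> V'}"
    using fJ by (intro order_trans[OF card_mono card_Un_le]) (auto intro: finite_subset[of _ "Pow J"])
  moreover have "2 * card {e \<in> E. e \<subseteq> J \<inter> V} \<le> m * card (J \<inter> V)"
    "2 * card {e \<in> E'. e \<subseteq> J \<inter> V'} \<le> m * card (J \<inter> V')"
    using assms by (auto simp: sparse_def)
  moreover have "card J = card (J \<inter> V) + card (J \<inter> V')"
  proof -
    have "J = (J \<inter> V) \<union> (J \<inter> V')" using J by auto
    then show ?thesis using fJ assms(3) card_Un_disjoint[of "J \<inter> V" "J \<inter> V'"] by auto
  qed
  ultimately show "2 * card {e \<in> E \<union> E'. e \<subseteq> J} \<le> m * card J"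
    by (simp add: algebra_simps)
qed

lemma sparse_UN:
  fixes k :: nat
  assumes "\<And>i. i < k \<Longrightarrow> sparse m (V i) (E i)" "\<And>i j. i < k \<Longrightarrow> j < k \<Longrightarrow> i \<noteq> j \<Longrightarrow> V i \<inter> V j = {}"
  shows "sparse m (\<Union>i<k. V i) (\<Union>i<k. E i)"
  using assms
proof (induction k)
  case 0
  then show ?case by (simp add: sparse_def)
next
  case (Suc k)
  have "sparse m (V k \<union> (\<Union>i<k. V i)) (E k \<union> (\<Union>i<k. E i))"
  proof (rule sparse_union)
    show "sparse m (\<Union>i<k. V i) (\<Union>i<k. E i)" using Suc by auto
    have "V k \<inter> V i = {}" if "i < k" for i using Suc.prems(2)[of k i] that by simp
    then show "V k \<inter> (\<Union>i<k. V i) = {}" by blast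
  qed (use Suc in simp)
  then show ?case by (simp add: lessThan_Suc)
qed

text \<open>The square of the right side is at least (n^2 p^(t-1))^|J|. As the base is at least 1
  and \<open>J\<close> is nonempty, the exponent may be lowered to 1.\<close>

lemma sparse_rate:
  assumes sp: "sparse (t - 1) V E" and p: "0 < p" "p \<le> 1" and X: "1 \<le> (real n)\<^sup>2 * p ^ (t - 1)"
    and J: "J \<subseteq> V" "{e \<in> E. e \<subseteq> J} \<noteq> {}"
  shows "sqrt ((real n)\<^sup>2 * p ^ (t - 1)) \<le> real n ^ card J * p ^ card {e \<in> E. e \<subseteq> J}"
proof -
  let ?X = "(real n)\<^sup>2 * p ^ (t - 1)"
  have fJ: "finite J" using sp J finite_subset by (auto simp: sparse_def)
  obtain e where e: "e \<in> E" "e \<subseteq> J" using J by blast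
  then have "e \<in> nsets V 2" using sp by (auto simp: sparse_def)
  then have "e \<noteq> {}" by (auto simp: nsets_def)
  then have "J \<noteq> {}" using e by auto
  then have J1: "1 \<le> card J" using fJ by (simp add: Suc_le_eq card_gt_0_iff)
  have "?X = ?X ^ 1" by simp
  also have "\<dots> \<le> ?X ^ card J" using X J1 by (rule power_increasing[rotated])
  also have "\<dots> = (real n ^ card J)\<^sup>2 * p ^ ((t - 1) * card J)"
    by (simp add: power_mult_distrib power_mult[symmetric] mult.commute)
  also have "\<dots> \<le> (real n ^ card J)\<^sup>2 * p ^ (2 * card {e \<in> E. e \<subseteq> J})"
    using sp J p by (intro mult_left_mono power_decreasing) (auto simp: sparse_def)
  also have "\<dots> = (real n ^ card J * p ^ card {e \<in> E. e \<subseteq> J})\<^sup>2"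
    by (simp add: power_mult_distrib power_mult[symmetric] mult.commute)
  finally show ?thesis using p by (intro real_le_lsqrt) auto
qed

section \<open>Maps whose image has many common neighbours\<close>

definition common_nbrs :: "nat graph \<Rightarrow> nat set \<Rightarrow> nat set" where
  "common_nbrs \<Gamma> A = {w \<in> vertices \<Gamma>. \<forall>a\<in>A. {a, w} \<in> edges \<Gamma>}"

lemma common_nbrs_subset: "common_nbrs \<Gamma> A \<subseteq> vertices \<Gamma>"
  unfolding common_nbrs_def by blast

lemma card_PiE_same_value_le:
  assumes V: "finite V" "a \<in> V" "b \<in> V" "a \<noteq> b"
  shows "card {\<phi> \<in> V \<rightarrow>\<^sub>E {1..n :: nat}. \<phi> a = \<phi> b} \<le> n ^ (card V - 1)"
proof -
  let ?A = "{\<phi> \<in> V \<rightarrow>\<^sub>E {1..n}. \<phi> a = \<phi> b}"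
  have "card ?A \<le> card ((V - {b}) \<rightarrow>\<^sub>E {1..n})"
  proof (rule card_inj_on_le)
    show "inj_on (\<lambda>\<phi>. restrict \<phi> (V - {b})) ?A"
    proof (rule inj_onI)
      fix \<phi> \<psi> assume *: "\<phi> \<in> ?A" "\<psi> \<in> ?A" "restrict \<phi> (V - {b}) = restrict \<psi> (V - {b})"
      have eq: "\<phi> x = \<psi> x" if "x \<in> V - {b}" for x
        using fun_cong[OF *(3), of x] that by simp
      show "\<phi> = \<psi>"
      proof (rule PiE_ext[of \<phi> V "\<lambda>_. {1..n}" \<psi>])
        fix x assume "x \<in> V"
        then show "\<phi> x = \<psi> x" using eq[of x] eq[of a] * V by (cases "x = b") auto
      qed (use * in auto)
    qed
    show "(\<lambda>\<phi>. restrict \<phi> (V - {b})) ` ?A \<subseteq> (V - {b}) \<rightarrow>\<^sub>E {1..n}"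
      by (rule image_subsetI) (unfold restrict_PiE_iff, blast dest: PiE_mem)
    show "finite ((V - {b}) \<rightarrow>\<^sub>E {1..n})" using V by (intro finite_PiE) auto
  qed
  also have "\<dots> = n ^ (card V - 1)" using V by (simp add: card_PiE card_Diff_singleton)
  finally show ?thesis .
qed

lemma card_not_inj_le:
  assumes V: "finite V"
  shows "card {\<phi> \<in> V \<rightarrow>\<^sub>E {1..n :: nat}. \<not> inj_on \<phi> V} \<le> (card V)\<^sup>2 * n ^ (card V - 1)"
proof -
  let ?I = "{(a, b). a \<in> V \<and> b \<in> V \<and> a \<noteq> b}"
  have fI: "finite ?I" by (rule finite_subset[of _ "V \<times> V"]) (use V in auto)
  have "{\<phi> \<in> V \<rightarrow>\<^sub>E {1..n}. \<not> inj_on \<phi> V} \<subseteq> (\<Union>i\<in>?I. {\<phi> \<in> V \<rightarrow>\<^sub>E {1..n}. \<phi> (fst i) = \<phi> (snd i)})"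
    by (auto simp: inj_on_def)
  then have "card {\<phi> \<in> V \<rightarrow>\<^sub>E {1..n}. \<not> inj_on \<phi> V} \<le> card (\<Union>i\<in>?I. {\<phi> \<in> V \<rightarrow>\<^sub>E {1..n}. \<phi> (fst i) = \<phi> (snd i)})"
    using V fI by (intro card_mono finite_UN_I finite_subset[OF _ finite_PiE[of V "\<lambda>_. {1..n}"]]) auto
  also have "\<dots> \<le> (\<Sum>i\<in>?I. card {\<phi> \<in> V \<rightarrow>\<^sub>E {1..n}. \<phi> (fst i) = \<phi> (snd i)})"
    by (rule card_UN_le[OF fI])
  also have "\<dots> \<le> (\<Sum>i\<in>?I. n ^ (card V - 1))"
  proof (rule sum_mono)
    fix i assume "i \<in> ?I"
    then show "card {\<phi> \<in> V \<rightarrow>\<^sub>E {1..n}. \<phi> (fst i) = \<phi> (snd i)} \<le> n ^ (card V - 1)"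
      by (intro card_PiE_same_value_le[OF V]) auto
  qed
  also have "\<dots> = card ?I * n ^ (card V - 1)" by simp
  also have "\<dots> \<le> (card V)\<^sup>2 * n ^ (card V - 1)"
  proof (rule mult_le_mono1)
    have "card ?I \<le> card (V \<times> V)" by (rule card_mono) (use V in auto)
    then show "card ?I \<le> (card V)\<^sup>2" by (simp add: card_cartesian_product power2_eq_square)
  qed
  finally show ?thesis .
qed

text \<open>The degree sum is at least d n^2 / 4, and vertices of degree below dn/8 supply at most
  half of it.\<close>

lemma many_high_degree:
  assumes \<Gamma>: "simple_graph \<Gamma>" "vertices \<Gamma> = {1..n}" "d \<le> density \<Gamma>" and d: "d > 0" and n: "n \<ge> 2"
  shows "d / 8 * real n \<le> card {w \<in> {1..n}. d / 8 * real n \<le> card (common_nbrs \<Gamma> {w})}"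
proof -
  define N where "N = (\<lambda>w. common_nbrs \<Gamma> {w})"
  let ?H = "{w \<in> {1..n}. d / 8 * real n \<le> card (N w)}"
  have E: "edges \<Gamma> \<subseteq> nsets {1..n} 2" using \<Gamma> by (simp add: simple_graph_def)
  have cN: "card (N w) \<le> n" for w
  proof -
    have "N w \<subseteq> {1..n}" unfolding N_def \<Gamma>(2)[symmetric] by (rule common_nbrs_subset)
    from card_mono[OF finite_atLeastAtMost this] show ?thesis by simp
  qed
  have "real (2 * (n choose 2)) = real (n * (n - 1))" by (simp only: two_times_choose_two)
  then have eq: "2 * real (n choose 2) = real n * real (n - 1)" by simp
  have "real n / 2 \<le> real (n - 1)" using n by (simp add: of_nat_diff)
  then have "real n * (real n / 2) \<le> real n * real (n - 1)" by (intro mult_left_mono) auto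
  then have c2: "(real n)\<^sup>2 / 4 \<le> real (n choose 2)"
    unfolding eq[symmetric] by (simp add: power2_eq_square)
  have "0 < real (n choose 2)" using n by simp
  then have "d * real (n choose 2) \<le> card (edges \<Gamma>)"
    using \<Gamma>(2,3) by (simp add: density_def le_divide_eq)
  then have "d * ((real n)\<^sup>2 / 4) \<le> card (edges \<Gamma>)"
    using mult_left_mono[OF c2, of d] d by linarith
  also have "real (card (edges \<Gamma>)) \<le> real (edge_count (edges \<Gamma>) {1..n} {1..n})"
    using edges_le_edge_count[OF E] by (simp only: of_nat_le_iff)
  also have "edge_count (edges \<Gamma>) {1..n} {1..n} = (\<Sum>w\<in>{1..n}. card (N w))"
    unfolding edge_count_def N_def common_nbrs_def by (subst card_pairs_eq) (auto simp: \<Gamma>(2))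
  also have "real (\<Sum>w\<in>{1..n}. card (N w)) = (\<Sum>w\<in>{1..n} - ?H. real (card (N w))) + (\<Sum>w\<in>?H. real (card (N w)))"
    unfolding of_nat_sum by (rule sum.subset_diff) auto
  also have "(\<Sum>w\<in>{1..n} - ?H. real (card (N w))) \<le> (\<Sum>w\<in>{1..n} - ?H. d / 8 * real n)"
    by (rule sum_mono) auto
  also have "\<dots> \<le> (\<Sum>w\<in>{1..n}. d / 8 * real n)" using d by (intro sum_mono2) auto
  also have "(\<Sum>w\<in>?H. real (card (N w))) \<le> (\<Sum>w\<in>?H. real n)" by (rule sum_mono) (simp add: cN)
  finally have "d * ((real n)\<^sup>2 / 4) \<le> real n * (d / 8 * real n) + card ?H * real n" by simp
  then have "real n * (d / 8 * real n) \<le> real n * card ?H" by (simp add: power2_eq_square algebra_simps)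
  then show ?thesis using n by (simp add: N_def)
qed

text \<open>Double counting of maps \<phi> and vertices \<open>w\<close> adjacent to the whole
  image. Each of the dn/8 vertices of high degree sees (dn/8)^k maps, so the average common
  neighbourhood has size at least 2 \<epsilon> n; this is the origin of \<epsilon>. Hence at least
  \<epsilon> n^k maps are rich, and the at most k^2 n^(k-1) maps that are not injective cost at most
  half of them.\<close>

lemma many_rich_maps:
  assumes \<Gamma>: "simple_graph \<Gamma>" "vertices \<Gamma> = {1..n}" "d \<le> density \<Gamma>" and d: "d > 0" and n: "n \<ge> 2"
    and V: "finite V" "V \<noteq> {}" and \<epsilon>: "\<epsilon> = (d / 8) ^ (card V + 1) / 2"
    and n_large: "2 * (real (card V))\<^sup>2 \<le> \<epsilon> * real n"
  shows "\<epsilon> / 2 * real n ^ card V \<le> card {\<phi> \<in> V \<rightarrow>\<^sub>E {1..n}. inj_on \<phi> V \<and> \<epsilon> * real n \<le> card (common_nbrs \<Gamma> (\<phi> ` V))}"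
proof -
  let ?k = "card V" and ?M = "V \<rightarrow>\<^sub>E {1..n}"
  define C where "C = (\<lambda>\<phi>. common_nbrs \<Gamma> (\<phi> ` V))"
  let ?rich = "{\<phi> \<in> ?M. \<epsilon> * real n \<le> card (C \<phi>)}"
  let ?H = "{w \<in> {1..n}. d / 8 * real n \<le> card (common_nbrs \<Gamma> {w})}"
  have fM: "finite ?M" using V by (intro finite_PiE) auto
  have \<epsilon>0: "\<epsilon> > 0" unfolding \<epsilon> using d by simp
  have k1: "?k \<ge> 1" using V by (simp add: Suc_le_eq card_gt_0_iff)
  have nbr: "common_nbrs \<Gamma> {w} \<subseteq> {1..n}" for w
    unfolding \<Gamma>(2)[symmetric] by (rule common_nbrs_subset)
  have "(d / 8 * real n) * (d / 8 * real n) ^ ?k \<le> card ?H * (d / 8 * real n) ^ ?k"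
    using many_high_degree[OF \<Gamma> d n] d by (intro mult_right_mono) auto
  also have "\<dots> = (\<Sum>w\<in>?H. (d / 8 * real n) ^ ?k)" by simp
  also have "\<dots> \<le> (\<Sum>w\<in>?H. real (card {\<phi> \<in> ?M. w \<in> C \<phi>}))"
  proof (rule sum_mono)
    fix w assume w: "w \<in> ?H"
    have "(d / 8 * real n) ^ ?k \<le> real (card (common_nbrs \<Gamma> {w})) ^ ?k"
      using w d by (intro power_mono) auto
    also have "\<dots> = real (card (V \<rightarrow>\<^sub>E common_nbrs \<Gamma> {w}))" using V by (simp add: card_PiE)
    also have "\<dots> \<le> real (card {\<phi> \<in> ?M. w \<in> C \<phi>})"
      unfolding of_nat_le_iff
    proof (rule card_mono)
      show "V \<rightarrow>\<^sub>E common_nbrs \<Gamma> {w} \<subseteq> {\<phi> \<in> ?M. w \<in> C \<phi>}"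
      proof
        fix \<phi> assume \<phi>: "\<phi> \<in> V \<rightarrow>\<^sub>E common_nbrs \<Gamma> {w}"
        have "{\<phi> a, w} \<in> edges \<Gamma>" if "a \<in> V" for a
        proof -
          have "{w, \<phi> a} \<in> edges \<Gamma>" using PiE_mem[OF \<phi> that] unfolding common_nbrs_def by blast
          then show ?thesis by (simp add: insert_commute)
        qed
        then have "w \<in> C \<phi>" unfolding C_def common_nbrs_def \<Gamma>(2) using w by simp
        moreover have "\<phi> \<in> ?M" using \<phi> PiE_mono[of V "\<lambda>_. common_nbrs \<Gamma> {w}" "\<lambda>_. {1..n}"] nbr by blast
        ultimately show "\<phi> \<in> {\<phi> \<in> ?M. w \<in> C \<phi>}" by simp
      qed
    qed (use fM in simp)
    finally show "(d / 8 * real n) ^ ?k \<le> real (card {\<phi> \<in> ?M. w \<in> C \<phi>})" .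
  qed
  also have "\<dots> \<le> (\<Sum>w\<in>{1..n}. real (card {\<phi> \<in> ?M. w \<in> C \<phi>}))" by (rule sum_mono2) auto
  also have "\<dots> = (\<Sum>\<phi>\<in>?M. real (card {w \<in> {1..n}. w \<in> C \<phi>}))"
  proof -
    have "(\<Sum>w\<in>{1..n}. \<Sum>\<phi>\<in>{\<phi> \<in> ?M. w \<in> C \<phi>}. 1 :: real) = (\<Sum>\<phi>\<in>?M. \<Sum>w\<in>{w \<in> {1..n}. w \<in> C \<phi>}. 1)"
      by (rule sum.swap_restrict) (use fM in auto)
    then show ?thesis by simp
  qed
  also have "\<dots> = (\<Sum>\<phi>\<in>?M. real (card (C \<phi>)))"
  proof (rule sum.cong[OF refl])
    fix \<phi>
    have "{w \<in> {1..n}. w \<in> C \<phi>} = C \<phi>"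
      using common_nbrs_subset[of \<Gamma> "\<phi> ` V"] unfolding C_def \<Gamma>(2) by blast
    then show "real (card {w \<in> {1..n}. w \<in> C \<phi>}) = real (card (C \<phi>))" by (rule arg_cong)
  qed
  also have "\<dots> = (\<Sum>\<phi>\<in>?M - ?rich. real (card (C \<phi>))) + (\<Sum>\<phi>\<in>?rich. real (card (C \<phi>)))"
    by (rule sum.subset_diff) (use fM in auto)
  also have "(\<Sum>\<phi>\<in>?M - ?rich. real (card (C \<phi>))) \<le> (\<Sum>\<phi>\<in>?M - ?rich. \<epsilon> * real n)"
    by (rule sum_mono) auto
  also have "\<dots> \<le> (\<Sum>\<phi>\<in>?M. \<epsilon> * real n)" using \<epsilon>0 fM by (intro sum_mono2) auto
  also have "\<dots> = real n ^ ?k * (\<epsilon> * real n)" using V by (simp add: card_PiE)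
  also have "(\<Sum>\<phi>\<in>?rich. real (card (C \<phi>))) \<le> (\<Sum>\<phi>\<in>?rich. real n)"
  proof (rule sum_mono)
    fix \<phi>
    have "card (C \<phi>) \<le> card {1..n}" 
      unfolding C_def \<Gamma>(2)[symmetric] by (rule card_mono[OF _ common_nbrs_subset]) (simp add: \<Gamma>(2))
    then show "real (card (C \<phi>)) \<le> real n" by simp
  qed
  finally have "(d / 8 * real n) * (d / 8 * real n) ^ ?k \<le> real n ^ ?k * (\<epsilon> * real n) + card ?rich * real n" by simp
  moreover have "(d / 8 * real n) * (d / 8 * real n) ^ ?k = real n * (2 * \<epsilon> * real n ^ ?k)"
    by (simp add: \<epsilon> power_mult_distrib power_divide)
  ultimately have "real n * (2 * \<epsilon> * real n ^ ?k) \<le> real n ^ ?k * (\<epsilon> * real n) + card ?rich * real n"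
    by (simp only:)
  then have "real n * (\<epsilon> * real n ^ ?k) \<le> real n * card ?rich" by (simp add: algebra_simps)
  then have rich: "\<epsilon> * real n ^ ?k \<le> card ?rich" using n by simp
  let ?inj = "{\<phi> \<in> ?M. inj_on \<phi> V \<and> \<epsilon> * real n \<le> card (C \<phi>)}"
  have "?rich \<subseteq> ?inj \<union> {\<phi> \<in> ?M. \<not> inj_on \<phi> V}" by auto
  then have "card ?rich \<le> card ?inj + card {\<phi> \<in> ?M. \<not> inj_on \<phi> V}"
    using fM by (intro order_trans[OF card_mono card_Un_le]) auto
  also have "\<dots> \<le> card ?inj + ?k\<^sup>2 * n ^ (?k - 1)" using card_not_inj_le[OF V(1)] by simp
  finally have "real (card ?rich) \<le> real (card ?inj + ?k\<^sup>2 * n ^ (?k - 1))" by (simp only: of_nat_le_iff)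
  then have le: "real (card ?rich) \<le> real (card ?inj) + (real ?k)\<^sup>2 * real n ^ (?k - 1)" by simp
  have "2 * (real ?k)\<^sup>2 * real n ^ (?k - 1) \<le> \<epsilon> * real n * real n ^ (?k - 1)"
    using n_large by (intro mult_right_mono) auto
  also have "\<dots> = \<epsilon> * real n ^ ?k" using k1 by (cases ?k) auto
  finally have "2 * ((real ?k)\<^sup>2 * real n ^ (?k - 1)) \<le> \<epsilon> * real n ^ ?k" by simp
  then show ?thesis using rich le unfolding C_def by linarith
qed

lemma nsets_insert_subset:
  assumes "nsets K 2 \<subseteq> E" "\<And>y. y \<in> K \<Longrightarrow> y \<noteq> x \<Longrightarrow> {x, y} \<in> E"
  shows "nsets (insert x K) 2 \<subseteq> E"
proof
  fix e assume "e \<in> nsets (insert x K) 2"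
  then obtain a b where ab: "e = {a, b}" "a \<in> insert x K" "b \<in> insert x K" "a \<noteq> b" by (rule nsets2_E)
  show "e \<in> E"
  proof (cases "a = x \<or> b = x")
    case True
    then show ?thesis using ab assms(2) by (auto simp: insert_commute)
  next
    case False
    then have "e \<in> nsets K 2" using ab by auto
    then show ?thesis using assms(1) by blast
  qed
qed

section \<open>The pattern and its deterministic consequence\<close>

context tree_plus_vertex
begin

text \<open>One clique and \<open>D + 1\<close> disjoint copies of \<open>G\<close>. At most
  \<open>D\<close> vertices cannot meet all these copies, and more than \<open>D\<close> vertices
  are enough for one side in \<open>copy_blowup\<close>.\<close>

definition pattern_V :: "nat \<Rightarrow> (nat + 'a \<times> nat) set" where
  "pattern_V t = Inl ` {1..t} \<union> (\<Union>i<D + 1. (\<lambda>x. Inr (x, i)) ` vertices G)"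

definition pattern_E :: "nat \<Rightarrow> (nat + 'a \<times> nat) set set" where
  "pattern_E t = (`) Inl ` nsets {1..t} 2 \<union> (\<Union>i<D + 1. (`) (\<lambda>x. Inr (x, i)) ` edges G)"

text \<open>Twice the bound of \<open>G_edges_subset_le\<close> is 4 |J|, which is at most (t - 1)
  |J| because t \<ge> 5; disjoint unions preserve sparsity.\<close>

lemma sparse_pattern:
  assumes "t \<ge> 5"
  shows "sparse (t - 1) (pattern_V t) (pattern_E t)"
proof -
  have "sparse (t - 1) (vertices G) (edges G)"
    unfolding sparse_def
  proof (intro conjI allI impI)
    fix J assume "J \<subseteq> vertices G"
    then have "2 * card {e \<in> edges G. e \<subseteq> J} \<le> 4 * card J" using G_edges_subset_le by fastforce
    also have "\<dots> \<le> (t - 1) * card J" using assms by (intro mult_le_mono1) simp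
    finally show "2 * card {e \<in> edges G. e \<subseteq> J} \<le> (t - 1) * card J" .
  qed (fact G_simple)+
  then have "sparse (t - 1) ((\<lambda>x. Inr (x, i)) ` vertices G) ((`) (\<lambda>x. Inr (x, i)) ` edges G)" for i
    by (rule sparse_image) (auto simp: inj_on_def)
  then have "sparse (t - 1) (\<Union>i<D + 1. (\<lambda>x. Inr (x, i)) ` vertices G) (\<Union>i<D + 1. (`) (\<lambda>x. Inr (x, i)) ` edges G)"
    by (intro sparse_UN) auto
  moreover have "sparse (t - 1) (Inl ` {1..t}) ((`) Inl ` nsets {1..t} 2)"
    by (intro sparse_image sparse_complete) auto
  ultimately show ?thesis
    unfolding pattern_V_def pattern_E_def by (intro sparse_union) auto
qed

text \<open>All randomness is in the hypotheses. The factor 2^|V| in \<delta> is the number of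
  possible blue traces of a common neighbour on the pattern. After restricting to the most popular
  trace \<open>Q\<close>, each pattern vertex is joined to all of \<open>W'\<close> in a single
  colour.\<close>

lemma ramsey_from_pattern:
  fixes \<phi> :: "nat + 'a \<times> nat \<Rightarrow> nat"
  assumes t: "t \<ge> 5" and \<Gamma>: "simple_graph \<Gamma>" "vertices \<Gamma> = {1..n}" and E: "E \<subseteq> nsets {1..n} 2"
    and \<phi>: "inj_on \<phi> (pattern_V t)" "\<phi> ` pattern_V t \<subseteq> {1..n}" "\<epsilon> * real n \<le> card (common_nbrs \<Gamma> (\<phi> ` pattern_V t))"
      "(`) \<phi> ` pattern_E t \<subseteq> E"
    and \<delta>: "\<delta> = \<epsilon> / 2 ^ card (pattern_V t)" and n: "real D < \<delta> * real n"
    and cl: "cliques_everywhere (t - 1) n \<delta> E" and ra: "ramsey_everywhere (t - 2) n \<delta> E"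
  shows "ramsey_graph (complete_graph t) G (graph_union \<Gamma> \<lparr>vertices = {1..n}, edges = E\<rparr>)"
proof -
  let ?V = "pattern_V t"
  let ?F = "edges \<Gamma> \<union> E"
  have fV: "finite ?V" using sparse_pattern[OF t] by (simp add: sparse_def)
  have E\<Gamma>: "edges \<Gamma> \<subseteq> nsets {1..n} 2" using \<Gamma> by (simp add: simple_graph_def)
  have "(\<exists>K\<subseteq>{1..n}. finite K \<and> card K = t \<and> nsets K 2 \<subseteq> {e \<in> ?F. col e = Red}) \<or>
      contains_copy \<lparr>vertices = {1..n}, edges = {e \<in> ?F. col e = Blue}\<rparr> G" (is "?red \<or> ?blue") for col
  proof (rule disjCI)
    assume no_blue: "\<not> ?blue"
    let ?R = "{e \<in> ?F. col e = Red}" and ?B = "{e \<in> ?F. col e = Blue}"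
    have RB: "e \<in> ?R" if "e \<in> ?F" "e \<notin> ?B" for e using that by (cases "col e") auto
    define W where "W = common_nbrs \<Gamma> (\<phi> ` ?V)"
    have W_n: "W \<subseteq> {1..n}" and W_edge: "\<And>w a. w \<in> W \<Longrightarrow> a \<in> ?V \<Longrightarrow> {\<phi> a, w} \<in> ?F"
      unfolding W_def \<Gamma>(2)[symmetric] by (rule common_nbrs_subset) (simp add: common_nbrs_def)
    have fW: "finite W" using W_n finite_subset by blast
    have W_disj: "w \<noteq> \<phi> a" if "w \<in> W" "a \<in> ?V" for w a
    proof
      assume "w = \<phi> a"
      then have "{\<phi> a, \<phi> a} \<in> edges \<Gamma>" using that by (auto simp: W_def common_nbrs_def)
      then have "{\<phi> a, \<phi> a} \<in> nsets {1..n} 2" using E\<Gamma> by blast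
      then show False by (simp add: nsets_def)
    qed
    define \<tau> where "\<tau> = (\<lambda>w. {a \<in> ?V. {\<phi> a, w} \<in> ?B})"
    have "\<exists>Q\<subseteq>?V. \<delta> * real n \<le> card {w \<in> W. \<tau> w = Q}"
    proof (rule ccontr)
      assume none: "\<not> (\<exists>Q\<subseteq>?V. \<delta> * real n \<le> card {w \<in> W. \<tau> w = Q})"
      have small: "real (card {w \<in> W. \<tau> w = Q}) < \<delta> * real n" if "Q \<in> Pow ?V" for Q
        using none that by (meson PowD not_le)
      have "\<tau> w \<in> Pow ?V" for w unfolding \<tau>_def by blast
      then have "W \<subseteq> (\<Union>Q\<in>Pow ?V. {w \<in> W. \<tau> w = Q})" by blast
      then have "card W \<le> card (\<Union>Q\<in>Pow ?V. {w \<in> W. \<tau> w = Q})"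
        by (rule card_mono[rotated]) (use fV fW in simp)
      also have "\<dots> \<le> (\<Sum>Q\<in>Pow ?V. card {w \<in> W. \<tau> w = Q})"
        using fV by (intro card_UN_le) simp
      finally have "card W \<le> (\<Sum>Q\<in>Pow ?V. card {w \<in> W. \<tau> w = Q})" .
      then have "real (card W) \<le> real (\<Sum>Q\<in>Pow ?V. card {w \<in> W. \<tau> w = Q})" by (simp only: of_nat_le_iff)
      also have "\<dots> = (\<Sum>Q\<in>Pow ?V. real (card {w \<in> W. \<tau> w = Q}))" by simp
      also have "\<dots> < (\<Sum>Q\<in>Pow ?V. \<delta> * real n)"
        by (rule sum_strict_mono) (use small fV in auto)
      also have "\<dots> = \<epsilon> * real n" using fV by (simp add: card_Pow \<delta>)
      finally show False using \<phi>(3) by (simp add: W_def)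
    qed
    then obtain Q where Q: "Q \<subseteq> ?V" "\<delta> * real n \<le> card {w \<in> W. \<tau> w = Q}" by blast
    define W' where "W' = {w \<in> W. \<tau> w = Q}"
    have W': "W' \<subseteq> {1..n}" "\<delta> * real n \<le> card W'" "finite W'"
      using W_n Q(2) fW by (auto simp: W'_def)
    have big: "D < card W'" using n W'(2) by linarith
    have Q_blue: "{\<phi> a, w} \<in> ?B" if "a \<in> Q" "w \<in> W'" for a w
      using that Q(1) by (auto simp: W'_def \<tau>_def)
    have Q_red: "{\<phi> a, w} \<in> ?R" if "a \<in> ?V" "a \<notin> Q" "w \<in> W'" for a w
    proof (rule RB)
      show "{\<phi> a, w} \<in> ?F" using that W_edge by (auto simp: W'_def)
      have "a \<notin> \<tau> w" using that by (simp add: W'_def)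
      then show "{\<phi> a, w} \<notin> ?B" using that(1) unfolding \<tau>_def by blast
    qed
    have cQ: "card (\<phi> ` Q) = card Q" using inj_on_subset[OF \<phi>(1) Q(1)] by (rule card_image)
    have Q_n: "\<phi> ` Q \<subseteq> {1..n}" using \<phi>(2) Q(1) by blast
    have disj: "\<phi> ` Q \<inter> W' = {}" using W_disj Q(1) by (auto simp: W'_def)
    have not_in: "\<phi> a \<notin> K" if "a \<in> ?V" "K \<subseteq> W'" for a K using W_disj[of "\<phi> a" a] that by (auto simp: W'_def)
    show ?red
    proof (cases "D < card Q")
      case True
      \<comment> \<open>\<open>copy_blowup\<close> with the exceptional edge on the side of
        \<open>W'\<close>: a blue random edge there would give a blue copy.\<close>
      have W'_red: "e \<in> ?R" if e: "e \<in> E" "e \<in> nsets W' 2" for e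
      proof (rule RB)
        show "e \<notin> ?B"
        proof
          assume eB: "e \<in> ?B"
          obtain a b where ab: "e = {a, b}" "a \<in> W'" "b \<in> W'" "a \<noteq> b" using e(2) by (rule nsets2_E)
          have ?blue
            by (rule copy_blowup[of "\<phi> ` Q" W' _ a b]) (use ab eB Q_blue cQ True big disj Q_n W' in auto)
          then show False using no_blue by contradiction
        qed
      qed (use e in simp)
      obtain K where K: "K \<subseteq> W'" "finite K" "card K = t - 1" "nsets K 2 \<subseteq> E"
        using cl[unfolded cliques_everywhere_def, rule_format, OF W'(1,2)] by (elim exE conjE) (rule that)
      have K_red: "nsets K 2 \<subseteq> ?R"
      proof
        fix e assume e: "e \<in> nsets K 2"
        show "e \<in> ?R"
        proof (rule W'_red)
          show "e \<in> E" using K(4) e by (rule subsetD)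
          show "e \<in> nsets W' 2" using nsets_mono[OF K(1)] e by (rule subsetD)
        qed
      qed
      show ?thesis
      proof (cases "Q = ?V")
        case False
        then obtain a where a: "a \<in> ?V" "a \<notin> Q" using Q(1) by blast
        \<comment> \<open>A pattern vertex outside \<open>Q\<close> is joined to \<open>W'\<close>
          in red, so it extends the red (t-1)-clique.\<close>
        have "nsets (insert (\<phi> a) K) 2 \<subseteq> ?R"
        proof (rule nsets_insert_subset[OF K_red])
          fix y assume "y \<in> K"
          then have "y \<in> W'" using K(1) by (rule subsetD[rotated])
          then show "{\<phi> a, y} \<in> ?R" by (rule Q_red[OF a])
        qed
        moreover have "card (insert (\<phi> a) K) = t" using K t not_in[OF a(1) K(1)] by simp
        moreover have "insert (\<phi> a) K \<subseteq> {1..n}" using K(1) W'(1) \<phi>(2) a by blast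
        ultimately show ?thesis using K(2) by (intro exI[of _ "insert (\<phi> a) K"]) simp
      next
        \<comment> \<open>No pattern vertex is red to \<open>W'\<close>, so none can extend
          \<open>K\<close>. Now the sides of \<open>copy_blowup\<close> are exchanged: a blue edge
          within the image of the pattern would give a blue copy, hence the planted clique on t
          vertices is red. This is the reason for including it.\<close>
        case QV: True
        have Inl_V: "Inl ` {1..t} \<subseteq> ?V" by (auto simp: pattern_V_def)
        let ?C = "\<phi> ` Inl ` {1..t}"
        have "card ?C = card (Inl ` {1..t} :: (nat + 'a \<times> nat) set)"
          using inj_on_subset[OF \<phi>(1) Inl_V] by (rule card_image)
        then have cC: "card ?C = t" by (simp add: card_image)
        have C_edge: "e \<in> E" if e: "e \<in> nsets ?C 2" for e
        proof -
          obtain x y where xy: "e = {x, y}" "x \<in> ?C" "y \<in> ?C" "x \<noteq> y" using e by (rule nsets2_E)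
          then obtain i j where ij: "i \<in> {1..t}" "j \<in> {1..t}" "x = \<phi> (Inl i)" "y = \<phi> (Inl j)" by blast
          then have "{i, j} \<in> nsets {1..t} 2" using xy by auto
          then have "Inl ` {i, j} \<in> pattern_E t" unfolding pattern_E_def by blast
          then have "\<phi> ` Inl ` {i, j} \<in> E" using \<phi>(4) by blast
          then show ?thesis using xy ij by simp
        qed
        have "nsets ?C 2 \<subseteq> ?R"
        proof
          fix e assume e: "e \<in> nsets ?C 2"
          show "e \<in> ?R"
          proof (rule RB)
            show "e \<in> ?F" using C_edge[OF e] by simp
            show "e \<notin> ?B"
            proof
              assume eB: "e \<in> ?B"
              obtain x y where xy: "e = {x, y}" "x \<in> ?C" "y \<in> ?C" "x \<noteq> y" using e by (rule nsets2_E)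
              have xyQ: "x \<in> \<phi> ` Q" "y \<in> \<phi> ` Q" using xy Inl_V QV by blast+
              have QB: "{w, z} \<in> ?B" if w: "w \<in> W'" and z: "z \<in> \<phi> ` Q" for w z
              proof -
                obtain a where a: "a \<in> Q" "z = \<phi> a" using z by blast
                have "{z, w} \<in> ?B" unfolding a(2) using a(1) w by (rule Q_blue)
                then show ?thesis by (subst insert_commute)
              qed
              have ?blue
              proof (rule copy_blowup[of W' "\<phi> ` Q" _ x y, OF QB])
                show "{x, y} \<in> ?B" using eB xy(1) by simp
              qed (use xy xyQ cQ True big disj Q_n W' in auto)
              then show False using no_blue by contradiction
            qed
          qed
        qed
        moreover have "?C \<subseteq> {1..n}" using \<phi>(2) Inl_V by blast
        ultimately show ?thesis using cC by (intro exI[of _ ?C]) simp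
      qed
    next
      case False
      let ?block = "\<lambda>i. (\<lambda>x. Inr (x, i)) ` vertices G :: (nat + 'a \<times> nat) set"
      \<comment> \<open>Pigeonhole: the \<open>D + 1\<close> blocks are disjoint and
        \<open>Q\<close> has at most \<open>D\<close> vertices.\<close>
      have "\<exists>i<D + 1. ?block i \<inter> Q = {}"
      proof (rule ccontr)
        assume none: "\<not> (\<exists>i<D + 1. ?block i \<inter> Q = {})"
        have "\<exists>x. Inr (x, i) \<in> Q" if "i < D + 1" for i
        proof -
          have "?block i \<inter> Q \<noteq> {}" using none that by blast
          then show ?thesis by blast
        qed
        then obtain f where f: "\<And>i. i < D + 1 \<Longrightarrow> Inr (f i, i) \<in> Q" by metis
        have "card {..<D + 1} \<le> card Q"
          using f finite_subset[OF Q(1) fV]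
          by (intro card_inj_on_le[of "\<lambda>i. Inr (f i, i)"]) (auto simp: inj_on_def)
        then show False using False by simp
      qed
      then obtain i where i: "i < D + 1" "?block i \<inter> Q = {}" by blast
      define h where "h = (\<lambda>x. \<phi> (Inr (x, i)))"
      have V_h: "Inr (x, i) \<in> ?V" if "x \<in> vertices G" for x
        unfolding pattern_V_def using that i(1) by blast
      have Q_h: "Inr (x, i) \<notin> Q" if "x \<in> vertices G" for x using that i(2) by blast
      have h_E: "h ` e \<in> E" if "e \<in> edges G" for e
      proof -
        have "(\<lambda>x. Inr (x, i)) ` e \<in> pattern_E t" unfolding pattern_E_def using that i(1) by blast
        then have "\<phi> ` (\<lambda>x. Inr (x, i)) ` e \<in> E" using \<phi>(4) by blast
        then show ?thesis by (simp add: h_def image_image)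
      qed
      have h_inj: "inj_on h (vertices G)"
        using \<phi>(1) V_h by (auto simp: h_def inj_on_def)
      have h_n: "h ` vertices G \<subseteq> {1..n}" using V_h \<phi>(2) by (auto simp: h_def)
      \<comment> \<open>The chosen copy of \<open>G\<close> is not entirely blue. Both ends of its
        red edge are joined to \<open>W'\<close> in red, so t - 2 more vertices suffice.\<close>
      obtain e where e: "e \<in> edges G" "h ` e \<notin> ?B"
      proof (rule ccontr)
        assume no: "\<not> thesis"
        have "\<forall>e\<in>edges G. h ` e \<in> ?B" using no that by blast
        then have ?blue unfolding contains_copy_def using h_inj h_n by (intro exI[of _ h]) simp
        then show False using no_blue by contradiction
      qed
      then have eR: "h ` e \<in> ?R" using h_E[OF e(1)] by (intro RB) auto
      have "e \<in> nsets (vertices G) 2" using G_simple(2) e(1) by blast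
      then obtain a b where ab: "e = {a, b}" "a \<in> vertices G" "b \<in> vertices G" "a \<noteq> b" by (rule nsets2_E)
      have hab: "h a \<noteq> h b" "{h a, h b} \<in> ?R" using ab h_inj eR by (auto simp: inj_on_def)
      have h_red: "{h x, w} \<in> ?R" if "x \<in> vertices G" "w \<in> W'" for x w
        unfolding h_def using V_h[OF that(1)] Q_h[OF that(1)] that(2) by (rule Q_red)
      have "\<not> contains_copy \<lparr>vertices = W', edges = {e \<in> E. col e = Blue}\<rparr> G"
      proof
        assume "contains_copy \<lparr>vertices = W', edges = {e \<in> E. col e = Blue}\<rparr> G"
        then have ?blue by (rule contains_copy_mono) (use W'(1) in auto)
        then show False using no_blue by contradiction
      qed
      then obtain K where K: "K \<subseteq> W'" "finite K" "card K = t - 2" "nsets K 2 \<subseteq> {e \<in> E. col e = Red}"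
        using ra[unfolded ramsey_everywhere_def, rule_format, OF W'(1,2), of col]
        by (elim disjE exE conjE) (rule that, assumption+, rule notE)
      have KR: "nsets K 2 \<subseteq> ?R" using K(4) by auto
      have b_red: "nsets (insert (h b) K) 2 \<subseteq> ?R"
      proof (rule nsets_insert_subset[OF KR])
        fix y assume "y \<in> K"
        then show "{h b, y} \<in> ?R" using h_red[OF ab(3), of y] K(1) by blast
      qed
      have "nsets (insert (h a) (insert (h b) K)) 2 \<subseteq> ?R"
      proof (rule nsets_insert_subset[OF b_red])
        fix y assume "y \<in> insert (h b) K"
        then show "{h a, y} \<in> ?R" using h_red[OF ab(2), of y] hab(2) K(1) by blast
      qed
      moreover have "card (insert (h a) (insert (h b) K)) = t"
      proof -
        have "h a \<notin> K" "h b \<notin> K" using not_in[OF V_h K(1)] ab by (auto simp: h_def)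
        then show ?thesis using K hab(1) t by simp
      qed
      moreover have "insert (h a) (insert (h b) K) \<subseteq> {1..n}" using K(1) W'(1) h_n ab by blast
      ultimately show ?thesis using K(2) by (intro exI[of _ "insert (h a) (insert (h b) K)"]) simp
    qed
  qed
  then show ?thesis
    unfolding ramsey_graph_def contains_complete_iff color_class_def graph_union_def
    using \<Gamma>(2) by simp
qed

end


section \<open>The threshold\<close>

text \<open>The model draws an indicator function on all sets, while \<open>expect\<close> sums over
  edge sets. The two match on the support of the product measure, where the indicator takes its
  default value \<open>False\<close> outside the possible edges.\<close>

lemma prob_binomial_random_graph:
  assumes p: "0 \<le> p" "p \<le> 1"
  shows "measure_pmf.prob (binomial_random_graph n p) {R. Q R} = pr (nsets {1..n} 2) p (\<lambda>E. Q \<lparr>vertices = {1..n}, edges = E\<rparr>)"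
proof -
  let ?P = "nsets {1..n} 2"
  let ?M = "Pi_pmf ?P False (\<lambda>_. bernoulli_pmf p)"
  let ?\<chi> = "\<lambda>E (e :: nat set). e \<in> E"
  let ?Q = "\<lambda>E. Q \<lparr>vertices = {1..n}, edges = E\<rparr>"
  let ?S = "{X. ?Q {e \<in> ?P. X e}}"
  have fin: "finite ?P" by (rule finite_pairs)
  have supp: "set_pmf ?M \<subseteq> ?\<chi> ` Pow ?P"
  proof
    fix X assume "X \<in> set_pmf ?M"
    then have X: "\<And>e. e \<notin> ?P \<Longrightarrow> \<not> X e" using set_Pi_pmf_subset[OF fin, of False "\<lambda>_. bernoulli_pmf p"] by blast
    have "X = ?\<chi> {e. X e}" by simp
    moreover have "{e. X e} \<in> Pow ?P" using X by blast
    ultimately show "X \<in> ?\<chi> ` Pow ?P" by (rule image_eqI)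
  qed
  have inj: "inj_on ?\<chi> A" for A by (rule inj_onI) (metis set_eqI)
  have "measure_pmf.prob (binomial_random_graph n p) {R. Q R} = measure_pmf.prob ?M ?S"
    unfolding binomial_random_graph_def measure_map_pmf by (simp add: vimage_def)
  also have "\<dots> = measure_pmf.prob ?M (?S \<inter> set_pmf ?M)" by (simp add: measure_Int_set_pmf)
  also have "?S \<inter> set_pmf ?M = (?\<chi> ` {E \<in> Pow ?P. ?Q E}) \<inter> set_pmf ?M"
  proof -
    have "?S \<inter> ?\<chi> ` Pow ?P = ?\<chi> ` {E \<in> Pow ?P. ?Q E}"
    proof -
      have eq: "{e \<in> ?P. ?\<chi> E e} = E" if "E \<in> Pow ?P" for E using that by blast
      show ?thesis
      proof (intro set_eqI iffI)
        fix X assume "X \<in> ?S \<inter> ?\<chi> ` Pow ?P"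
        then obtain E where E: "E \<in> Pow ?P" "X = ?\<chi> E" "?Q {e \<in> ?P. X e}" by blast
        then have "?Q E" using eq[OF E(1)] by simp
        then show "X \<in> ?\<chi> ` {E \<in> Pow ?P. ?Q E}" using E by blast
      next
        fix X assume "X \<in> ?\<chi> ` {E \<in> Pow ?P. ?Q E}"
        then obtain E where E: "E \<in> Pow ?P" "?Q E" "X = ?\<chi> E" by blast
        then have "?Q {e \<in> ?P. X e}" using eq[OF E(1)] by simp
        then show "X \<in> ?S \<inter> ?\<chi> ` Pow ?P" using E by blast
      qed
    qed
    moreover have "A \<inter> C = (A \<inter> B) \<inter> C" if "C \<subseteq> B" for A B C :: "(nat set \<Rightarrow> bool) set"
      using that by blast
    from this[OF supp, of ?S] have "?S \<inter> set_pmf ?M = (?S \<inter> ?\<chi> ` Pow ?P) \<inter> set_pmf ?M" .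
    ultimately show ?thesis by (simp only:)
  qed
  also have "measure_pmf.prob ?M \<dots> = measure_pmf.prob ?M (?\<chi> ` {E \<in> Pow ?P. ?Q E})" by (simp add: measure_Int_set_pmf)
  also have "\<dots> = (\<Sum>X\<in>?\<chi> ` {E \<in> Pow ?P. ?Q E}. pmf ?M X)"
    by (rule measure_measure_pmf_finite, rule finite_imageI, rule finite_subset[of _ "Pow ?P"]) (use fin in auto)
  also have "\<dots> = (\<Sum>E\<in>{E \<in> Pow ?P. ?Q E}. pmf ?M (?\<chi> E))"
    by (subst sum.reindex[OF inj]) (simp only: o_def)
  also have "\<dots> = (\<Sum>E\<in>{E \<in> Pow ?P. ?Q E}. p ^ card E * (1 - p) ^ card (?P - E))"
  proof (rule sum.cong[OF refl])
    fix E assume "E \<in> {E \<in> Pow ?P. ?Q E}"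
    then have E: "E \<subseteq> ?P" by simp
    have "pmf ?M (?\<chi> E) = (\<Prod>e\<in>?P. pmf (bernoulli_pmf p) (e \<in> E))"
      using E by (subst pmf_Pi[OF fin]) auto
    also have "\<dots> = (\<Prod>e\<in>?P. if e \<in> E then p else 1 - p)"
      using p by (intro prod.cong refl) auto
    also have "\<dots> = (\<Prod>e\<in>?P \<inter> {e. e \<in> E}. p) * (\<Prod>e\<in>?P \<inter> - {e. e \<in> E}. 1 - p)"
      by (rule prod.If_cases[OF fin])
    also have "?P \<inter> {e. e \<in> E} = E" using E by blast
    also have "?P \<inter> - {e. e \<in> E} = ?P - E" by blast
    finally show "pmf ?M (?\<chi> E) = p ^ card E * (1 - p) ^ card (?P - E)" by simp
  qed
  also have "\<dots> = pr ?P p ?Q"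
    unfolding expect_def by (rule sum.mono_neutral_cong_left) (use fin in auto)
  finally show ?thesis .
qed

lemma with_high_probability_binomial:
  assumes p: "\<And>n. 0 \<le> p n \<and> p n \<le> 1"
    and lim: "(\<lambda>n. pr (nsets {1..n} 2) (p n) (\<lambda>E. \<not> Q n \<lparr>vertices = {1..n}, edges = E\<rparr>)) \<longlonglongrightarrow> 0"
  shows "with_high_probability (\<lambda>n. binomial_random_graph n (p n)) Q"
proof -
  have "pr (nsets {1..n} 2) (p n) (\<lambda>E. Q n \<lparr>vertices = {1..n}, edges = E\<rparr>) =
      1 - pr (nsets {1..n} 2) (p n) (\<lambda>E. \<not> Q n \<lparr>vertices = {1..n}, edges = E\<rparr>)" for n
  proof -
    have "expect (nsets {1..n} 2) (p n) (\<lambda>_. 1) =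
       pr (nsets {1..n} 2) (p n) (\<lambda>E. Q n \<lparr>vertices = {1..n}, edges = E\<rparr>) +
       pr (nsets {1..n} 2) (p n) (\<lambda>E. \<not> Q n \<lparr>vertices = {1..n}, edges = E\<rparr>)"
      unfolding expect_add[symmetric] by (rule expect_cong) (simp add: of_bool_def)
    then show ?thesis using expect_const[OF finite_pairs, of n "p n" 1] by linarith
  qed
  moreover have "(\<lambda>n. 1 - pr (nsets {1..n} 2) (p n) (\<lambda>E. \<not> Q n \<lparr>vertices = {1..n}, edges = E\<rparr>)) \<longlonglongrightarrow> 1 - 0"
    by (intro tendsto_diff tendsto_const lim)
  ultimately show ?thesis
    unfolding with_high_probability_def using p by (simp add: prob_binomial_random_graph)
qed

section \<open>The upper bound, uniformly in the dense graph\<close>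

context tree_plus_vertex
begin

text \<open>The dense graph is fixed, so no union bound is paid and the slowly growing exponent from
  \<open>sparse_rate\<close> is enough. Janson's inequality is applied to the extensional maps only,
  which are among the maps excluded by the event.\<close>

lemma pattern_appears:
  assumes t: "t \<ge> 5" and \<Gamma>: "simple_graph \<Gamma>" "vertices \<Gamma> = {1..n}" "d \<le> density \<Gamma>" and d: "d > 0" and n: "n \<ge> 2"
    and \<epsilon>: "\<epsilon> = (d / 8) ^ (card (pattern_V t) + 1) / 2"
    and n_large: "2 * (real (card (pattern_V t)))\<^sup>2 \<le> \<epsilon> * real n"
    and p: "0 \<le> p" "p \<le> 1" and X: "1 \<le> (real n)\<^sup>2 * p ^ (t - 1)"
  shows "pr (nsets {1..n} 2) p (\<lambda>E. \<forall>\<phi>. inj_on \<phi> (pattern_V t) \<longrightarrow> \<phi> ` pattern_V t \<subseteq> {1..n} \<longrightarrow>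
      \<epsilon> * real n \<le> card (common_nbrs \<Gamma> (\<phi> ` pattern_V t)) \<longrightarrow> \<not> (`) \<phi> ` pattern_E t \<subseteq> E)
    \<le> exp (- (\<epsilon> / 2) * sqrt ((real n)\<^sup>2 * p ^ (t - 1)) / (2 * (2 * card (pattern_V t)) ^ card (pattern_V t)))"
proof -
  let ?V = "pattern_V t" and ?E = "pattern_E t"
  have sp: "sparse (t - 1) ?V ?E" by (rule sparse_pattern[OF t])
  have fV: "finite ?V" and EV: "?E \<subseteq> nsets ?V 2" using sp by (simp_all add: sparse_def)
  have "{1, 2} \<in> nsets {1..t} 2" using t by simp
  then have "Inl ` {1, 2} \<in> ?E" unfolding pattern_E_def by blast
  then have E_ne: "?E \<noteq> {}" by blast
  have "Inl 1 \<in> ?V" using t by (simp add: pattern_V_def)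
  then have V_ne: "?V \<noteq> {}" by blast
  have p0: "p > 0" using X t p by (cases "p = 0") (auto simp: power_0_left)
  have \<epsilon>0: "\<epsilon> > 0" unfolding \<epsilon> using d by simp
  define \<F> where "\<F> = {\<phi> \<in> ?V \<rightarrow>\<^sub>E {1..n}. inj_on \<phi> ?V \<and> \<epsilon> * real n \<le> card (common_nbrs \<Gamma> (\<phi> ` ?V))}"
  have "pr (nsets {1..n} 2) p (\<lambda>E. \<forall>\<phi>. inj_on \<phi> ?V \<longrightarrow> \<phi> ` ?V \<subseteq> {1..n} \<longrightarrow>
      \<epsilon> * real n \<le> card (common_nbrs \<Gamma> (\<phi> ` ?V)) \<longrightarrow> \<not> (`) \<phi> ` ?E \<subseteq> E)
    \<le> pr (nsets {1..n} 2) p (\<lambda>E. \<forall>\<phi>\<in>\<F>. \<not> (`) \<phi> ` ?E \<subseteq> E)"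
  proof (rule pr_mono[OF p], intro ballI)
    fix E \<phi>
    assume *: "\<forall>\<phi>. inj_on \<phi> ?V \<longrightarrow> \<phi> ` ?V \<subseteq> {1..n} \<longrightarrow> \<epsilon> * real n \<le> card (common_nbrs \<Gamma> (\<phi> ` ?V)) \<longrightarrow> \<not> (`) \<phi> ` ?E \<subseteq> E"
      and \<phi>: "\<phi> \<in> \<F>"
    have "\<phi> ` ?V \<subseteq> {1..n}" using \<phi> by (intro image_subsetI) (auto simp: \<F>_def dest: PiE_mem)
    then show "\<not> (`) \<phi> ` ?E \<subseteq> E" using * \<phi> by (simp add: \<F>_def)
  qed
  also have "\<dots> \<le> exp (- (\<epsilon> / 2) * sqrt ((real n)\<^sup>2 * p ^ (t - 1)) / (2 * (2 * card ?V) ^ card ?V))"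
  proof (rule janson_embed[OF fV EV E_ne finite_pairs p0 p(2)])
    show "\<F> \<subseteq> ?V \<rightarrow>\<^sub>E {1..n}" by (auto simp: \<F>_def)
    show "inj_on \<phi> ?V" if "\<phi> \<in> \<F>" for \<phi> using that by (simp add: \<F>_def)
    show "\<phi> ` e \<in> nsets {1..n} 2" if \<phi>: "\<phi> \<in> \<F>" and e: "e \<in> ?E" for \<phi> e
    proof -
      have eV: "e \<in> nsets ?V 2" using EV e by blast
      then have sub: "e \<subseteq> ?V" by (simp add: nsets_def)
      have "inj_on \<phi> ?V" using \<phi> by (simp add: \<F>_def)
      then have inj: "inj_on \<phi> e" using sub by (rule inj_on_subset)
      have "\<phi> ` ?V \<subseteq> {1..n}" using \<phi> by (intro image_subsetI) (auto simp: \<F>_def dest: PiE_mem)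
      then have "\<phi> ` e \<subseteq> {1..n}" using sub by blast
      then show ?thesis using eV card_image[OF inj] by (simp add: nsets_def)
    qed
    show "0 < \<epsilon> / 2" using \<epsilon>0 by simp
    show "\<epsilon> / 2 * real n ^ card ?V \<le> card \<F>"
      unfolding \<F>_def by (rule many_rich_maps[OF \<Gamma> d n fV V_ne \<epsilon> n_large])
    show "0 < sqrt ((real n)\<^sup>2 * p ^ (t - 1))" using X by (simp del: real_sqrt_mult)
    show "sqrt ((real n)\<^sup>2 * p ^ (t - 1)) \<le> real n ^ card J * p ^ card {e \<in> ?E. e \<subseteq> J}"
      if "J \<subseteq> ?V" "{e \<in> ?E. e \<subseteq> J} \<noteq> {}" for J
      by (rule sparse_rate[OF sp p0 p(2) X that])
  qed
  finally show ?thesis .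
qed

text \<open>The error is found before the graph is given and does not depend on it, so any sequence
  of dense graphs can be inserted afterwards.\<close>

lemma perturbed_ramsey_likely:
  assumes t: "t \<ge> 5" and d: "d > 0"
  shows "\<exists>err. (err \<longlongrightarrow> 0) (regime t) \<and> (\<forall>\<^sub>F x in regime t. \<forall>\<Gamma>. simple_graph \<Gamma> \<longrightarrow> vertices \<Gamma> = {1..fst x} \<longrightarrow>
    d \<le> density \<Gamma> \<longrightarrow> pr (nsets {1..fst x} 2) (snd x)
      (\<lambda>E. \<not> ramsey_graph (complete_graph t) G (graph_union \<Gamma> \<lparr>vertices = {1..fst x}, edges = E\<rparr>)) \<le> err x)"
proof -
  let ?V = "pattern_V t" and ?E = "pattern_E t"
  define \<epsilon> where "\<epsilon> = (d / 8) ^ (card ?V + 1) / 2"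
  define \<delta> where "\<delta> = \<epsilon> / 2 ^ card ?V"
  have \<epsilon>0: "\<epsilon> > 0" unfolding \<epsilon>_def using d by simp
  then have \<delta>0: "\<delta> > 0" by (simp add: \<delta>_def)
  have fV: "finite ?V" using sparse_pattern[OF t] by (simp add: sparse_def)
  have "Inl 1 \<in> ?V" using t by (simp add: pattern_V_def)
  then have kpos: "card ?V > 0" using fV by (auto simp: card_gt_0_iff)
  define c where "c = (\<epsilon> / 2) / (2 * (2 * card ?V) ^ card ?V)"
  have c: "c > 0" using \<epsilon>0 kpos by (simp add: c_def)
  define err where "err = (\<lambda>(n, p). exp (- (c * sqrt ((real n)\<^sup>2 * p ^ (t - 1)))) +
     (pr (nsets {1..n} 2) p (\<lambda>E. \<not> cliques_everywhere (t - 1) n \<delta> E) +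
      pr (nsets {1..n} 2) p (\<lambda>E. \<not> ramsey_everywhere (t - 2) n \<delta> E)))"
  have "(err \<longlongrightarrow> 0) (regime t)"
  proof -
    have "filterlim (\<lambda>x. c * (case x of (n, p) \<Rightarrow> sqrt ((real n)\<^sup>2 * p ^ (t - 1)))) at_top (regime t)"
      by (rule filterlim_tendsto_pos_mult_at_top[OF tendsto_const c filterlim_regime_sqrt])
    then have "filterlim (\<lambda>x. - (c * (case x of (n, p) \<Rightarrow> sqrt ((real n)\<^sup>2 * p ^ (t - 1))))) at_bot (regime t)"
      by (simp only: filterlim_uminus_at_bot minus_minus)
    from tendsto_add[OF filterlim_compose[OF exp_at_bot this]
        tendsto_add[OF cliques_everywhere_likely[OF t \<delta>0] ramsey_everywhere_likely[OF t \<delta>0]]]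
    show ?thesis unfolding err_def case_prod_unfold by (simp only: add_0_right)
  qed
  moreover have "\<forall>\<^sub>F x in regime t. \<forall>\<Gamma>. simple_graph \<Gamma> \<longrightarrow> vertices \<Gamma> = {1..fst x} \<longrightarrow>
    d \<le> density \<Gamma> \<longrightarrow> pr (nsets {1..fst x} 2) (snd x)
      (\<lambda>E. \<not> ramsey_graph (complete_graph t) G (graph_union \<Gamma> \<lparr>vertices = {1..fst x}, edges = E\<rparr>)) \<le> err x"
    using regime_prob filterlim_regime_main[of t, unfolded filterlim_at_top, rule_format, of 1]
      filterlim_regime_n[OF t, unfolded filterlim_at_top, rule_format, of "2 + 2 * (real (card ?V))\<^sup>2 / \<epsilon> + (real D + 1) / \<delta>"]
  proof eventually_elim
    case (elim x)
    obtain n p where x: "x = (n, p)" by (cases x)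
    have p: "0 \<le> p" "p \<le> 1" and X: "1 \<le> (real n)\<^sup>2 * p ^ (t - 1)"
      and nL: "2 + 2 * (real (card ?V))\<^sup>2 / \<epsilon> + (real D + 1) / \<delta> \<le> real n"
      using elim by (simp_all add: x)
    \<comment> \<open>The three summands of the lower bound on n serve, in this order, to make
      density a genuine quotient, to make most rich maps injective, and to make the popular class
      larger than \<open>D\<close>.\<close>
    have nonneg: "0 \<le> 2 * (real (card ?V))\<^sup>2 / \<epsilon>" "0 \<le> (real D + 1) / \<delta>" using \<epsilon>0 \<delta>0 by simp_all
    have "2 \<le> real n" using nL nonneg by linarith
    then have n2: "n \<ge> 2" by simp
    have "2 * (real (card ?V))\<^sup>2 / \<epsilon> \<le> real n" using nL nonneg by linarith
    then have n_large: "2 * (real (card ?V))\<^sup>2 \<le> \<epsilon> * real n" using \<epsilon>0 by (simp add: divide_le_eq mult.commute)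
    have "(real D + 1) / \<delta> \<le> real n" using nL nonneg by linarith
    then have n_D: "real D < \<delta> * real n" using \<delta>0 by (simp add: divide_le_eq mult.commute)
    show ?case
      unfolding x fst_conv snd_conv
    proof (intro allI impI)
      fix \<Gamma> assume \<Gamma>: "simple_graph \<Gamma>" "vertices \<Gamma> = {1..n}" "d \<le> density \<Gamma>"
      let ?miss = "\<lambda>E. \<forall>\<phi>. inj_on \<phi> ?V \<longrightarrow> \<phi> ` ?V \<subseteq> {1..n} \<longrightarrow>
          \<epsilon> * real n \<le> card (common_nbrs \<Gamma> (\<phi> ` ?V)) \<longrightarrow> \<not> (`) \<phi> ` ?E \<subseteq> E"
      let ?bad = "\<lambda>E. \<not> cliques_everywhere (t - 1) n \<delta> E \<or> \<not> ramsey_everywhere (t - 2) n \<delta> E"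
      have "pr (nsets {1..n} 2) p (\<lambda>E. \<not> ramsey_graph (complete_graph t) G (graph_union \<Gamma> \<lparr>vertices = {1..n}, edges = E\<rparr>))
          \<le> pr (nsets {1..n} 2) p ?miss + pr (nsets {1..n} 2) p ?bad"
      proof (rule pr_disj_le[OF p])
        fix E assume E: "E \<subseteq> nsets {1..n} 2"
          and not: "\<not> ramsey_graph (complete_graph t) G (graph_union \<Gamma> \<lparr>vertices = {1..n}, edges = E\<rparr>)"
        show "?miss E \<or> ?bad E"
        proof (rule disjCI)
          assume nbad: "\<not> ?bad E"
          show "?miss E"
          proof (intro allI impI notI)
            fix \<phi> assume \<phi>: "inj_on \<phi> ?V" "\<phi> ` ?V \<subseteq> {1..n}" "\<epsilon> * real n \<le> card (common_nbrs \<Gamma> (\<phi> ` ?V))" "(`) \<phi> ` ?E \<subseteq> E"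
            have "ramsey_graph (complete_graph t) G (graph_union \<Gamma> \<lparr>vertices = {1..n}, edges = E\<rparr>)"
              by (rule ramsey_from_pattern[OF t \<Gamma>(1,2) E \<phi> \<delta>_def n_D]) (use nbad in simp_all)
            then show False using not by contradiction
          qed
        qed
      qed
      also have "pr (nsets {1..n} 2) p ?miss \<le> exp (- (c * sqrt ((real n)\<^sup>2 * p ^ (t - 1))))"
        using pattern_appears[OF t \<Gamma> d n2 \<epsilon>_def n_large p X] by (simp add: c_def del: real_sqrt_mult)
      also have "pr (nsets {1..n} 2) p ?bad \<le> pr (nsets {1..n} 2) p (\<lambda>E. \<not> cliques_everywhere (t - 1) n \<delta> E) +
          pr (nsets {1..n} 2) p (\<lambda>E. \<not> ramsey_everywhere (t - 2) n \<delta> E)"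
        by (rule pr_disj_le[OF p])
      finally show "pr (nsets {1..n} 2) p (\<lambda>E. \<not> ramsey_graph (complete_graph t) G (graph_union \<Gamma> \<lparr>vertices = {1..n}, edges = E\<rparr>))
          \<le> err (n, p)"
        by (simp only: err_def case_prod_conv)
    qed
  qed
  ultimately show ?thesis by blast
qed

end

section \<open>From the threshold function to the regime\<close>

lemma threshold_power:
  assumes "t \<ge> 2" "n \<ge> 1"
  shows "(real n)\<^sup>2 * (real n powr (- 2 / (real t - 1))) ^ (t - 1) = 1"
proof -
  have "(real n powr (- 2 / (real t - 1))) ^ (t - 1) = real n powr (real (t - 1) * (- 2 / (real t - 1)))"
    using assms by (subst powr_power) auto
  also have "real (t - 1) * (- 2 / (real t - 1)) = - 2"
  proof -
    have eq: "real (t - 1) = real t - 1" using assms by (simp add: of_nat_diff)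
    have cancel: "k * (- 2 / k) = - 2" if "k \<noteq> 0" for k :: real using that by simp
    show ?thesis unfolding eq by (rule cancel) (use assms in simp)
  qed
  also have "real n powr (- 2) = inverse ((real n)\<^sup>2)" using assms by (simp add: powr_minus)
  finally show ?thesis using assms by simp
qed

text \<open>The function f satisfies n^2 f^(t-1) = 1, so p \<ge> b f makes n^2 p^(t-1) at least
  b^(t-1).\<close>

lemma filterlim_regime_smallomega:
  assumes t: "t \<ge> 2" and p: "\<And>n. 0 \<le> p n \<and> p n \<le> 1" and \<omega>: "p \<in> \<omega>(\<lambda>n. real n powr (- 2 / (real t - 1)))"
  shows "filterlim (\<lambda>n. (n, p n)) (regime t) sequentially"
  unfolding filterlim_def le_filter_def eventually_filtermap
proof (intro allI impI)
  fix P assume "eventually P (regime t)"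
  then obtain L where L: "\<And>n p. 0 \<le> p \<Longrightarrow> p \<le> 1 \<Longrightarrow> L \<le> (real n)\<^sup>2 * p ^ (t - 1) \<Longrightarrow> P (n, p)"
    unfolding eventually_regime by blast
  \<comment> \<open>At least 1, so that b^(t-1) is no smaller than b.\<close>
  define b where "b = max 1 L"
  have b: "b \<ge> 1" "L \<le> b" by (auto simp: b_def)
  have "\<forall>\<^sub>F n in sequentially. norm (p n) \<ge> b * norm (real n powr (- 2 / (real t - 1)))"
    using b by (intro landau_omega.smallD[OF \<omega>]) auto
  then show "\<forall>\<^sub>F n in sequentially. P (n, p n)"
    using eventually_ge_at_top[of 1]
  proof eventually_elim
    case (elim n)
    let ?f = "real n powr (- 2 / (real t - 1))"
    have ge: "b * ?f \<le> p n" using elim(1) p[of n] by simp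
    have "L \<le> b ^ 1" using b by simp
    also have "\<dots> \<le> b ^ (t - 1)" using b t by (intro power_increasing) auto
    also have "\<dots> = (real n)\<^sup>2 * (b * ?f) ^ (t - 1)"
      using threshold_power[OF t elim(2)] by (simp add: power_mult_distrib)
    also have "\<dots> \<le> (real n)\<^sup>2 * p n ^ (t - 1)"
      using ge b by (intro mult_left_mono power_mono) auto
    finally show ?case using L p by blast
  qed
qed

lemma one_statement:
  assumes G: "tree_plus_vertex T v S u c" and t: "t \<ge> 5" and d: "d > 0"
    and p: "\<And>n. 0 \<le> p n \<and> p n \<le> 1" and \<omega>: "p \<in> \<omega>(\<lambda>n. real n powr (- 2 / (real t - 1)))"
    and \<Gamma>: "dense_graph_sequence d \<Gamma>"
  shows "with_high_probability (\<lambda>n. binomial_random_graph n (p n))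
    (\<lambda>n R. ramsey_graph (complete_graph t) (add_vertex T v S) (graph_union (\<Gamma> n) R))"
proof (rule with_high_probability_binomial[OF p])
  interpret tree_plus_vertex T v S u c by (rule G)
  let ?fail = "\<lambda>n. pr (nsets {1..n} 2) (p n) (\<lambda>E. \<not> ramsey_graph (complete_graph t) G (graph_union (\<Gamma> n) \<lparr>vertices = {1..n}, edges = E\<rparr>))"
  obtain err where err: "(err \<longlongrightarrow> 0) (regime t)"
    and bound: "\<forall>\<^sub>F x in regime t. \<forall>\<Gamma>. simple_graph \<Gamma> \<longrightarrow> vertices \<Gamma> = {1..fst x} \<longrightarrow>
    d \<le> density \<Gamma> \<longrightarrow> pr (nsets {1..fst x} 2) (snd x)
      (\<lambda>E. \<not> ramsey_graph (complete_graph t) G (graph_union \<Gamma> \<lparr>vertices = {1..fst x}, edges = E\<rparr>)) \<le> err x"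
    using perturbed_ramsey_likely[OF t d] by blast
  have lim: "filterlim (\<lambda>n. (n, p n)) (regime t) sequentially"
    using t by (intro filterlim_regime_smallomega[OF _ p \<omega>]) simp
  show "?fail \<longlonglongrightarrow> 0"
  proof (rule tendsto_sandwich[OF _ _ tendsto_const filterlim_compose[OF err lim]])
    show "\<forall>\<^sub>F n in sequentially. 0 \<le> ?fail n"
      using p by (intro always_eventually allI expect_nonneg) auto
    \<comment> \<open>The density bound on the sequence is imposed from n = 2 onwards only.\<close>
    show "\<forall>\<^sub>F n in sequentially. ?fail n \<le> err (n, p n)"
      using eventually_compose_filterlim[OF bound lim] eventually_ge_at_top[of 2]
    proof eventually_elim
      case (elim n)
      then show ?case using \<Gamma> by (auto simp: dense_graph_sequence_def)
    qed
  qed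
qed

section \<open>The lower bound\<close>

definition balanced_bipartite :: "nat \<Rightarrow> nat graph" where
  "balanced_bipartite n = \<lparr>vertices = {1..n}, edges = (\<lambda>(a, b). {a, b}) ` ({1..n div 2} \<times> {n div 2 + 1..n})\<rparr>"

text \<open>Splitting n as evenly as possible gives at least n(n-1)/4 edges, that is, density at
  least 1/2 for every n and not only in the limit. This is where d \<le> 1/2 is used.\<close>

lemma dense_balanced_bipartite:
  assumes "d \<le> 1 / 2"
  shows "dense_graph_sequence d balanced_bipartite"
  unfolding dense_graph_sequence_def
proof (intro allI conjI impI)
  fix n :: nat
  let ?A = "{1..n div 2}" and ?B = "{n div 2 + 1..n}"
  show "vertices (balanced_bipartite n) = {1..n}" by (simp add: balanced_bipartite_def)
  show "simple_graph (balanced_bipartite n)"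
    by (auto simp: simple_graph_def balanced_bipartite_def)
  assume n: "n \<ge> 2"
  have "inj_on (\<lambda>(a, b). {a, b}) (?A \<times> ?B)"
    by (auto simp: inj_on_def doubleton_eq_iff)
  then have "card (edges (balanced_bipartite n)) = (n div 2) * (n - n div 2)"
    by (simp add: balanced_bipartite_def card_image card_cartesian_product)
  moreover have "n * (n - 1) \<le> 4 * ((n div 2) * (n - n div 2))"
  proof (cases "even n")
    case True
    then obtain m where "n = 2 * m" by (rule evenE)
    then show ?thesis by (simp add: algebra_simps)
  next
    case False
    then obtain m where "n = 2 * m + 1" by (rule oddE)
    then show ?thesis by (simp add: algebra_simps)
  qed
  ultimately have "2 * (n choose 2) \<le> 4 * card (edges (balanced_bipartite n))"
    by (simp add: two_times_choose_two)
  then have "n choose 2 \<le> 2 * card (edges (balanced_bipartite n))" by simp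
  then have "real (n choose 2) \<le> real (2 * card (edges (balanced_bipartite n)))" by (simp only: of_nat_le_iff)
  moreover have "0 < real (n choose 2)" using n by simp
  ultimately have "1 / 2 \<le> density (balanced_bipartite n)"
    unfolding density_def by (simp add: balanced_bipartite_def le_divide_eq)
  then show "d \<le> density (balanced_bipartite n)" using assms by simp
qed

text \<open>A blue copy of the target graph would be bipartite. Recording the side of each image
  2-colours \<open>T\<close> properly and puts all neighbours of \<open>v\<close> on the side
  opposite to \<open>v\<close>, contrary to the hypothesis on colourings.\<close>

lemma not_ramsey_balanced_bipartite:
  fixes n :: nat
  assumes S: "v \<notin> vertices T"
    and no_col: "\<not> (\<exists>c :: 'a \<Rightarrow> bool. proper_coloring T c \<and> monochromatic_on c S)"
    and E: "\<And>K. K \<subseteq> {1..n} \<Longrightarrow> finite K \<Longrightarrow> card K = t \<Longrightarrow> \<not> nsets K 2 \<subseteq> E"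
  shows "\<not> ramsey_graph (complete_graph t) (add_vertex (T :: 'a graph) v S)
     (graph_union (balanced_bipartite n) \<lparr>vertices = {1..n}, edges = E\<rparr>)"
proof
  let ?\<Gamma> = "balanced_bipartite n" and ?A = "{1..n div 2}"
  \<comment> \<open>Edges lying in both graphs are blue, so every red edge is a random one outside
    the bipartite graph.\<close>
  define col where "col = (\<lambda>e. if e \<in> edges ?\<Gamma> then Blue else Red)"
  let ?U = "graph_union ?\<Gamma> \<lparr>vertices = {1..n}, edges = E\<rparr>"
  assume "ramsey_graph (complete_graph t) (add_vertex T v S) ?U"
  then consider "contains_copy (color_class ?U col Red) (complete_graph t)"
    | "contains_copy (color_class ?U col Blue) (add_vertex T v S)"
    unfolding ramsey_graph_def by blast
  then show False
  proof cases
    case 1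
    then obtain K where "K \<subseteq> {1..n}" "finite K" "card K = t" "nsets K 2 \<subseteq> {e \<in> edges ?\<Gamma> \<union> E. col e = Red}"
      unfolding contains_complete_iff by (auto simp: color_class_def graph_union_def balanced_bipartite_def)
    moreover have "{e \<in> edges ?\<Gamma> \<union> E. col e = Red} \<subseteq> E" by (auto simp: col_def split: if_splits)
    ultimately show False using E by blast
  next
    case 2
    then obtain f where f: "\<And>e. e \<in> edges (add_vertex T v S) \<Longrightarrow> f ` e \<in> {e \<in> edges ?\<Gamma> \<union> E. col e = Blue}"
      by (auto simp: contains_copy_def color_class_def graph_union_def)
    have f_edge: "f ` e \<in> edges ?\<Gamma>" if "e \<in> edges (add_vertex T v S)" for e
      using f[OF that] by (auto simp: col_def split: if_splits)
    have cross: "(f x \<in> ?A) \<noteq> (f y \<in> ?A)" if xy: "{x, y} \<in> edges (add_vertex T v S)" for x y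
    proof -
      have "{f x, f y} \<in> edges ?\<Gamma>" using f_edge[OF xy] by simp
      then obtain a b where "{f x, f y} = {a, b}" "a \<in> ?A" "b \<in> {n div 2 + 1..n}"
        by (auto simp: balanced_bipartite_def)
      then show ?thesis by (auto simp: doubleton_eq_iff)
    qed
    have "proper_coloring T (\<lambda>x. f x \<in> ?A)"
      unfolding proper_coloring_def using cross by (simp add: add_vertex_def)
    moreover have "monochromatic_on (\<lambda>x. f x \<in> ?A) S"
    proof -
      have "(f x \<in> ?A) = (f v \<notin> ?A)" if "x \<in> S" for x
      proof -
        have "{v, x} \<in> edges (add_vertex T v S)" using that by (auto simp: add_vertex_def)
        then show ?thesis using cross by blast
      qed
      then show ?thesis by (simp add: monochromatic_on_def)
    qed
    ultimately show False using no_col by blast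
  qed
qed

text \<open>First moment: the expected number of cliques is at most n^t p^(t choose 2), which equals
  (n^2 p^(t-1))^(t/2).\<close>

lemma clique_unlikely:
  assumes t: "t \<ge> 2" and p: "0 \<le> p" "p \<le> 1"
  shows "pr (nsets {1..n} 2) p (\<lambda>E. \<exists>K\<subseteq>{1..n}. finite K \<and> card K = t \<and> nsets K 2 \<subseteq> E)
    \<le> sqrt ((real n)\<^sup>2 * p ^ (t - 1)) ^ t"
proof -
  let ?P = "nsets {1..n} 2"
  let ?I = "{K. K \<subseteq> {1..n} \<and> card K = t}"
  have fI: "finite ?I" by (rule finite_subset[of _ "Pow {1..n}"]) auto
  have "pr ?P p (\<lambda>E. \<exists>K\<subseteq>{1..n}. finite K \<and> card K = t \<and> nsets K 2 \<subseteq> E) \<le> (\<Sum>K\<in>?I. pr ?P p (\<lambda>E. nsets K 2 \<subseteq> E))"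
    by (rule pr_union_bound[OF p fI]) blast
  also have "\<dots> = (\<Sum>K\<in>?I. p ^ (t choose 2))"
  proof (rule sum.cong[OF refl])
    fix K assume K: "K \<in> ?I"
    then have fK: "finite K" using finite_subset by auto
    have "nsets K 2 = {e. e \<subseteq> K \<and> card e = 2}"
      using fK finite_subset by (auto simp: nsets_def)
    then have "card (nsets K 2) = t choose 2" using n_subsets[OF fK, of 2] K by simp
    then show "pr ?P p (\<lambda>E. nsets K 2 \<subseteq> E) = p ^ (t choose 2)"
      using K by (subst pr_superset[OF finite_pairs]) (auto intro: nsets_mono[THEN subsetD])
  qed
  also have "\<dots> = real (n choose t) * p ^ (t choose 2)" by (simp add: n_subsets)
  also have "\<dots> \<le> real n ^ t * p ^ (t choose 2)"
  proof (rule mult_right_mono)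
    have "n choose t \<le> n ^ t" by (cases "t \<le> n") (auto intro: binomial_le_pow simp: not_le binomial_eq_0)
    then have "real (n choose t) \<le> real (n ^ t)" by (simp only: of_nat_le_iff)
    then show "real (n choose t) \<le> real n ^ t" by simp
  qed (use p in simp)
  also have "\<dots> = sqrt (((real n)\<^sup>2 * p ^ (t - 1)) ^ t)"
  proof -
    have "((real n)\<^sup>2 * p ^ (t - 1)) ^ t = (real n)\<^sup>2 ^ t * p ^ ((t - 1) * t)"
      by (simp add: power_mult_distrib power_mult)
    also have "(t - 1) * t = 2 * (t choose 2)" by (simp add: two_times_choose_two)
    also have "(real n)\<^sup>2 ^ t * p ^ (2 * (t choose 2)) = (real n ^ t * p ^ (t choose 2))\<^sup>2"
      by (simp add: power_mult_distrib power_mult[symmetric] mult.commute)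
    finally show ?thesis using p by (simp add: real_sqrt_unique)
  qed
  also have "\<dots> = sqrt ((real n)\<^sup>2 * p ^ (t - 1)) ^ t" by (rule real_sqrt_power)
  finally show ?thesis .
qed

text \<open>The same bipartite graphs work for every p below the threshold: whp there is no random
  K_t, and then the colouring by membership in the bipartite graph has neither a red nor a blue
  copy.\<close>

lemma zero_statement:
  assumes t: "t \<ge> 2" and v: "v \<notin> vertices T"
    and no_col: "\<not> (\<exists>c :: 'a \<Rightarrow> bool. proper_coloring T c \<and> monochromatic_on c S)"
    and p: "\<And>n. 0 \<le> p n \<and> p n \<le> 1" and o: "p \<in> o(\<lambda>n. real n powr (- 2 / (real t - 1)))"
  shows "with_high_probability (\<lambda>n. binomial_random_graph n (p n))
    (\<lambda>n R. \<not> ramsey_graph (complete_graph t) (add_vertex (T :: 'a graph) v S) (graph_union (balanced_bipartite n) R))"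
proof (rule with_high_probability_binomial[OF p], unfold not_not)
  let ?f = "\<lambda>n. real n powr (- 2 / (real t - 1))"
  let ?bad = "\<lambda>n. pr (nsets {1..n} 2) (p n) (\<lambda>E. ramsey_graph (complete_graph t) (add_vertex T v S)
     (graph_union (balanced_bipartite n) \<lparr>vertices = {1..n}, edges = E\<rparr>))"
  have "(\<lambda>n. (p n / ?f n) ^ (t - 1)) \<longlonglongrightarrow> 0 ^ (t - 1)"
    by (intro tendsto_power smalloD_tendsto[OF o])
  from tendsto_power[OF tendsto_real_sqrt[OF this], of t]
  have "(\<lambda>n. sqrt ((p n / ?f n) ^ (t - 1)) ^ t) \<longlonglongrightarrow> sqrt (0 ^ (t - 1)) ^ t" .
  then have lim: "(\<lambda>n. sqrt ((p n / ?f n) ^ (t - 1)) ^ t) \<longlonglongrightarrow> 0"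
    using t by (simp add: power_0_left)
  show "?bad \<longlonglongrightarrow> 0"
  proof (rule tendsto_sandwich[OF _ _ tendsto_const lim])
    show "\<forall>\<^sub>F n in sequentially. 0 \<le> ?bad n"
      using p by (intro always_eventually allI expect_nonneg) auto
    show "\<forall>\<^sub>F n in sequentially. ?bad n \<le> sqrt ((p n / ?f n) ^ (t - 1)) ^ t"
      using eventually_ge_at_top[of 1]
    proof eventually_elim
      case (elim n)
      have "?bad n \<le> pr (nsets {1..n} 2) (p n) (\<lambda>E. \<exists>K\<subseteq>{1..n}. finite K \<and> card K = t \<and> nsets K 2 \<subseteq> E)"
      proof (rule pr_mono)
        fix E assume "ramsey_graph (complete_graph t) (add_vertex T v S)
          (graph_union (balanced_bipartite n) \<lparr>vertices = {1..n}, edges = E\<rparr>)"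
        then show "\<exists>K\<subseteq>{1..n}. finite K \<and> card K = t \<and> nsets K 2 \<subseteq> E"
          using not_ramsey_balanced_bipartite[OF v no_col, of n t E] by blast
      qed (use p in auto)
      also have "\<dots> \<le> sqrt ((real n)\<^sup>2 * p n ^ (t - 1)) ^ t"
        using p by (intro clique_unlikely[OF t]) auto
      \<comment> \<open>Since n^2 f^(t-1) = 1, the factor n^2 is the reciprocal of f^(t-1).\<close>
      also have "(real n)\<^sup>2 * p n ^ (t - 1) = (p n / ?f n) ^ (t - 1)"
        using threshold_power[OF t elim] elim
        by (simp add: power_divide eq_divide_eq)
      finally show ?case .
    qed
  qed
qed

theorem corollary4p3:
  fixes T G :: "'a graph" and v :: 'a and S :: "'a set" and t :: nat and d :: real
  assumes "tree T" and "card (vertices T) \<ge> 4"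
    and "v \<notin> vertices T" and "S \<subseteq> vertices T" and "G = add_vertex T v S"
    and "\<not> (\<exists>c :: 'a \<Rightarrow> bool. proper_coloring T c \<and> monochromatic_on c (neighborhood G v))"
    and "\<exists>u \<in> neighborhood G v. \<exists>c :: 'a \<Rightarrow> bool.
           proper_coloring T c \<and> monochromatic_on c (neighborhood G v - {u})"
    and "t \<ge> 5" and "0 < d" and "d \<le> 1 / 2"
  shows "perturbed_ramsey_threshold (complete_graph t) G d
           (\<lambda>n. real n powr (- 2 / (real t - 1)))"
proof -
  have edges_T: "edges T \<subseteq> nsets (vertices T) 2"
    using assms(1) by (simp add: tree_def simple_graph_def)
  have nbhd: "neighborhood G v = S"
  proof
    show "neighborhood G v \<subseteq> S"
    proof
      fix w assume "w \<in> neighborhood G v"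
      then have "{v, w} \<in> edges T \<or> (\<exists>x\<in>S. {v, w} = {v, x})"
        by (auto simp: neighborhood_def assms(5) add_vertex_def)
      moreover have "{v, w} \<notin> edges T" using edges_T assms(3) by (auto simp: nsets_def)
      ultimately show "w \<in> S" by (auto simp: doubleton_eq_iff)
    qed
    show "S \<subseteq> neighborhood G v" by (auto simp: neighborhood_def assms(5) add_vertex_def)
  qed
  note no_col = assms(6)[unfolded nbhd]
  obtain u c where u: "u \<in> S" and c: "proper_coloring T (c :: 'a \<Rightarrow> bool)" "monochromatic_on c (S - {u})"
    using assms(7) unfolding nbhd by blast
  \<comment> \<open>The colouring is constant on \<open>S\<close> without \<open>u\<close>. If some
    colour there agreed with that of \<open>u\<close>, it would be constant on all of
    \<open>S\<close>, which is excluded; so \<open>u\<close> has the opposite colour.\<close>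
  have "tree_plus_vertex T v S u c"
  proof
    fix x assume x: "x \<in> S" "x \<noteq> u"
    show "c x \<noteq> c u"
    proof
      assume eq: "c x = c u"
      have "c y = c u" if "y \<in> S" for y
      proof (cases "y = u")
        case False
        then have "c y = c x"
          using c(2)[unfolded monochromatic_on_def, rule_format, of y x] x that by simp
        then show ?thesis using eq by simp
      qed simp
      then have "monochromatic_on c S" unfolding monochromatic_on_def by metis
      then show False using no_col c(1) by blast
    qed
  qed (use assms(1,3,4) u c in auto)
  note G = this
  have t: "t \<ge> 2" using assms(8) by simp
  show ?thesis
    unfolding perturbed_ramsey_threshold_def assms(5)
  proof (intro conjI allI impI, goal_cases)
    case (1 p \<Gamma>)
    then show ?case by (intro one_statement[OF G assms(8,9)]) auto
  next
    case (2 p)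
    then show ?case
      using zero_statement[OF t assms(3) no_col, of p] dense_balanced_bipartite[OF assms(10)] by blast
  qed
qed

end
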